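(* Let $n\ge1$, let $f:\mathbb{C}^n\to\mathbb{C}^n$ be a square system of analytic functions, let $y\in\mathbb{C}^n$, and let $V\subset\mathbb{C}^n$ be a linear subspace of dimension $\kappa$. Define $$g(x)=f(x)-f(y)-Df(y)\,\pi_V(x-y),$$ where $\pi_V$ is the orthogonal projection of $\mathbb{C}^n$ onto $V$. Let $A:\mathbb{C}^n\to\mathbb{C}^n$ be an invertible affine map such that $(g\circ A)(0)=0$ and $\ker D(g\circ A)(0)=\langle e_1,\dots,e_\kappa\rangle$. Let $S_\kappa:\mathbb{C}^n\to\mathbb{C}^n$ be the inflation map $$S_\kappa(x_1,\dots,x_n)=(x_1,\dots,x_\kappa,x_{\kappa+1}^2,\dots,x_n^2),$$ and let $Q:\mathbb{C}^n\to\mathbb{C}^n$ be the quadratic part of $g\circ A\circ S_\kappa$. Suppose that there exist real numbers $c>0$ and $\varepsilon>0$ such that (1) $\|(f\circ A\circ S_\kappa)(x)-Q(x)\|\le c\,\varepsilon^2$ for every $x\in\mathbb{C}^n$ with $\|x\|=\varepsilon$, and (2) $\|Q(x)\|\ge c$ for every $x\in\mathbb{C}^n$ with $\|x\|=1$. Then $f$ has $2^\kappa$ zeros, counted with multiplicity, in $A\big(\mathbb{B}^{(\kappa)}_\varepsilon\big)$, where $\mathbb{B}^{(\kappa)}_\varepsilon\subset\mathbb{C}^n$ is the ball of radius $\varepsilon$ centered at $0$ in the mixed norm $$\|x\|_{(\kappa)}=\sqrt{\sum_{i=1}^{\kappa}|x_i|^2+\sum_{i=\kappa+1}^{n}|x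_i|}.$$
   Context: $\|\cdot\|$ denotes the Euclidean (Hermitian) norm on $\mathbb{C}^n$, orthogonality is with respect to the standard Hermitian inner product, $Df(y)$ is the complex Jacobian of $f$ at $y$, $e_1,\dots,e_n$ are the standard basis vectors of $\mathbb{C}^n$, and $\langle\cdot\rangle$ denotes complex linear span. The quadratic part of an analytic map $h:\mathbb{C}^n\to\mathbb{C}^n$ is the homogeneous degree $2$ part of its Taylor expansion at the origin. The multiplicity of an isolated zero $z$ of an analytic map $f:\mathbb{C}^n\to\mathbb{C}^n$ is the number of zeros near $z$ after a generic perturbation of $f$. "Mixed norm" is only a name: $\|\cdot\|_{(\kappa)}$ is not homogeneous in general.
   Formalization: The exact count can fail under the non-strict bound (1) (x²−x³ has 3 zeros in the closed unit disc, x²−1 none in the open one); proved: the closed ball's image has at least 2^κ zeros (non-isolated ones count as infinite), exactly 2^κ if f has no zero on the image of the mixed sphere. *)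

theory Defs
  imports "HOL-Analysis.Analysis" "HOL-Library.Extended_Nat"
begin

section \<open>Analytic maps of several complex variables\<close>

definition cpartial :: "'n::finite \<Rightarrow> (complex^'n \<Rightarrow> complex) \<Rightarrow> complex^'n \<Rightarrow> complex" where
  "cpartial j u z = deriv (\<lambda>t. u (z + t *s axis j 1)) 0"

definition cjacobian :: "(complex^'n \<Rightarrow> complex^'n) \<Rightarrow> complex^'n \<Rightarrow> complex^'n^'n::finite" where
  "cjacobian f z = (\<chi> i j. cpartial j (\<lambda>x. f x $ i) z)"

text \<open>Analyticity on the whole space means complex Frechet differentiability everywhere, in line
  with the one-variable notion of the library: \<open>has_derivative\<close> alone only gives a
  real-linear derivative, so it is required to be multiplication by a complex matrix.\<close>

definition analytic_map :: "(complex^'n \<Rightarrow> complex^'n::finite) \<Rightarrow> bool" where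
  "analytic_map f \<longleftrightarrow> (\<forall>z. \<exists>M::complex^'n^'n. (f has_derivative (\<lambda>v. M *v v)) (at z))"

text \<open>The degree 2 part of the Taylor expansion at the origin. Summing over ordered pairs of indices
  and halving is the same as summing the Taylor terms over the monomials of degree 2.\<close>

definition quadratic_part :: "(complex^'n \<Rightarrow> complex^'n) \<Rightarrow> complex^'n \<Rightarrow> complex^'n::finite" where
  "quadratic_part h x =
     (\<chi> i. (\<Sum>j\<in>UNIV. \<Sum>k\<in>UNIV. cpartial j (cpartial k (\<lambda>z. h z $ i)) 0 * x $ j * x $ k) / 2)"


section \<open>Hermitian geometry and affine maps\<close>

definition hermitian_inner :: "complex^'n \<Rightarrow> complex^'n::finite \<Rightarrow> complex" where
  "hermitian_inner u v = (\<Sum>i\<in>UNIV. u $ i * cnj (v $ i))"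

text \<open>Meant for a complex linear subspace \<open>V\<close>.\<close>

definition orth_proj :: "(complex^'n) set \<Rightarrow> complex^'n \<Rightarrow> complex^'n::finite" where
  "orth_proj V x = (THE p. p \<in> V \<and> (\<forall>v\<in>V. hermitian_inner (x - p) v = 0))"

definition invertible_affine :: "(complex^'n \<Rightarrow> complex^'n::finite) \<Rightarrow> bool" where
  "invertible_affine A \<longleftrightarrow> (\<exists>(M::complex^'n^'n) b. invertible M \<and> A = (\<lambda>x. M *v x + b))"


section \<open>Multiplicities and numbers of zeros\<close>

definition isolated_zero :: "(complex^'n \<Rightarrow> complex^'n::finite) \<Rightarrow> complex^'n \<Rightarrow> bool" where
  "isolated_zero f z \<longleftrightarrow> f z = 0 \<and> (\<forall>\<^sub>F x in at z. f x \<noteq> 0)"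

text \<open>\<open>m\<close> is the number of zeros near \<open>z\<close> after a generic perturbation of \<open>f\<close>. ``Near'' refers to
  an arbitrarily small ball around \<open>z\<close>; a perturbation is any analytic map uniformly close to \<open>f\<close> on
  that ball, and it is generic if all its zeros in the ball are nondegenerate. By Sard's theorem
  there are generic perturbations arbitrarily close to \<open>f\<close> (subtract small regular
  values), so for an isolated zero there is at most one such \<open>m\<close>.\<close>

definition generic_zero_number ::
    "(complex^'n \<Rightarrow> complex^'n::finite) \<Rightarrow> complex^'n \<Rightarrow> nat \<Rightarrow> bool" where
  "generic_zero_number f z m \<longleftrightarrow>
     (\<exists>R>0. \<forall>r. 0 < r \<and> r \<le> R \<longrightarrow>
       (\<exists>\<delta>>0. \<forall>p. analytic_map p \<and> (\<forall>x\<in>ball z r. norm (p x - f x) < \<delta>) \<and>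
                   (\<forall>x\<in>ball z r. p x = 0 \<longrightarrow> invertible (cjacobian p x)) \<longrightarrow>
                 finite {x \<in> ball z r. p x = 0} \<and> card {x \<in> ball z r. p x = 0} = m))"

text \<open>A zero that is not isolated counts as infinitely many zeros.\<close>

definition zero_mult :: "(complex^'n \<Rightarrow> complex^'n::finite) \<Rightarrow> complex^'n \<Rightarrow> enat" where
  "zero_mult f z = (if isolated_zero f z then enat (THE m. generic_zero_number f z m) else \<infinity>)"

definition zero_count :: "(complex^'n \<Rightarrow> complex^'n::finite) \<Rightarrow> (complex^'n) set \<Rightarrow> enat" where
  "zero_count f E =
     (if finite {z \<in> E. f z = 0} then (\<Sum>z\<in>{z \<in> E. f z = 0}. zero_mult f z) else \<infinity>)"


section \<open>Inflation and the mixed norm\<close>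

text \<open>The coordinates of \<open>\<complex>\<^sup>n\<close> are indexed by a linearly ordered type with \<open>n\<close> elements;
  \<open>first_coords \<kappa>\<close> plays the role of \<open>{1, \<dots>, \<kappa>}\<close>.\<close>

definition first_coords :: "nat \<Rightarrow> 'n::{finite,linorder} set" where
  "first_coords \<kappa> = {i. card {j. j < i} < \<kappa>}"

definition inflation :: "nat \<Rightarrow> complex^'n::{finite,linorder} \<Rightarrow> complex^'n::{finite,linorder}" where
  "inflation \<kappa> x = (\<chi> i. if i \<in> first_coords \<kappa> then x $ i else (x $ i)\<^sup>2)"

definition mixed_norm :: "nat \<Rightarrow> complex^'n::{finite,linorder} \<Rightarrow> real" where
  "mixed_norm \<kappa> x =
     sqrt ((\<Sum>i\<in>first_coords \<kappa>. (norm (x $ i))\<^sup>2) + (\<Sum>i\<in>- first_coords \<kappa>. norm (x $ i)))"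

text \<open>The ball is closed. With the non-strict bound
  \<open>norm (f (A (S x)) - Q x) \<le> c * \<epsilon>\<^sup>2\<close> on the sphere, zeros may lie on the boundary of the ball:
  for \<open>n = \<kappa> = 1\<close>, \<open>A = id\<close>, \<open>y = 0\<close>, \<open>c = \<epsilon> = 1\<close>, the map \<open>x\<^sup>2 - 1\<close> has no zero in the open unit
  disc and two in the closed one, while \<open>x\<^sup>2 - x\<^sup>3\<close> has two in the open disc and three in the
  closed one. So neither ball gives the exact number in all cases: the closed ball contains at
  least \<open>2 ^ \<kappa>\<close> zeros, and exactly \<open>2 ^ \<kappa>\<close> when no zero lies on the boundary, in particular when
  the bound is strict.\<close>

definition mixed_ball :: "nat \<Rightarrow> real \<Rightarrow> (complex^'n::{finite,linorder}) set" where
  "mixed_ball \<kappa> \<epsilon> = {x. mixed_norm \<kappa> x \<le> \<epsilon>}"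

end

theory Submission
  imports Defs "HOL-Complex_Analysis.Conformal_Mappings"
begin

text \<open>The linear part of \<open>g \<circ> A \<circ> S\<^sub>\<kappa>\<close> does not enter \<open>Q\<close>, so \<open>Q = P \<circ> S\<^sub>\<kappa>\<close> where \<open>P\<close> is the sum of a
  quadratic map in the first \<open>\<kappa>\<close> coordinates and a linear map in the others, and \<open>S\<^sub>\<kappa>\<close> maps the
  \<open>\<epsilon>\<close>-sphere onto the mixed \<open>\<epsilon>\<close>-sphere. Hence (1) and (2) say that \<open>f \<circ> A\<close> is a Rouche perturbation
  of \<open>P\<close> on the mixed ball, and \<open>P\<close> vanishes only at the origin. No topological degree is used: the
  number of nondegenerate zeros in a linear pencil of analytic maps is constant by a maximum principle
  in the complex parameter, so every analytic map without zeros on the boundary of a bounded open set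
  has a well-defined generic number of zeros there, invariant under homotopy. For \<open>P\<close> this number is
  \<open>2\<^sup>\<kappa>\<close>, because \<open>P\<close> can be joined to a sum of squares of the first \<open>\<kappa>\<close> coordinates plus the same
  linear part without acquiring further zeros: the coefficients to be avoided form null sets.\<close>

section \<open>Analytic functions of several complex variables\<close>

text \<open>After inflation the model \<open>Q\<close> would count 2^n zeros, and the branching of
  \<open>inflation\<close> would have to be divided out; so the comparison is made before inflation,
  on the mixed ball, where \<open>P\<close> has the right count. The obstacle is degeneracy:
  \<open>f\<close> may have degenerate zeros and the zero of \<open>P\<close> at the origin may be
  degenerate, while branches of zeros can be followed only where they are nondegenerate. Sard's
  theorem supplies nondegenerate perturbations. Degenerate members between two of them are harmless
  because the pencil parameter is complex: a maximum principle compares two nondegenerate members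
  directly, and comparing both ways gives equality. Bound (1) is not strict, so zeros of
  \<open>f\<close> may sit on the boundary. Moving \<open>f\<close> slightly towards
  \<open>P\<close> makes the bound strict, but the zeros born from a boundary zero may fall on
  either side. Hence a lower bound in general, and equality when the boundary is free of
  zeros.\<close>

lemma has_derivative_vec_iff:
  fixes f :: "'a::real_normed_vector \<Rightarrow> 'b::euclidean_space^'n::finite"
  shows "(f has_derivative f') (at x within S) \<longleftrightarrow>
         (\<forall>i. ((\<lambda>x. f x $ i) has_derivative (\<lambda>v. f' v $ i)) (at x within S))"
proof
  assume "(f has_derivative f') (at x within S)"
  then show "\<forall>i. ((\<lambda>x. f x $ i) has_derivative (\<lambda>v. f' v $ i)) (at x within S)"
    using bounded_linear.has_derivative[OF bounded_linear_vec_nth] by blast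
next
  assume *: "\<forall>i. ((\<lambda>x. f x $ i) has_derivative (\<lambda>v. f' v $ i)) (at x within S)"
  show "(f has_derivative f') (at x within S)"
    unfolding has_derivative_componentwise_within[of f]
  proof
    fix b :: "'b^'n" assume "b \<in> Basis"
    then obtain k c where b: "b = axis k c"
      by (auto simp: Basis_vec_def)
    show "((\<lambda>x. f x \<bullet> b) has_derivative (\<lambda>x. f' x \<bullet> b)) (at x within S)"
      using * by (auto simp: b inner_axis intro!: has_derivative_inner_left)
  qed
qed

text \<open>Scalar counterpart of \<open>analytic_map\<close>, with the complex-linear derivative
  written as a row vector. A map is analytic iff its components are
  (\<open>analytic_map_iff\<close>), so the calculus is developed for scalar functions only.\<close>

definition analytic_fun :: "(complex^'n::finite \<Rightarrow> complex) \<Rightarrow> bool" where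
  "analytic_fun u \<longleftrightarrow> (\<forall>z. \<exists>a. (u has_derivative (\<lambda>v. \<Sum>j\<in>UNIV. a $ j * v $ j)) (at z))"

lemma has_derivative_line:
  fixes z v :: "complex^'n::finite" and t :: complex
  shows "((\<lambda>t. z + t *s v) has_derivative (\<lambda>t. t *s v)) (at t within S)"
  unfolding has_derivative_vec_iff
  by (auto intro!: derivative_eq_intros)

lemma line_has_field_derivative:
  fixes z v :: "complex^'n::finite"
  assumes "(u has_derivative (\<lambda>v. \<Sum>j\<in>UNIV. a $ j * v $ j)) (at (z + t *s v))"
  shows "((\<lambda>t. u (z + t *s v)) has_field_derivative (\<Sum>j\<in>UNIV. a $ j * v $ j)) (at t)"
proof -
  have "((\<lambda>t. u (z + t *s v)) has_derivative (\<lambda>h. \<Sum>j\<in>UNIV. a $ j * (h *s v) $ j)) (at t)"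
    using has_derivative_compose[OF has_derivative_line[of z v t UNIV],
        where g=u and g'="\<lambda>v. \<Sum>j\<in>UNIV. a $ j * v $ j"] assms by simp
  then show ?thesis
    unfolding has_field_derivative_def
    by (rule has_derivative_eq_rhs) (auto simp: fun_eq_iff sum_distrib_left mult_ac intro!: sum.cong)
qed

lemma cpartial_eqI:
  assumes "(u has_derivative (\<lambda>v. \<Sum>j\<in>UNIV. a $ j * v $ j)) (at z)"
  shows "cpartial j u z = a $ j"
proof -
  have "((\<lambda>t. u (z + t *s axis j 1)) has_field_derivative (\<Sum>k\<in>UNIV. a $ k * axis j 1 $ k)) (at 0)"
    by (rule line_has_field_derivative) (use assms in simp)
  then show ?thesis
    unfolding cpartial_def by (simp add: DERIV_imp_deriv axis_def if_distrib if_distribR cong: if_cong)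
qed

lemma analytic_fun_has_derivative:
  assumes "analytic_fun u"
  shows "(u has_derivative (\<lambda>v. \<Sum>j\<in>UNIV. cpartial j u z * v $ j)) (at z)"
proof -
  obtain a where a: "(u has_derivative (\<lambda>v. \<Sum>j\<in>UNIV. a $ j * v $ j)) (at z)"
    using assms unfolding analytic_fun_def by blast
  with cpartial_eqI[OF a] show ?thesis by simp
qed

lemma analytic_funI:
  assumes "\<And>z. (u has_derivative (\<lambda>v. \<Sum>j\<in>UNIV. d j z * v $ j)) (at z)"
  shows "analytic_fun u" "cpartial j u z = d j z"
proof -
  have *: "(u has_derivative (\<lambda>v. \<Sum>j\<in>UNIV. (\<chi> j. d j z) $ j * v $ j)) (at z)" for z
    using assms by simp
  show "analytic_fun u"
    unfolding analytic_fun_def using * by blast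
  show "cpartial j u z = d j z"
    using cpartial_eqI[OF *] by simp
qed

lemma analytic_fun_imp_continuous_on: "analytic_fun u \<Longrightarrow> continuous_on S u"
  by (meson analytic_fun_has_derivative continuous_at_imp_continuous_on has_derivative_continuous)

lemma analytic_fun_line_DERIV:
  assumes "analytic_fun u"
  shows "((\<lambda>t. u (z + t *s v)) has_field_derivative
           (\<Sum>j\<in>UNIV. cpartial j u (z + t *s v) * v $ j)) (at t)"
  using line_has_field_derivative[of u "\<chi> j. cpartial j u (z + t *s v)" z t v]
    analytic_fun_has_derivative[OF assms] by simp

text \<open>One-variable theory (Cauchy estimates, Taylor's theorem) enters through restriction to
  complex lines.\<close>

lemma analytic_fun_line_holomorphic:
  assumes "analytic_fun u"
  shows "(\<lambda>t. u (z + t *s v)) holomorphic_on S"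
  using analytic_fun_line_DERIV[OF assms]
  by (meson DERIV_subset field_differentiable_def holomorphic_on_def subset_UNIV)

lemma analytic_fun_const: "analytic_fun (\<lambda>x. c)" "cpartial j (\<lambda>x. c) z = 0"
  using analytic_funI[of "\<lambda>x. c" "\<lambda>j z. 0"] by auto

lemma analytic_fun_nth: "analytic_fun (\<lambda>x. x $ i)"
    "cpartial j (\<lambda>x. x $ i) z = (if j = i then 1 else 0)"
proof -
  have "((\<lambda>x. x $ i) has_derivative (\<lambda>v. \<Sum>j\<in>UNIV. (if j = i then 1 else 0) * v $ j)) (at z)"
    for z :: "complex^'a"
    by (rule has_derivative_eq_rhs[OF bounded_linear_imp_has_derivative[OF bounded_linear_vec_nth]])
      (simp add: if_distribR if_distrib cong: if_cong)
  from analytic_funI[OF this]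
  show "analytic_fun (\<lambda>x::complex^'a. x $ i)" "cpartial j (\<lambda>x. x $ i) z = (if j = i then 1 else 0)"
    by auto
qed

lemma
  assumes u: "analytic_fun u" and w: "analytic_fun w"
  shows analytic_fun_add: "analytic_fun (\<lambda>x. u x + w x)"
    and cpartial_add: "cpartial j (\<lambda>x. u x + w x) z = cpartial j u z + cpartial j w z"
proof -
  have "((\<lambda>x. u x + w x) has_derivative
          (\<lambda>v. \<Sum>j\<in>UNIV. (cpartial j u z + cpartial j w z) * v $ j)) (at z)" for z
    by (rule has_derivative_eq_rhs[OF has_derivative_add[OF analytic_fun_has_derivative[OF u]
            analytic_fun_has_derivative[OF w]]])
      (simp add: algebra_simps sum.distrib)
  from analytic_funI[OF this]
  show "analytic_fun (\<lambda>x. u x + w x)"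
       "cpartial j (\<lambda>x. u x + w x) z = cpartial j u z + cpartial j w z" by auto
qed

lemma
  assumes u: "analytic_fun u" and w: "analytic_fun w"
  shows analytic_fun_mult: "analytic_fun (\<lambda>x. u x * w x)"
    and cpartial_mult: "cpartial j (\<lambda>x. u x * w x) z = u z * cpartial j w z + cpartial j u z * w z"
proof -
  have "((\<lambda>x. u x * w x) has_derivative
          (\<lambda>v. \<Sum>j\<in>UNIV. (u z * cpartial j w z + cpartial j u z * w z) * v $ j)) (at z)" for z
    by (rule has_derivative_eq_rhs[OF has_derivative_mult[OF analytic_fun_has_derivative[OF u]
            analytic_fun_has_derivative[OF w]]])
      (simp add: algebra_simps sum.distrib sum_distrib_left)
  from analytic_funI[OF this]
  show "analytic_fun (\<lambda>x. u x * w x)"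
       "cpartial j (\<lambda>x. u x * w x) z = u z * cpartial j w z + cpartial j u z * w z" by auto
qed

lemma
  assumes u: "analytic_fun u"
  shows analytic_fun_cmult: "analytic_fun (\<lambda>x. c * u x)"
    and cpartial_cmult: "cpartial j (\<lambda>x. c * u x) z = c * cpartial j u z"
  using analytic_fun_mult[OF analytic_fun_const(1) u] cpartial_mult[OF analytic_fun_const(1) u]
  by (auto simp: analytic_fun_const)

lemma
  assumes u: "analytic_fun u" and w: "analytic_fun w"
  shows analytic_fun_diff: "analytic_fun (\<lambda>x. u x - w x)"
    and cpartial_diff: "cpartial j (\<lambda>x. u x - w x) z = cpartial j u z - cpartial j w z"
  using analytic_fun_add[OF u analytic_fun_cmult[OF w, of "-1"]]
    cpartial_add[OF u analytic_fun_cmult[OF w, of "-1"]] cpartial_cmult[OF w, of j "-1"]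
  by auto

lemma
  assumes "\<And>i. i \<in> I \<Longrightarrow> analytic_fun (u i)"
  shows analytic_fun_sum: "analytic_fun (\<lambda>x. \<Sum>i\<in>I. u i x)"
    and cpartial_sum: "cpartial j (\<lambda>x. \<Sum>i\<in>I. u i x) z = (\<Sum>i\<in>I. cpartial j (u i) z)"
proof -
  have "analytic_fun (\<lambda>x. \<Sum>i\<in>I. u i x) \<and>
        cpartial j (\<lambda>x. \<Sum>i\<in>I. u i x) z = (\<Sum>i\<in>I. cpartial j (u i) z)"
    using assms
    by (induction I rule: infinite_finite_induct)
      (auto simp: analytic_fun_const analytic_fun_add cpartial_add)
  then show "analytic_fun (\<lambda>x. \<Sum>i\<in>I. u i x)"
    "cpartial j (\<lambda>x. \<Sum>i\<in>I. u i x) z = (\<Sum>i\<in>I. cpartial j (u i) z)" by auto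
qed

lemma analytic_fun_prod:
  assumes "\<And>i. i \<in> I \<Longrightarrow> analytic_fun (u i)"
  shows "analytic_fun (\<lambda>x. \<Prod>i\<in>I. u i x)"
  using assms
  by (induction I rule: infinite_finite_induct) (auto simp: analytic_fun_const analytic_fun_mult)

lemma analytic_fun_power: "analytic_fun u \<Longrightarrow> analytic_fun (\<lambda>x. u x ^ n)"
  by (induction n) (auto simp: analytic_fun_const analytic_fun_mult)

lemmas analytic_fun_intros = analytic_fun_const(1) analytic_fun_nth(1) analytic_fun_add
  analytic_fun_diff analytic_fun_cmult analytic_fun_mult analytic_fun_sum analytic_fun_prod
  analytic_fun_power

lemma cjacobian_nth: "cjacobian f z $ i $ j = cpartial j (\<lambda>x. f x $ i) z"
  by (simp add: cjacobian_def)

lemma analytic_map_iff: "analytic_map f \<longleftrightarrow> (\<forall>i. analytic_fun (\<lambda>z. f z $ i))"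
proof
  assume "analytic_map f"
  then show "\<forall>i. analytic_fun (\<lambda>z. f z $ i)"
    unfolding analytic_map_def analytic_fun_def has_derivative_vec_iff matrix_vector_mult_def
    by fastforce
next
  assume *: "\<forall>i. analytic_fun (\<lambda>z. f z $ i)"
  have "(f has_derivative (\<lambda>v. cjacobian f z *v v)) (at z)" for z
    unfolding has_derivative_vec_iff matrix_vector_mult_def
    using analytic_fun_has_derivative[OF *[rule_format]] by (simp add: cjacobian_nth)
  then show "analytic_map f"
    unfolding analytic_map_def by blast
qed

lemma analytic_map_has_derivative:
  assumes "analytic_map f"
  shows "(f has_derivative (\<lambda>v. cjacobian f z *v v)) (at z)"
  unfolding has_derivative_vec_iff matrix_vector_mult_def
  using analytic_fun_has_derivative[of "\<lambda>z. f z $ i" for i] assms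
  by (simp add: cjacobian_nth analytic_map_iff)

lemma analytic_map_imp_continuous_on: "analytic_map f \<Longrightarrow> continuous_on S f"
  by (meson analytic_map_has_derivative continuous_at_imp_continuous_on has_derivative_continuous)

lemma cjacobian_eqI:
  assumes "(f has_derivative (\<lambda>v. M *v v)) (at z)"
  shows "cjacobian f z = M"
proof -
  have "cpartial j (\<lambda>x. f x $ i) z = M $ i $ j" for i j
    using assms by (intro cpartial_eqI) (simp add: has_derivative_vec_iff matrix_vector_mult_def)
  then show ?thesis by (simp add: vec_eq_iff cjacobian_nth)
qed

lemma matrix_vector_mult_has_derivative:
  "((\<lambda>x. M *v x) has_derivative (\<lambda>v. M *v v)) (at (z::complex^'n::finite) within S)"
  unfolding has_derivative_vec_iff matrix_vector_mult_def
  by (auto intro!: bounded_linear_imp_has_derivative bounded_linear_sum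
      bounded_linear_const_mult bounded_linear_vec_nth)

lemma analytic_map_matrix: "analytic_map ((*v) M)"
  unfolding analytic_map_def using matrix_vector_mult_has_derivative by blast

lemma
  assumes f: "analytic_map f" and g: "analytic_map g"
  shows analytic_map_compose: "analytic_map (\<lambda>x. g (f x))"
    and cjacobian_compose: "cjacobian (\<lambda>x. g (f x)) z = cjacobian g (f z) ** cjacobian f z"
proof -
  have *: "((\<lambda>x. g (f x)) has_derivative (\<lambda>v. (cjacobian g (f z) ** cjacobian f z) *v v)) (at z)" for z
    using has_derivative_compose[OF analytic_map_has_derivative[OF f] analytic_map_has_derivative[OF g]]
    by (simp add: matrix_vector_mul_assoc)
  show "analytic_map (\<lambda>x. g (f x))"
    unfolding analytic_map_def using * by blast
  show "cjacobian (\<lambda>x. g (f x)) z = cjacobian g (f z) ** cjacobian f z"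
    by (rule cjacobian_eqI[OF *])
qed

lemma
  assumes f: "analytic_map f" and u: "analytic_fun u"
  shows analytic_fun_compose: "analytic_fun (\<lambda>x. u (f x))"
    and cpartial_compose:
      "cpartial j (\<lambda>x. u (f x)) z = (\<Sum>i\<in>UNIV. cpartial i u (f z) * cpartial j (\<lambda>x. f x $ i) z)"
proof -
  have "((\<lambda>x. u (f x)) has_derivative
      (\<lambda>v. \<Sum>j\<in>UNIV. (\<Sum>i\<in>UNIV. cpartial i u (f z) * cpartial j (\<lambda>x. f x $ i) z) * v $ j)) (at z)" for z
    apply (rule has_derivative_eq_rhs[OF has_derivative_compose[OF
            analytic_map_has_derivative[OF f] analytic_fun_has_derivative[OF u]]])
    apply (rule ext)
    apply (simp add: matrix_vector_mult_def cjacobian_nth sum_distrib_left sum_distrib_right mult.assoc)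
    apply (rule sum.swap)
    done
  from analytic_funI[OF this]
  show "analytic_fun (\<lambda>x. u (f x))"
    "cpartial j (\<lambda>x. u (f x)) z = (\<Sum>i\<in>UNIV. cpartial i u (f z) * cpartial j (\<lambda>x. f x $ i) z)"
    by auto
qed

section \<open>Cauchy estimates, quadratic Taylor bounds and analyticity of partial
  derivatives\<close>

lemma norm_axis_1: "norm (axis j (1::complex) :: complex^'n::finite) = 1"
  by simp

lemma norm_scale_vec: "norm (t *s v) = norm t * norm (v :: complex^'n::finite)"
  by (simp add: norm_vec_def L2_set_def norm_mult power_mult_distrib flip: sum_distrib_left real_sqrt_mult)
    (simp add: real_sqrt_mult)

text \<open>Cauchy's inequality on circles of radius 1 about points of the unit disc bounds the
  second derivative by \<open>2 * M\<close>; these circles stay in the disc of radius 2, hence that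
  radius in the hypothesis.\<close>

lemma Taylor1_bound:
  assumes hol: "\<phi> holomorphic_on UNIV" and M: "\<And>t. norm t \<le> 2 \<Longrightarrow> norm (\<phi> t) \<le> M" and "norm \<tau> \<le> 1"
  shows "norm (\<phi> \<tau> - \<phi> 0 - \<tau> * deriv \<phi> 0) \<le> 2 * M * (norm \<tau>)\<^sup>2"
proof -
  have "norm ((deriv ^^ 0) \<phi> \<tau> - (\<Sum>i\<le>1. (deriv ^^ i) \<phi> 0 * (\<tau> - 0) ^ i / fact i))
        \<le> (2 * M) * norm (\<tau> - 0) ^ Suc 1 / fact 1"
  proof (rule field_Taylor[where S = "cball 0 1"])
    fix i and x :: complex
    have "(deriv ^^ i) \<phi> holomorphic_on UNIV"
      using hol by (simp add: holomorphic_higher_deriv)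
    then show "((deriv ^^ i) \<phi> has_field_derivative (deriv ^^ Suc i) \<phi> x) (at x within cball 0 1)"
      by (simp add: has_field_derivative_at_within holomorphic_derivI)
  next
    fix x :: complex assume x: "x \<in> cball 0 1"
    have "norm ((deriv ^^ 2) \<phi> x) \<le> fact 2 * M / 1 ^ 2"
    proof (rule Cauchy_inequality)
      show "norm (\<phi> t) \<le> M" if "norm (x - t) = 1" for t
      proof (rule M)
        have "norm t \<le> norm x + norm (x - t)"
          by (metis norm_minus_commute norm_triangle_sub)
        then show "norm t \<le> 2" using that x by simp
      qed
    qed (use hol in \<open>auto intro: holomorphic_on_subset holomorphic_on_imp_continuous_on\<close>)
    then show "norm ((deriv ^^ Suc 1) \<phi> x) \<le> 2 * M"
      by (simp add: numeral_2_eq_2)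
  qed (use assms in auto)
  then show ?thesis
    by (simp add: algebra_simps power2_eq_square)
qed

text \<open>The one-variable bound on the line through \<open>z\<close> in the unit direction of
  \<open>h\<close>. The constant is the same for all directions, which is what lets a limit of such
  bounds yield a Frechet derivative.\<close>

lemma analytic_fun_Taylor1_bound:
  assumes u: "analytic_fun u" and M: "\<And>x. x \<in> cball z 2 \<Longrightarrow> norm (u x) \<le> M" and h: "norm h \<le> 1"
  shows "norm (u (z + h) - u z - (\<Sum>j\<in>UNIV. cpartial j u z * h $ j)) \<le> 2 * M * (norm h)\<^sup>2"
proof (cases "h = 0")
  case False
  define v where "v = complex_of_real (inverse (norm h)) *s h"
  have hv: "h = complex_of_real (norm h) *s v"
    using False by (simp add: v_def vector_smult_assoc)
  have nv: "norm v = 1"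
    using False by (simp add: v_def norm_scale_vec norm_inverse)
  define \<phi> where "\<phi> = (\<lambda>t. u (z + t *s v))"
  have "norm (\<phi> (norm h) - \<phi> 0 - complex_of_real (norm h) * deriv \<phi> 0) \<le> 2 * M * (norm (complex_of_real (norm h)))\<^sup>2"
  proof (rule Taylor1_bound)
    show "\<phi> holomorphic_on UNIV"
      unfolding \<phi>_def by (rule analytic_fun_line_holomorphic[OF u])
    show "norm (\<phi> t) \<le> M" if "norm t \<le> 2" for t
      unfolding \<phi>_def by (rule M) (use that nv in \<open>simp add: dist_norm norm_scale_vec\<close>)
  qed (use h in simp)
  moreover have "deriv \<phi> 0 = (\<Sum>j\<in>UNIV. cpartial j u z * v $ j)"
    using DERIV_imp_deriv[OF analytic_fun_line_DERIV[OF u, of z v 0]] by (simp add: \<phi>_def)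
  moreover have "complex_of_real (norm h) * (\<Sum>j\<in>UNIV. cpartial j u z * v $ j) =
      (\<Sum>j\<in>UNIV. cpartial j u z * h $ j)"
    by (subst (2) hv) (simp add: sum_distrib_left algebra_simps)
  moreover have "\<phi> (norm h) = u (z + h)" "\<phi> 0 = u z"
    using hv by (simp_all add: \<phi>_def)
  ultimately show ?thesis by simp
qed simp

lemma cpartial_bound:
  assumes u: "analytic_fun u" and M: "\<And>x. x \<in> cball z 1 \<Longrightarrow> norm (u x) \<le> M"
  shows "norm (cpartial j u z) \<le> M"
proof -
  have "norm ((deriv ^^ 1) (\<lambda>t. u (z + t *s axis j 1)) 0) \<le> fact 1 * M / 1 ^ 1"
  proof (rule Cauchy_inequality)
    show "norm (u (z + t *s axis j 1)) \<le> M" if "norm (0 - t) = 1" for t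
      by (rule M) (use that in \<open>simp add: dist_norm norm_scale_vec\<close>)
  qed (auto intro!: analytic_fun_line_holomorphic[OF u] holomorphic_on_imp_continuous_on)
  then show ?thesis by (simp add: cpartial_def)
qed

lemma analytic_fun_locally_bounded:
  assumes "analytic_fun u"
  obtains M where "\<And>x. x \<in> cball z r \<Longrightarrow> norm (u x) \<le> M"
proof -
  have "compact (u ` cball z r)"
    by (intro compact_continuous_image analytic_fun_imp_continuous_on assms compact_cball)
  then have "bounded (u ` cball z r)" by (rule compact_imp_bounded)
  then show ?thesis using that by (force simp: bounded_iff)
qed

text \<open>By the Cauchy estimates the first partial derivatives converge, and the quadratic Taylor bound
  passes to the limit.\<close>

lemma analytic_fun_uniform_limit:
  fixes U :: "nat \<Rightarrow> complex^'n::finite \<Rightarrow> complex"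
  assumes U: "\<And>m. analytic_fun (U m)"
    and lim: "\<And>z r e. e > 0 \<Longrightarrow> \<exists>N. \<forall>m\<ge>N. \<forall>x\<in>cball z r. norm (U m x - w x) < (e::real)"
  shows "analytic_fun w"
  unfolding analytic_fun_def
proof
  fix z :: "complex^'n"
  obtain N0 where N0: "\<And>m x. m \<ge> N0 \<Longrightarrow> x \<in> cball z 2 \<Longrightarrow> norm (U m x - w x) < 1"
    using lim[of 1 z 2] by (metis zero_less_one)
  obtain C where C: "\<And>x. x \<in> cball z 2 \<Longrightarrow> norm (U N0 x) \<le> C"
    using analytic_fun_locally_bounded[OF U] by blast
  \<comment> \<open>On the ball of radius 2 all later functions are within 1 of the limit, hence
    within 2 of \<open>U N0\<close>, which is bounded by \<open>C\<close>. This gives one bound for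
    the whole tail.\<close>
  define M where "M = C + 2"
  have M: "norm (U m x) \<le> M" if "m \<ge> N0" "x \<in> cball z 2" for m x
  proof -
    have "U m x = (U m x - w x) - (U N0 x - w x) + U N0 x" by simp
    then have "norm (U m x) \<le> norm (U m x - w x) + norm (U N0 x - w x) + norm (U N0 x)"
      by (smt (verit) norm_triangle_ineq norm_triangle_ineq4)
    with N0[OF that] N0[OF order_refl that(2)] C[OF that(2)] show ?thesis
      by (simp add: M_def)
  qed
  have "\<exists>c. (\<lambda>m. cpartial j (U m) z) \<longlonglongrightarrow> c" for j
  proof -
    have "Cauchy (\<lambda>m. cpartial j (U m) z)"
    proof (rule CauchyI)
      fix e :: real assume "e > 0"
      obtain N where N: "\<And>m x. m \<ge> N \<Longrightarrow> x \<in> cball z 1 \<Longrightarrow> norm (U m x - w x) < e / 3"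
        using lim[of "e/3" z 1] \<open>e > 0\<close> by (metis divide_pos_pos zero_less_numeral)
      have "norm (cpartial j (U m) z - cpartial j (U n) z) < e" if "m \<ge> N" "n \<ge> N" for m n
      proof -
        have "norm (cpartial j (\<lambda>x. U m x - U n x) z) \<le> 2 * e / 3"
        proof (rule cpartial_bound)
          fix x assume x: "x \<in> cball z 1"
          have "norm (U m x - U n x) \<le> norm (U m x - w x) + norm (U n x - w x)"
            using norm_triangle_ineq4[of "U m x - w x" "U n x - w x"] by simp
          with N[OF that(1) x] N[OF that(2) x] show "norm (U m x - U n x) \<le> 2 * e / 3" by simp
        qed (intro analytic_fun_intros U)
        then show ?thesis
          using \<open>e > 0\<close> by (simp add: cpartial_diff[OF U U])
      qed
      then show "\<exists>M. \<forall>m\<ge>M. \<forall>n\<ge>M. norm (cpartial j (U m) z - cpartial j (U n) z) < e" by blast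
    qed
    then show ?thesis using Cauchy_convergent convergent_def by blast
  qed
  then obtain c where c: "\<And>j. (\<lambda>m. cpartial j (U m) z) \<longlonglongrightarrow> c j" by metis
  have limw: "(\<lambda>m. U m x) \<longlonglongrightarrow> w x" for x
    using lim[of _ x 0] by (auto simp: LIMSEQ_iff)
  have bound: "norm (w (z + h) - w z - (\<Sum>j\<in>UNIV. c j * h $ j)) \<le> 2 * M * (norm h)\<^sup>2"
    if "norm h \<le> 1" for h
  proof (rule tendsto_upperbound)
    show "(\<lambda>m. norm (U m (z + h) - U m z - (\<Sum>j\<in>UNIV. cpartial j (U m) z * h $ j)))
          \<longlonglongrightarrow> norm (w (z + h) - w z - (\<Sum>j\<in>UNIV. c j * h $ j))"
      by (intro tendsto_intros limw c)
    show "\<forall>\<^sub>F m in sequentially.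
        norm (U m (z + h) - U m z - (\<Sum>j\<in>UNIV. cpartial j (U m) z * h $ j)) \<le> 2 * M * (norm h)\<^sup>2"
      using eventually_ge_at_top[of N0]
      by eventually_elim (use analytic_fun_Taylor1_bound[OF U] M that in blast)
  qed simp
  have "(w has_derivative (\<lambda>v. \<Sum>j\<in>UNIV. c j * v $ j)) (at z)"
  proof (rule has_derivativeI_sandwich[where e = 1])
    show "bounded_linear (\<lambda>v. \<Sum>j\<in>UNIV. c j * v $ j)"
      by (intro bounded_linear_sum bounded_linear_const_mult bounded_linear_vec_nth)
    show "norm (w y - w z - (\<Sum>j\<in>UNIV. c j * (y - z) $ j)) / norm (y - z) \<le> 2 * M * norm (y - z)"
      if "y \<noteq> z" "dist y z < 1" for y
      using bound[of "y - z"] that by (simp add: dist_norm field_simps power2_eq_square)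
    have "(\<lambda>y. 2 * M * norm (y - z)) \<midarrow>z\<rightarrow> 2 * M * norm (z - z)"
      by (intro tendsto_intros)
    then show "(\<lambda>y. 2 * M * norm (y - z)) \<midarrow>z\<rightarrow> 0" by simp
  qed simp
  then show "\<exists>a. (w has_derivative (\<lambda>v. \<Sum>j\<in>UNIV. a $ j * v $ j)) (at z)"
    by (intro exI[of _ "\<chi> j. c j"]) simp
qed

text \<open>The partial derivative is the locally uniform limit of difference quotients with step
  \<open>1 / (m + 1)\<close>: the quadratic Taylor bound makes the error at most
  \<open>2 * M / (m + 1)\<close>. Jacobian determinants along pencils and second derivatives at the
  origin rely on this.\<close>

lemma analytic_fun_cpartial:
  fixes u :: "complex^'n::finite \<Rightarrow> complex"
  assumes u: "analytic_fun u"
  shows "analytic_fun (cpartial j u)"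
proof (rule analytic_fun_uniform_limit)
  let ?\<tau> = "\<lambda>m::nat. complex_of_real (inverse (real (Suc m)))"
  let ?U = "\<lambda>m x. inverse (?\<tau> m) * (u (x + ?\<tau> m *s axis j 1) - u x)"
  show "analytic_fun (?U m)" for m
  proof -
    have "analytic_map (\<lambda>x::complex^'n. x + ?\<tau> m *s axis j 1)"
      unfolding analytic_map_iff by (auto intro!: analytic_fun_intros)
    then show ?thesis by (intro analytic_fun_intros u analytic_fun_compose[OF _ u])
  qed
  fix z :: "complex^'n" and r e :: real assume "e > 0"
  \<comment> \<open>The Taylor bound at a point of \<open>cball z r\<close> needs control on the
    ball of radius 2 around that point.\<close>
  obtain M where M: "\<And>x. x \<in> cball z (r + 2) \<Longrightarrow> norm (u x) \<le> M"
    using analytic_fun_locally_bounded[OF u] by blast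
  obtain N where N: "2 * \<bar>M\<bar> / e < real N"
    using reals_Archimedean2 by blast
  have "norm (?U m x - cpartial j u x) < e" if "m \<ge> N" "x \<in> cball z r" for m x
  proof -
    let ?t = "?\<tau> m"
    have M': "norm (u y) \<le> M" if "y \<in> cball x 2" for y
      by (rule M) (use that \<open>x \<in> cball z r\<close> dist_triangle[of z y x] in auto)
    have nt: "norm ?t \<le> 1"
      by (simp only: norm_of_real) (simp add: field_simps)
    have t0: "?t \<noteq> 0" by (simp del: of_nat_Suc)
    have M0: "0 \<le> M" using M'[of x] by (smt (verit) centre_in_cball norm_ge_zero)
    have "norm (u (x + ?t *s axis j 1) - u x - (\<Sum>k\<in>UNIV. cpartial k u x * (?t *s axis j 1) $ k))
      \<le> 2 * M * (norm (?t *s axis j 1 :: complex^'n))\<^sup>2"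
      by (rule analytic_fun_Taylor1_bound[OF u M']) (use nt in \<open>simp_all add: norm_scale_vec\<close>)
    moreover have "(\<Sum>k\<in>UNIV. cpartial k u x * (?t *s axis j 1) $ k) = ?t * cpartial j u x"
      by (simp add: axis_def if_distrib if_distribR mult.commute cong: if_cong)
    ultimately have *: "norm (u (x + ?t *s axis j 1) - u x - ?t * cpartial j u x) \<le> 2 * M * (norm ?t)\<^sup>2"
      by (simp only: norm_scale_vec norm_axis_1 mult_1_right)
    have "?U m x - cpartial j u x = inverse ?t * (u (x + ?t *s axis j 1) - u x - ?t * cpartial j u x)"
      using t0 by (simp add: right_diff_distrib del: of_nat_Suc)
    then have "norm (?U m x - cpartial j u x) =
        inverse (norm ?t) * norm (u (x + ?t *s axis j 1) - u x - ?t * cpartial j u x)"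
      by (simp only: norm_mult norm_inverse)
    also have "\<dots> \<le> inverse (norm ?t) * (2 * M * (norm ?t)\<^sup>2)"
      using * by (intro mult_left_mono) auto
    also have "\<dots> = 2 * M * norm ?t"
      using t0 by (simp add: power2_eq_square del: of_nat_Suc)
    also have "\<dots> = 2 * M / real (Suc m)"
      by (simp add: norm_inverse divide_inverse del: of_nat_Suc)
    also have "\<dots> < e"
    proof -
      have "2 * M < e * real N"
        using N M0 \<open>e > 0\<close> by (simp add: pos_divide_less_eq mult.commute)
      also have "\<dots> \<le> e * real (Suc m)"
        using that \<open>e > 0\<close> by (intro mult_left_mono) auto
      finally show ?thesis by (simp add: pos_divide_less_eq del: of_nat_Suc)
    qed
    finally show ?thesis .
  qed
  then show "\<exists>N. \<forall>m\<ge>N. \<forall>x\<in>cball z r. norm (?U m x - cpartial j u x) < e" by blast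
qed

section \<open>Pencils of analytic maps\<close>

definition pencil ::
    "(complex^'n \<Rightarrow> complex^'n) \<Rightarrow> (complex^'n \<Rightarrow> complex^'n) \<Rightarrow> complex \<Rightarrow> complex^'n \<Rightarrow> complex^'n::finite"
  where "pencil p0 p1 s x = p0 x + s *s (p1 x - p0 x)"

lemma pencil_simps [simp]: "pencil p0 p1 0 = p0" "pencil p0 p1 1 = p1" "pencil p p s = p"
  by (auto simp: pencil_def)

lemma analytic_map_pencil:
  assumes "analytic_map p0" "analytic_map p1"
  shows "analytic_map (pencil p0 p1 s)"
  using assms unfolding analytic_map_iff pencil_def by (auto intro!: analytic_fun_intros)

lemma cjacobian_pencil_nth:
  assumes "analytic_map p0" "analytic_map p1"
  shows "cjacobian (pencil p0 p1 s) x $ i $ j =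
    cpartial j (\<lambda>x. p0 x $ i) x + s * (cpartial j (\<lambda>x. p1 x $ i) x - cpartial j (\<lambda>x. p0 x $ i) x)"
proof -
  have a: "analytic_fun (\<lambda>x. p0 x $ i)" "analytic_fun (\<lambda>x. p1 x $ i)"
    using assms by (auto simp: analytic_map_iff)
  show ?thesis
    unfolding cjacobian_nth pencil_def
    by (simp add: a cpartial_add cpartial_cmult cpartial_diff analytic_fun_intros right_diff_distrib)
qed

lemma continuous_on_analytic_compose:
  assumes "analytic_fun u" "continuous_on S g"
  shows "continuous_on S (\<lambda>k. u (g k))"
  by (rule continuous_on_compose2[OF analytic_fun_imp_continuous_on[OF assms(1), of UNIV] assms(2)]) auto

lemma continuous_on_pencil:
  assumes p: "analytic_map p0" "analytic_map p1" and g: "continuous_on S g" and s: "continuous_on S s"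
  shows "continuous_on S (\<lambda>k. pencil p0 p1 (s k) (g k))"
proof -
  have a: "analytic_fun (\<lambda>x. p0 x $ i)" "analytic_fun (\<lambda>x. p1 x $ i)" for i
    using p by (auto simp: analytic_map_iff)
  have "continuous_on S (\<lambda>k. \<chi> i. p0 (g k) $ i + s k * (p1 (g k) $ i - p0 (g k) $ i))"
    by (intro continuous_intros s continuous_on_analytic_compose[OF a(1) g]
        continuous_on_analytic_compose[OF a(2) g])
  moreover have "(\<chi> i. p0 (g k) $ i + s k * (p1 (g k) $ i - p0 (g k) $ i)) = pencil p0 p1 (s k) (g k)" for k
    by (simp add: pencil_def vec_eq_iff right_diff_distrib)
  ultimately show ?thesis by simp
qed

lemma continuous_on_det_cjacobian_pencil:
  assumes p: "analytic_map p0" "analytic_map p1" and g: "continuous_on S g" and s: "continuous_on S s"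
  shows "continuous_on S (\<lambda>k. det (cjacobian (pencil p0 p1 (s k)) (g k)))"
proof -
  have a: "analytic_fun (cpartial j (\<lambda>x. p0 x $ i))" "analytic_fun (cpartial j (\<lambda>x. p1 x $ i))" for i j
    using p by (auto simp: analytic_map_iff analytic_fun_cpartial)
  show ?thesis
    unfolding det_def cjacobian_pencil_nth[OF p]
    by (intro continuous_intros s continuous_on_analytic_compose[OF a(1) g]
        continuous_on_analytic_compose[OF a(2) g])
qed

lemma analytic_fun_compose_holomorphic:
  fixes \<xi> :: "complex \<Rightarrow> complex^'n::finite"
  assumes u: "analytic_fun u" and "open S" and \<xi>: "\<And>i. (\<lambda>s. \<xi> s $ i) holomorphic_on S"
  shows "(\<lambda>s. u (\<xi> s)) holomorphic_on S"
proof -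
  have "\<exists>D. ((\<lambda>s. u (\<xi> s)) has_field_derivative D) (at s)" if "s \<in> S" for s
  proof -
    have "((\<lambda>s. \<xi> s $ i) has_field_derivative deriv (\<lambda>s. \<xi> s $ i) s) (at s)" for i
      using \<xi> \<open>open S\<close> that by (rule holomorphic_derivI)
    then have "(\<xi> has_derivative (\<lambda>d. \<chi> i. deriv (\<lambda>s. \<xi> s $ i) s * d)) (at s)"
      by (simp add: has_derivative_vec_iff has_field_derivative_def)
    from has_derivative_compose[OF this analytic_fun_has_derivative[OF u]]
    have "((\<lambda>s. u (\<xi> s)) has_field_derivative
        (\<Sum>j\<in>UNIV. cpartial j u (\<xi> s) * deriv (\<lambda>s. \<xi> s $ j) s)) (at s)"
      unfolding has_field_derivative_def
      by (rule has_derivative_eq_rhs) (auto simp: fun_eq_iff sum_distrib_left sum_distrib_right mult_ac)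
    then show ?thesis by blast
  qed
  then show ?thesis
    using \<open>open S\<close> by (metis holomorphic_on_open)
qed

lemma holomorphic_det_cjacobian_pencil:
  assumes p: "analytic_map p0" "analytic_map p1" and "open S"
    and \<xi>: "\<And>i. (\<lambda>s. \<xi> s $ i) holomorphic_on S"
  shows "(\<lambda>s. det (cjacobian (pencil p0 p1 s) (\<xi> s))) holomorphic_on S"
proof -
  have a: "analytic_fun (cpartial j (\<lambda>x. p0 x $ i))" "analytic_fun (cpartial j (\<lambda>x. p1 x $ i))" for i j
    using p by (auto simp: analytic_map_iff analytic_fun_cpartial)
  show ?thesis
    unfolding det_def cjacobian_pencil_nth[OF p]
    by (intro holomorphic_intros analytic_fun_compose_holomorphic[OF a(1) \<open>open S\<close> \<xi>]
        analytic_fun_compose_holomorphic[OF a(2) \<open>open S\<close> \<xi>])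
qed

lemma matrix_vector_mult_scale: "(M::complex^'n^'m) *v (c *s v) = c *s (M *v v)"
  by (simp add: matrix_vector_mult_def vec_eq_iff sum_distrib_left mult_ac)

text \<open>Implicit function theorem, obtained by inverting the map that sends the pair of
  \<open>s\<close> and \<open>x\<close> to \<open>s\<close> and \<open>pencil p0 p1 s x\<close>. Its
  derivative is block triangular with the Jacobian in \<open>x\<close> as a diagonal block. The real
  inverse function theorem gives only a real derivative for the branch; holomorphy is checked
  afterwards.\<close>

lemma pencil_nondegenerate_branch:
  fixes p0 p1 :: "complex^'n::finite \<Rightarrow> complex^'n"
  assumes p: "analytic_map p0" "analytic_map p1"
    and zero: "pencil p0 p1 s0 x0 = 0" and inv: "invertible (cjacobian (pencil p0 p1 s0) x0)"
  obtains \<rho> U \<xi> where "\<rho> > 0" "open U" "x0 \<in> U" "\<xi> s0 = x0"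
    "\<And>i. (\<lambda>s. \<xi> s $ i) holomorphic_on ball s0 \<rho>"
    "\<And>s. s \<in> ball s0 \<rho> \<Longrightarrow> pencil p0 p1 s (\<xi> s) = 0"
    "\<And>s x. s \<in> ball s0 \<rho> \<Longrightarrow> x \<in> U \<Longrightarrow> pencil p0 p1 s x = 0 \<Longrightarrow> x = \<xi> s"
proof -
  define f :: "complex \<times> (complex^'n) \<Rightarrow> complex \<times> (complex^'n)"
    where "f = (\<lambda>z. (fst z, pencil p0 p1 (fst z) (snd z)))"
  define D :: "complex \<times> (complex^'n) \<Rightarrow> complex \<times> (complex^'n) \<Rightarrow> complex \<times> (complex^'n)" where
    "D = (\<lambda>z h. (fst h, cjacobian (pencil p0 p1 (fst z)) (snd z) *v snd h
                          + fst h *s (p1 (snd z) - p0 (snd z))))"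
  have derf: "(f has_derivative D z) (at z)" for z
  proof -
    have d: "((\<lambda>z. q (snd z) $ i) has_derivative
        (\<lambda>h. \<Sum>j\<in>UNIV. cpartial j (\<lambda>x. q x $ i) (snd z) * snd h $ j)) (at z)"
      if "analytic_map q" for q :: "complex^'n \<Rightarrow> complex^'n" and i
      using that
      by (intro has_derivative_compose[OF has_derivative_snd[OF has_derivative_ident] analytic_fun_has_derivative])
        (simp add: analytic_map_iff)
    have "((\<lambda>z. pencil p0 p1 (fst z) (snd z)) has_derivative (\<lambda>h. snd (D z h))) (at z)"
      unfolding has_derivative_vec_iff pencil_def vector_add_component vector_smult_component
        vector_minus_component
    proof
      fix i
      show "((\<lambda>z. p0 (snd z) $ i + fst z * (p1 (snd z) $ i - p0 (snd z) $ i))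
            has_derivative (\<lambda>h. snd (D z h) $ i)) (at z)"
        apply (rule has_derivative_eq_rhs)
         apply (rule has_derivative_add has_derivative_mult has_derivative_diff has_derivative_fst
            has_derivative_ident d p)+
        apply (simp add: D_def matrix_vector_mult_def cjacobian_pencil_nth[OF p] fun_eq_iff
            algebra_simps sum.distrib sum_subtractf sum_distrib_left)
        done
    qed
    then have "((\<lambda>z. (fst z, pencil p0 p1 (fst z) (snd z))) has_derivative (\<lambda>h. (fst h, snd (D z h)))) (at z)"
      by (intro has_derivative_Pair has_derivative_fst has_derivative_ident)
    then show ?thesis by (simp add: f_def D_def)
  qed
  define f' where "f' = (\<lambda>z. Blinfun (D z))"
  have f': "blinfun_apply (f' z) = D z" for z
    using derf[of z] unfolding f'_def
    by (simp add: bounded_linear_Blinfun_apply has_derivative_bounded_linear)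
  have contf: "continuous_on UNIV f'"
  proof (rule continuous_on_blinfun_componentwise)
    fix h :: "complex \<times> (complex^'n)"
    have a: "analytic_fun (\<lambda>x. p0 x $ i)" "analytic_fun (\<lambda>x. p1 x $ i)"
            "analytic_fun (cpartial j (\<lambda>x. p0 x $ i))" "analytic_fun (cpartial j (\<lambda>x. p1 x $ i))" for i j
      using p by (auto simp: analytic_map_iff analytic_fun_cpartial)
    have "continuous_on UNIV (\<lambda>z. (fst h, \<chi> i. snd (D z h) $ i))"
      unfolding D_def snd_conv matrix_vector_mult_def cjacobian_pencil_nth[OF p]
        vector_add_component vector_smult_component vector_minus_component vec_lambda_beta
      by (intro continuous_intros continuous_on_analytic_compose[OF a(1)]
          continuous_on_analytic_compose[OF a(2)] continuous_on_analytic_compose[OF a(3)]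
          continuous_on_analytic_compose[OF a(4)])
    moreover have "blinfun_apply (f' z) h = (fst h, \<chi> i. snd (D z h) $ i)" for z
      unfolding f' vec_lambda_eta by (simp add: D_def)
    ultimately show "continuous_on UNIV (\<lambda>z. blinfun_apply (f' z) h)" by simp
  qed
  have linD: "linear (D z)" for z
    using derf[of z] has_derivative_linear by blast
  have "inj (D (s0, x0))"
  proof (subst linear_injective_0[OF linD], intro allI impI)
    fix h assume "D (s0, x0) h = 0"
    then have "fst h = 0" "cjacobian (pencil p0 p1 s0) x0 *v snd h = 0"
      by (auto simp: D_def zero_prod_def)
    then show "h = 0"
      using inv by (simp add: prod_eq_iff invertible_left_inverse matrix_left_invertible_ker)
  qed
  from linear_injective_left_inverse[OF linD this]
  obtain G where G: "linear G" "G \<circ> D (s0, x0) = id" by blast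
  have "blinfun_apply (Blinfun G) = G"
    using G(1) by (simp add: bounded_linear_Blinfun_apply linear_conv_bounded_linear)
  then have invf: "Blinfun G o\<^sub>L f' (s0, x0) = id_blinfun"
    using G(2) by (intro blinfun_eqI) (metis blinfun_apply_blinfun_compose blinfun_apply_id_blinfun comp_apply f' id_apply)
  obtain U' V g g' where *: "open U'" "(s0, x0) \<in> U'" "open V" "f (s0, x0) \<in> V"
    "homeomorphism U' V f g"
    "\<And>y. y \<in> V \<Longrightarrow> (g has_derivative (g' y)) (at y)"
    "\<And>y. y \<in> V \<Longrightarrow> g' y = inv (D (g y))"
    "\<And>y. y \<in> V \<Longrightarrow> bij (D (g y))"
    by (rule inverse_function_theorem[where f = f and f' = f' and U = UNIV and ?x0.0 = "(s0, x0)"])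
      (use derf contf invf in \<open>auto simp: f'\<close>)
  have f0: "f (s0, x0) = (s0, 0)"
    by (simp add: f_def zero)
  define \<xi> where "\<xi> = (\<lambda>s. snd (g (s, 0)))"
  \<comment> \<open>Shrinking to product neighbourhoods makes \<open>U\<close> independent of the
    parameter, so that uniqueness of the zero holds on one fixed set for all nearby
    \<open>s\<close>.\<close>
  obtain A U where AU: "open A" "open U" "(s0, x0) \<in> A \<times> U" "A \<times> U \<subseteq> U'"
    using open_prod_elim[OF *(1,2)] .
  obtain B C where BC: "open B" "open C" "(s0, 0) \<in> B \<times> C" "B \<times> C \<subseteq> V"
    using open_prod_elim[OF *(3,4)] unfolding f0 .
  obtain \<rho> where \<rho>: "\<rho> > 0" "ball s0 \<rho> \<subseteq> A \<inter> B"
    using AU BC by (metis IntI mem_Sigma_iff open_Int open_contains_ball)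
  have sV: "(s, 0) \<in> V" if "s \<in> ball s0 \<rho>" for s
    using that \<rho> BC by auto
  have fg: "f (g (s, 0)) = (s, 0)" if "s \<in> ball s0 \<rho>" for s
    using *(5) sV[OF that] by (simp add: homeomorphism_def)
  show ?thesis
  proof
    show "\<xi> s0 = x0"
      using *(2,5) f0 unfolding \<xi>_def homeomorphism_def by (metis snd_conv)
    show "pencil p0 p1 s (\<xi> s) = 0" if "s \<in> ball s0 \<rho>" for s
    proof -
      have "fst (g (s, 0)) = s" "pencil p0 p1 (fst (g (s, 0))) (snd (g (s, 0))) = 0"
        using fg[OF that] by (auto simp: f_def)
      from this(2)[unfolded this(1)] show ?thesis unfolding \<xi>_def by simp
    qed
    show "x = \<xi> s" if "s \<in> ball s0 \<rho>" "x \<in> U" "pencil p0 p1 s x = 0" for s x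
    proof -
      have "(s, x) \<in> U'" using that \<rho> AU by auto
      moreover have "f (s, x) = (s, 0)" using that by (simp add: f_def)
      ultimately have "g (s, 0) = (s, x)" using *(5) by (metis homeomorphism_apply1)
      then show ?thesis by (simp add: \<xi>_def)
    qed
    show "(\<lambda>s. \<xi> s $ i) holomorphic_on ball s0 \<rho>" for i
    proof -
      have "\<exists>d. ((\<lambda>s. \<xi> s $ i) has_field_derivative d) (at s)" if s: "s \<in> ball s0 \<rho>" for s
      proof -
        have "((\<lambda>s. (s, 0)) has_derivative (\<lambda>d. (d, 0))) (at s)"
          by (intro has_derivative_Pair has_derivative_ident has_derivative_const)
        from has_derivative_compose[OF this *(6)[OF sV[OF s]]]
        have "(\<xi> has_derivative (\<lambda>d. snd (g' (s, 0) (d, 0)))) (at s)"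
          unfolding \<xi>_def by (rule has_derivative_snd)
        then have 1: "((\<lambda>s. \<xi> s $ i) has_derivative (\<lambda>d. snd (g' (s, 0) (d, 0)) $ i)) (at s)"
          by (simp add: has_derivative_vec_iff)
        let ?D = "D (g (s, 0))" and ?w = "inv (D (g (s, 0))) (1, 0)"
        have bij: "bij ?D" using *(8)[OF sV[OF s]] .
        \<comment> \<open>The inverse is a priori only real linear. The complex multiple by
          \<open>d\<close> of the preimage \<open>?w\<close> of \<open>(1, 0)\<close> is mapped to
          \<open>(d, 0)\<close>, so by injectivity it is the value, and the dependence on
          \<open>d\<close> is complex linear.\<close>
        have "inv ?D (d, 0) = (d * fst ?w, d *s snd ?w)" for d
        proof (rule inv_f_eq[OF bij_is_inj[OF bij]])
          have "?D ?w = (1, 0)" by (rule surj_f_inv_f[OF bij_is_surj[OF bij]])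
          then have "fst ?w = 1" "cjacobian (pencil p0 p1 (fst (g (s, 0)))) (snd (g (s, 0))) *v snd ?w
              + (p1 (snd (g (s, 0))) - p0 (snd (g (s, 0)))) = 0"
            by (auto simp: D_def)
          then have "fst ?w = 1" "d *s (cjacobian (pencil p0 p1 (fst (g (s, 0)))) (snd (g (s, 0))) *v snd ?w
              + (p1 (snd (g (s, 0))) - p0 (snd (g (s, 0))))) = 0"
            by simp_all
          then show "?D (d * fst ?w, d *s snd ?w) = (d, 0)"
            by (simp add: D_def matrix_vector_mult_scale vector_add_ldistrib)
        qed
        from this[THEN arg_cong, of snd]
        have "snd (g' (s, 0) (d, 0)) $ i = snd ?w $ i * d" for d
          unfolding *(7)[OF sV[OF s]] by (metis mult.commute snd_conv vector_smult_component)
        then have "(\<lambda>d. snd (g' (s, 0) (d, 0)) $ i) = (*) (snd ?w $ i)" by (rule ext)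
        with 1 show ?thesis unfolding has_field_derivative_def by metis
      qed
      then show ?thesis by (metis holomorphic_on_open open_ball)
    qed
  qed (use \<rho> AU in auto)
qed

section \<open>Rouche's theorem for nondegenerate zeros\<close>

definition zeros_in :: "(complex^'n \<Rightarrow> complex^'n::finite) \<Rightarrow> (complex^'n) set \<Rightarrow> (complex^'n) set" where
  "zeros_in p W = {x \<in> W. p x = 0}"

definition nondegenerate_on :: "(complex^'n \<Rightarrow> complex^'n::finite) \<Rightarrow> (complex^'n) set \<Rightarrow> bool" where
  "nondegenerate_on p W \<longleftrightarrow> (\<forall>x\<in>W. p x = 0 \<longrightarrow> invertible (cjacobian p x))"

lemma zeros_in_closure:
  assumes "\<And>x. x \<in> frontier W \<Longrightarrow> p x \<noteq> 0" "x \<in> closure W" "p x = 0"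
  shows "x \<in> W"
  using assms closure_Un_frontier by fastforce

text \<open>The zeros in the closure form a compact set, and the uniqueness half of the branch lemma
  isolates each of them.\<close>

lemma finite_zeros_in_nondegenerate:
  assumes p: "analytic_map p" and W: "bounded W" and nz: "\<And>x. x \<in> frontier W \<Longrightarrow> p x \<noteq> 0"
    and nd: "nondegenerate_on p W"
  shows "finite (zeros_in p W)"
proof -
  let ?Z = "closure W \<inter> p -` {0}"
  have Z: "?Z = zeros_in p W"
    using zeros_in_closure[where p = p, OF nz] closure_subset[of W] by (auto simp: zeros_in_def)
  have "closed (p -` {0})"
    using analytic_map_imp_continuous_on[OF p, of UNIV] by (simp add: closed_vimage)
  then have "compact ?Z"
    using W by (simp add: compact_Int_closed)
  have "\<exists>U. open U \<and> z \<in> U \<and> zeros_in p U \<subseteq> {z}" if "z \<in> ?Z" for z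
  proof -
    have "z \<in> W" "p z = 0" using that Z by (auto simp: zeros_in_def)
    \<comment> \<open>A single map is viewed as a constant pencil, so that the branch lemma
      applies.\<close>
    then have "pencil p p 0 z = 0" "invertible (cjacobian (pencil p p 0) z)"
      using nd by (auto simp: nondegenerate_on_def)
    then obtain r U \<xi> where "r > 0" "open U" "z \<in> U"
      "\<xi> 0 = z" "\<And>i. (\<lambda>s. \<xi> s $ i) holomorphic_on ball 0 r"
      "\<And>s. s \<in> ball 0 r \<Longrightarrow> pencil p p s (\<xi> s) = 0"
      "\<And>s x. s \<in> ball 0 r \<Longrightarrow> x \<in> U \<Longrightarrow> pencil p p s x = 0 \<Longrightarrow> x = \<xi> s"
      by (rule pencil_nondegenerate_branch[OF p p]) (rule that)
    note r = this
    from r(1-4) r(7)[of 0] have "zeros_in p U \<subseteq> {z}" by (auto simp: zeros_in_def)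
    with \<open>open U\<close> \<open>z \<in> U\<close> show ?thesis by blast
  qed
  then obtain U where U: "\<And>z. z \<in> ?Z \<Longrightarrow> open (U z) \<and> z \<in> U z \<and> zeros_in p (U z) \<subseteq> {z}"
    by metis
  obtain C where C: "C \<subseteq> ?Z" "finite C" "?Z \<subseteq> (\<Union>z\<in>C. U z)"
  proof (rule compactE_image[OF \<open>compact ?Z\<close>, of ?Z U])
    show "open (U z)" if "z \<in> ?Z" for z using U[OF that] by blast
    show "?Z \<subseteq> (\<Union>z\<in>?Z. U z)" using U by blast
  qed
  have "?Z \<subseteq> C"
  proof
    fix x assume x: "x \<in> ?Z"
    then obtain z where "z \<in> C" "x \<in> U z" using C by auto
    with U[of z] C x have "x = z" by (auto simp: zeros_in_def)
    then show "x \<in> C" using \<open>z \<in> C\<close> by simp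
  qed
  then show ?thesis using C Z finite_subset by metis
qed

lemma compact_norm_lower_bound:
  fixes f :: "'a::topological_space \<Rightarrow> 'b::real_normed_vector"
  assumes C: "compact C" and f: "continuous_on C f" and nz: "\<And>x. x \<in> C \<Longrightarrow> f x \<noteq> 0"
  obtains \<eta> where "\<eta> > 0" "\<And>x. x \<in> C \<Longrightarrow> \<eta> \<le> norm (f x)"
proof (cases "C = {}")
  case False
  from continuous_attains_inf[OF C this continuous_on_norm[OF f]] nz that show ?thesis
    by (metis zero_less_norm_iff)
qed (use that[of 1] in auto)

text \<open>Upper semicontinuity of the number of zeros. Around each zero at parameter
  \<open>a\<close> there is a neighbourhood containing at most one zero for nearby parameters; off
  these neighbourhoods \<open>pencil p0 p1 a\<close> is bounded away from 0, and so are the nearby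
  members.\<close>

lemma pencil_zeros_near_nondegenerate:
  assumes p: "analytic_map p0" "analytic_map p1" and W: "bounded W"
    and nz: "\<And>x. x \<in> frontier W \<Longrightarrow> pencil p0 p1 a x \<noteq> 0"
    and nd: "nondegenerate_on (pencil p0 p1 a) W"
  obtains \<rho> where "\<rho> > 0"
    "\<And>s T. s \<in> ball a \<rho> \<Longrightarrow> T \<subseteq> zeros_in (pencil p0 p1 s) (closure W) \<Longrightarrow>
       card T \<le> card (zeros_in (pencil p0 p1 a) W)"
proof -
  let ?F = "pencil p0 p1"
  let ?Z = "zeros_in (?F a) W"
  have fin: "finite ?Z"
    by (rule finite_zeros_in_nondegenerate[OF analytic_map_pencil[OF p] W nz nd])
  have "\<exists>r U \<xi>. r > 0 \<and> open U \<and> z \<in> U \<and>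
      (\<forall>s x. s \<in> ball a r \<longrightarrow> x \<in> U \<longrightarrow> ?F s x = 0 \<longrightarrow> x = \<xi> s)" if z: "z \<in> ?Z" for z
  proof -
    have "?F a z = 0" "invertible (cjacobian (?F a) z)"
      using z nd by (auto simp: zeros_in_def nondegenerate_on_def)
    then obtain r U \<xi> where "r > 0" "open U" "z \<in> U"
      "\<xi> a = z" "\<And>i. (\<lambda>s. \<xi> s $ i) holomorphic_on ball a r"
      "\<And>s. s \<in> ball a r \<Longrightarrow> ?F s (\<xi> s) = 0"
      "\<And>s x. s \<in> ball a r \<Longrightarrow> x \<in> U \<Longrightarrow> ?F s x = 0 \<Longrightarrow> x = \<xi> s"
      by (rule pencil_nondegenerate_branch[OF p]) (rule that)
    then show ?thesis
      by (intro exI[of _ r] exI[of _ U] exI[of _ \<xi>] conjI allI impI)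
  qed
  then obtain r U \<xi> where *: "\<And>z. z \<in> ?Z \<Longrightarrow> r z > 0 \<and> open (U z) \<and> z \<in> U z \<and>
      (\<forall>s x. s \<in> ball a (r z) \<longrightarrow> x \<in> U z \<longrightarrow> ?F s x = 0 \<longrightarrow> x = \<xi> z s)"
    by metis
  let ?C = "closure W - (\<Union>z\<in>?Z. U z)"
  have "compact ?C"
  proof (intro compact_diff open_UN ballI)
    show "open (U z)" if "z \<in> ?Z" for z using *[OF that] by blast
  qed (use W in simp)
  have C0: "?F a x \<noteq> 0" if "x \<in> ?C" for x
  proof
    assume "?F a x = 0"
    moreover from this have "x \<in> W"
      using zeros_in_closure[where p = "?F a", OF nz] that by blast
    ultimately have "x \<in> ?Z" by (simp add: zeros_in_def)
    with *[OF this] that show False by blast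
  qed
  obtain \<eta> where \<eta>: "\<eta> > 0" "\<And>x. x \<in> ?C \<Longrightarrow> \<eta> \<le> norm (?F a x)"
    using compact_norm_lower_bound[OF \<open>compact ?C\<close>
        analytic_map_imp_continuous_on[OF analytic_map_pencil[OF p]] C0] by metis
  have "bounded ((\<lambda>x. p1 x - p0 x) ` ?C)"
    by (intro compact_imp_bounded compact_continuous_image continuous_intros
        analytic_map_imp_continuous_on p \<open>compact ?C\<close>)
  then obtain M where M: "M > 0" "\<And>x. x \<in> ?C \<Longrightarrow> norm (p1 x - p0 x) \<le> M"
    unfolding bounded_pos by blast
  \<comment> \<open>The radii \<open>r z\<close> give uniqueness near each zero;
    \<open>\<eta> / M\<close> keeps the change of the pencil below the lower bound
    \<open>\<eta>\<close> on the rest of the closure.\<close>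
  define \<rho> where "\<rho> = Min (insert (\<eta> / M) (r ` ?Z))"
  show ?thesis
  proof
    show "\<rho> > 0"
      unfolding \<rho>_def using fin * \<eta> M by (subst Min_gr_iff) auto
    fix s T assume s: "s \<in> ball a \<rho>" and T: "T \<subseteq> zeros_in (?F s) (closure W)"
    have sr: "s \<in> ball a (r z)" if "z \<in> ?Z" for z
    proof -
      have "\<rho> \<le> r z" unfolding \<rho>_def using that fin by (intro Min_le) auto
      then show ?thesis using s by auto
    qed
    have "\<rho> \<le> \<eta> / M" unfolding \<rho>_def using fin by (intro Min_le) auto
    then have s\<eta>: "norm (s - a) < \<eta> / M" using s by (auto simp: dist_norm norm_minus_commute)
    have nC: "?F s x \<noteq> 0" if "x \<in> ?C" for x
    proof
      assume "?F s x = 0"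
      then have "?F a x = - ((s - a) *s (p1 x - p0 x))"
        by (simp add: pencil_def vector_sub_rdistrib vector_ssub_ldistrib algebra_simps eq_neg_iff_add_eq_0)
      then have "norm (?F a x) = norm (s - a) * norm (p1 x - p0 x)"
        by (simp only: norm_minus_cancel norm_scale_vec)
      also have "\<dots> \<le> norm (s - a) * M"
        using M(2)[OF that] by (intro mult_left_mono) auto
      also have "\<dots> < \<eta>" using s\<eta> M by (simp add: pos_less_divide_eq)
      finally show False using \<eta>(2)[OF that] by simp
    qed
    have "T \<subseteq> (\<lambda>z. \<xi> z s) ` ?Z"
    proof
      fix x assume "x \<in> T"
      then have x: "x \<in> closure W" "?F s x = 0" using T by (auto simp: zeros_in_def)
      with nC have "x \<notin> ?C" by blast
      then obtain z where "z \<in> ?Z" "x \<in> U z" using x by auto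
      then show "x \<in> (\<lambda>z. \<xi> z s) ` ?Z" using * sr x by blast
    qed
    then show "card T \<le> card ?Z"
      by (meson card_image_le card_mono fin finite_imageI le_trans)
  qed
qed

text \<open>\<open>b\<close> is the Blaschke factor of the disc of radius \<open>R\<close> with its
  zero at \<open>a\<close>. Both norm claims are read off from the factorisation in
  \<open>key\<close>, whose right-hand side vanishes on the circle and is positive inside.\<close>

lemma Blaschke_factor_norm:
  fixes a s :: complex
  assumes R: "norm a < R" and s: "norm s \<le> R"
  defines "b \<equiv> of_real R * (s - a) / (of_real (R\<^sup>2) - cnj a * s)"
  shows "of_real (R\<^sup>2) - cnj a * s \<noteq> 0"
    and "norm s = R \<Longrightarrow> norm b = 1" and "norm s < R \<Longrightarrow> norm b < 1"
proof -
  have R0: "R > 0" using R by (smt (verit) norm_ge_zero)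
  have key: "(norm (of_real (R\<^sup>2) - cnj a * s))\<^sup>2 - (norm (of_real R * (s - a)))\<^sup>2
      = (R\<^sup>2 - (norm s)\<^sup>2) * (R\<^sup>2 - (norm a)\<^sup>2)"
    unfolding cmod_power2 by (simp add: algebra_simps power2_eq_square)
  have "norm (cnj a * s) < R\<^sup>2"
  proof -
    have "norm (cnj a * s) \<le> norm a * R" using s by (simp add: norm_mult mult_left_mono)
    also have "\<dots> < R * R" using R R0 by simp
    finally show ?thesis by (simp add: power2_eq_square)
  qed
  then show nz: "of_real (R\<^sup>2) - cnj a * s \<noteq> 0"
    using R0 by (metis abs_of_nonneg eq_iff_diff_eq_0 less_irrefl norm_of_real zero_le_power2)
  show "norm b = 1" if "norm s = R"
  proof -
    have "(norm (of_real (R\<^sup>2) - cnj a * s))\<^sup>2 = (norm (of_real R * (s - a)))\<^sup>2"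
      using key that by simp
    then have "norm (of_real (R\<^sup>2) - cnj a * s) = norm (of_real R * (s - a))"
      by (metis norm_ge_zero power2_eq_iff_nonneg)
    then show ?thesis using nz unfolding b_def norm_divide by (metis divide_self_if norm_eq_zero)
  qed
  show "norm b < 1" if "norm s < R"
  proof -
    have "(R\<^sup>2 - (norm s)\<^sup>2) * (R\<^sup>2 - (norm a)\<^sup>2) > 0"
      using that R R0 by (intro mult_pos_pos) (auto intro: power_strict_mono)
    then have "(norm (of_real R * (s - a)))\<^sup>2 < (norm (of_real (R\<^sup>2) - cnj a * s))\<^sup>2"
      using key by simp
    then have "norm (of_real R * (s - a)) < norm (of_real (R\<^sup>2) - cnj a * s)"
      by (metis norm_ge_zero power2_less_imp_less)
    then show ?thesis unfolding b_def norm_divide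
      by (subst divide_less_eq_1_pos) (use nz in simp_all)
  qed
qed


text \<open>Tuples of zeros are represented by total functions whose index type is the infinite type
  of points, so compactness is Tychonoff's theorem.\<close>

lemma compact_function_space:
  fixes K :: "'b::topological_space set"
  assumes "compact K"
  shows "compact {x :: 'a \<Rightarrow> 'b. \<forall>i. x i \<in> K}"
proof -
  have "compactin (product_topology (\<lambda>i::'a. euclidean :: 'b topology) UNIV) (PiE UNIV (\<lambda>i. K))"
    using assms by (simp add: compactin_PiE)
  moreover have "PiE UNIV (\<lambda>i. K) = {x :: 'a \<Rightarrow> 'b. \<forall>i. x i \<in> K}"
    by (auto simp: PiE_def)
  ultimately show ?thesis by (simp add: euclidean_product_topology)
qed

text \<open>The count of nondegenerate zeros can only be smaller at degenerate parameters. The product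
  \<open>\<Psi>\<close> of the Jacobian determinants and the mutual differences along a tuple of zeros is holomorphic
  on each branch and vanishes where zeros collide or degenerate; if it vanished identically near
  \<open>a\<close> but not at \<open>s\<close>, dividing by a high power of the Blaschke factor at \<open>a\<close> would violate the
  maximum principle.\<close>

lemma card_nondegenerate_zeros_pencil_le:
  fixes p0 p1 :: "complex^'n::finite \<Rightarrow> complex^'n"
  assumes p: "analytic_map p0" "analytic_map p1" and W: "open W" "bounded W"
    and nz: "\<And>s x. norm s \<le> R \<Longrightarrow> x \<in> frontier W \<Longrightarrow> pencil p0 p1 s x \<noteq> 0"
    and a: "norm a < R" and nd: "nondegenerate_on (pencil p0 p1 a) W"
    and s1: "norm s1 < R" and T: "finite T" "T \<subseteq> zeros_in (pencil p0 p1 s1) W"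
    and ndT: "\<And>t. t \<in> T \<Longrightarrow> invertible (cjacobian (pencil p0 p1 s1) t)"
  shows "card T \<le> card (zeros_in (pencil p0 p1 a) W)"
proof (rule ccontr)
  assume gt: "\<not> ?thesis"
  let ?F = "pencil p0 p1"
  obtain \<rho> where \<rho>: "\<rho> > 0" "\<And>s T. s \<in> ball a \<rho> \<Longrightarrow> T \<subseteq> zeros_in (?F s) (closure W) \<Longrightarrow>
       card T \<le> card (zeros_in (?F a) W)"
    using pencil_zeros_near_nondegenerate[OF p W(2) nz nd] a by (metis less_imp_le)
  have "\<exists>c. t $ c \<noteq> t' $ c" if "t \<noteq> t'" for t t' :: "complex^'n"
    using that by (auto simp: vec_eq_iff)
  \<comment> \<open>The product needs scalar differences. For each pair a coordinate separating the
    two points at \<open>s1\<close> is fixed; it may stop separating the moving zeros elsewhere,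
    where the product merely vanishes.\<close>
  then obtain c where c: "\<And>t t' :: complex^'n. t \<noteq> t' \<Longrightarrow> t $ c t t' \<noteq> t' $ c t t'"
    by metis
  define \<Psi> where "\<Psi> = (\<lambda>s (x :: complex^'n \<Rightarrow> complex^'n).
      (\<Prod>t\<in>T. det (cjacobian (?F s) (x t))) * (\<Prod>t\<in>T. \<Prod>t'\<in>T-{t}. (x t - x t') $ c t t'))"
  define b where "b = (\<lambda>s. of_real R * (s - a) / (of_real (R\<^sup>2) - cnj a * s))"
  have R0: "R > 0" using a by (smt (verit) norm_ge_zero)
  have b: "norm s \<le> R \<Longrightarrow> of_real (R\<^sup>2) - cnj a * s \<noteq> 0"
    "norm s = R \<Longrightarrow> norm (b s) = 1" "norm s < R \<Longrightarrow> norm (b s) < 1" for s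
    using Blaschke_factor_norm[OF a, of s] unfolding b_def by (blast intro: less_imp_le order_refl)+
  have b0: "b s \<noteq> 0" if "norm s \<le> R" "s \<noteq> a" for s
    using b(1)[OF that(1)] that R0 by (simp add: b_def)
  \<comment> \<open>Removing \<open>ball a (\<rho>/2)\<close> keeps \<open>b\<close> away from its
    zero. By \<open>\<Psi>0\<close>, points of \<open>K\<close> where \<open>\<Psi>\<close> does not
    vanish even lie outside \<open>ball a \<rho>\<close>; the gap leaves room for a small disc of
    parameters around them. All coordinates of the tuple are confined to the closure so that
    \<open>K\<close> is compact.\<close>
  define K where "K = {(s, x). s \<in> cball 0 R - ball a (\<rho>/2) \<and> (\<forall>t. x t \<in> closure W) \<and>
      (\<forall>t\<in>T. ?F s (x t) = 0)}"
  have \<Psi>0: "s \<notin> ball a \<rho>" if "\<Psi> s x \<noteq> 0" "(s, x) \<in> K" for s x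
  proof
    assume s: "s \<in> ball a \<rho>"
    have "inj_on x T"
    proof (rule inj_onI, rule ccontr)
      fix t t' assume "t \<in> T" "t' \<in> T" "x t = x t'" "t \<noteq> t'"
      then have "(\<Prod>t\<in>T. \<Prod>t'\<in>T-{t}. (x t - x t') $ c t t') = 0"
        using T(1) by (simp add: prod_zero_iff) (metis DiffI empty_iff insert_iff)
      then show False using that by (simp add: \<Psi>_def)
    qed
    moreover have "x ` T \<subseteq> zeros_in (?F s) (closure W)"
      using that by (auto simp: K_def zeros_in_def)
    ultimately show False using \<rho>(2)[OF s] gt by (metis card_image)
  qed
  have contF: "continuous_on S (\<lambda>k. ?F (fst k) (snd k t))"
    and contdet: "continuous_on S (\<lambda>k. det (cjacobian (?F (fst k)) (snd k t)))"
    and contx: "continuous_on S (\<lambda>k. snd k t)"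
    for S :: "(complex \<times> (complex^'n \<Rightarrow> complex^'n)) set" and t
  proof -
    show x: "continuous_on S (\<lambda>k. snd k t)"
      by (rule continuous_on_product_then_coordinatewise[where f = snd])
        (rule continuous_on_snd[OF continuous_on_id])
    show "continuous_on S (\<lambda>k. ?F (fst k) (snd k t))"
      by (intro continuous_on_pencil p continuous_intros x)
    show "continuous_on S (\<lambda>k. det (cjacobian (?F (fst k)) (snd k t)))"
      by (intro continuous_on_det_cjacobian_pencil p continuous_intros x)
  qed
  have "compact K"
  proof -
    have "K = ((cball 0 R - ball a (\<rho>/2)) \<times> {x. \<forall>t. x t \<in> closure W}) \<inter>
        (\<Inter>t\<in>T. (\<lambda>k. ?F (fst k) (snd k t)) -` {0})"
      by (auto simp: K_def)
    moreover have "closed (\<Inter>t\<in>T. (\<lambda>k. ?F (fst k) (snd k t)) -` {0})"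
      by (intro closed_INT ballI closed_vimage contF closed_singleton)
    ultimately show ?thesis
      using W by (auto intro!: compact_Int_closed compact_Times compact_function_space compact_diff)
  qed
  have cont\<Psi>: "continuous_on K (\<lambda>k. \<Psi> (fst k) (snd k))"
    unfolding \<Psi>_def by (intro continuous_intros contdet contx)
  have contb: "continuous_on K (\<lambda>k. b (fst k))"
    unfolding b_def using b(1) by (intro continuous_intros) (auto simp: K_def)
  have bK: "b (fst k) \<noteq> 0" if "k \<in> K" for k
    using that \<rho>(1) by (intro b0) (auto simp: K_def)
  have "T \<noteq> {}" using gt by auto
  then obtain t0 where t0: "t0 \<in> T" by blast
  \<comment> \<open>The tuple listing the points of \<open>T\<close>. The default \<open>t0\<close>
    only serves to keep the remaining coordinates in the closure, as \<open>K\<close>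
    demands.\<close>
  define x1 where "x1 = (\<lambda>t. if t \<in> T then t else t0)"
  have x1W: "x1 t \<in> closure W" "t \<in> T \<Longrightarrow> ?F s1 (x1 t) = 0" for t
    using T(2) t0 closure_subset[of W] by (auto simp: x1_def zeros_in_def)
  have \<Psi>1: "\<Psi> s1 x1 \<noteq> 0"
    using T(1) ndT c unfolding \<Psi>_def by (auto simp: prod_zero_iff x1_def invertible_det_nz)
  have "s1 \<notin> ball a \<rho>"
  proof
    assume "s1 \<in> ball a \<rho>"
    moreover have "T \<subseteq> zeros_in (?F s1) (closure W)"
      using T(2) closure_subset[of W] by (auto simp: zeros_in_def)
    ultimately show False using \<rho>(2) gt by blast
  qed
  then have k1: "(s1, x1) \<in> K" and "s1 \<noteq> a"
    using s1 x1W \<rho>(1) by (auto simp: K_def)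
  have bound: "\<exists>k\<in>K. norm (\<Psi> s1 x1) \<le> norm (\<Psi> (fst k) (snd k)) * norm (b s1) ^ m" for m
  proof -
    define \<Theta> where "\<Theta> = (\<lambda>k. norm (\<Psi> (fst k) (snd k)) / norm (b (fst k)) ^ m)"
    have cont\<Theta>: "continuous_on K \<Theta>"
      unfolding \<Theta>_def by (intro continuous_intros cont\<Psi> contb) (use bK in auto)
    obtain k0 where k0: "k0 \<in> K" "\<And>k. k \<in> K \<Longrightarrow> \<Theta> k \<le> \<Theta> k0"
      using continuous_attains_sup[OF \<open>compact K\<close> _ cont\<Theta>] k1 by blast
    \<comment> \<open>Among the maximisers of \<open>\<Theta>\<close> one with the largest real part
      of the parameter is selected. At an interior parameter the maximum principle would make
      \<open>\<Theta>\<close> constant along the branches, and moving to the right would produce a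
      maximiser with larger real part. This avoids continuing branches globally.\<close>
    define Mx where "Mx = K \<inter> \<Theta> -` {\<Theta> k0}"
    have "compact Mx"
    proof -
      have "closedin (top_of_set K) Mx"
        unfolding Mx_def by (rule continuous_closedin_preimage[OF cont\<Theta>]) simp
      then show ?thesis using \<open>compact K\<close> closedin_compact by blast
    qed
    moreover have "continuous_on Mx (\<lambda>k. Re (fst k))" by (intro continuous_intros)
    moreover have "Mx \<noteq> {}" using k0 by (auto simp: Mx_def)
    ultimately obtain k where k: "k \<in> Mx" "\<And>k'. k' \<in> Mx \<Longrightarrow> Re (fst k') \<le> Re (fst k)"
      using continuous_attains_sup[of Mx "\<lambda>k. Re (fst k)"] by blast
    obtain s x where sx: "k = (s, x)" by fastforce
    have kK: "(s, x) \<in> K" and max: "\<And>k'. k' \<in> K \<Longrightarrow> \<Theta> k' \<le> \<Theta> (s, x)"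
      using k k0 by (auto simp: Mx_def sx)
    have "\<Theta> (s1, x1) > 0"
      using \<Psi>1 bK[OF k1] by (simp add: \<Theta>_def)
    then have "\<Theta> (s, x) > 0" using max[OF k1] by simp
    then have \<Psi>k: "\<Psi> s x \<noteq> 0" by (auto simp: \<Theta>_def)
    have s_out: "s \<notin> ball a \<rho>" by (rule \<Psi>0[OF \<Psi>k kK])
    have sR: "norm s \<le> R" using kK by (simp add: K_def)
    have "norm s = R"
    proof (rule ccontr)
      assume "norm s \<noteq> R"
      with sR have sR: "norm s < R" by simp
      have "\<exists>r \<xi>. r > 0 \<and> \<xi> s = x t \<and> (\<forall>i. (\<lambda>s. \<xi> s $ i) holomorphic_on ball s r) \<and>
          (\<forall>s'\<in>ball s r. ?F s' (\<xi> s') = 0 \<and> \<xi> s' \<in> W)" if t: "t \<in> T" for t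
      proof -
        have F0: "?F s (x t) = 0" using kK t by (auto simp: K_def)
        have "x t \<in> closure W" using kK by (auto simp: K_def)
        then have xW: "x t \<in> W" using zeros_in_closure[where p = "?F s", OF nz] F0 sR by simp
        have "det (cjacobian (?F s) (x t)) \<noteq> 0"
          using \<Psi>k t T(1) by (auto simp: \<Psi>_def)
        then have "invertible (cjacobian (?F s) (x t))" by (simp add: invertible_det_nz)
        with F0 obtain r U \<xi> where
          \<xi>: "r > 0" "open U" "x t \<in> U" "\<xi> s = x t" "\<And>i. (\<lambda>s. \<xi> s $ i) holomorphic_on ball s r"
          "\<And>s'. s' \<in> ball s r \<Longrightarrow> ?F s' (\<xi> s') = 0"
          "\<And>s' x. s' \<in> ball s r \<Longrightarrow> x \<in> U \<Longrightarrow> ?F s' x = 0 \<Longrightarrow> x = \<xi> s'"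
          by (rule pencil_nondegenerate_branch[OF p]) (rule that)
        have "continuous_on (ball s r) (\<lambda>s. \<chi> i. \<xi> s $ i)"
          by (intro continuous_intros holomorphic_on_imp_continuous_on \<xi>)
        then have "continuous_on (ball s r) \<xi>" by simp
        then have "open (ball s r \<inter> \<xi> -` W)"
          by (simp add: W(1) continuous_open_preimage)
        moreover have "s \<in> ball s r \<inter> \<xi> -` W" using \<xi> xW by simp
        ultimately obtain r' where r': "r' > 0" "ball s r' \<subseteq> ball s r \<inter> \<xi> -` W"
          by (meson open_contains_ball)
        have "(\<lambda>s. \<xi> s $ i) holomorphic_on ball s r'" for i
          using \<xi>(5) r' holomorphic_on_subset by blast
        then show ?thesis
          using r' \<xi>(4,6) by (intro exI[of _ r'] exI[of _ \<xi>]) auto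
      qed
      then obtain r \<xi> where \<xi>: "\<And>t. t \<in> T \<Longrightarrow> r t > 0 \<and> \<xi> t s = x t \<and>
          (\<forall>i. (\<lambda>s. \<xi> t s $ i) holomorphic_on ball s (r t)) \<and>
          (\<forall>s'\<in>ball s (r t). ?F s' (\<xi> t s') = 0 \<and> \<xi> t s' \<in> W)"
        by metis
      define r0 where "r0 = Min ({R - norm s, \<rho>/2} \<union> r ` T)"
      have r0: "r0 > 0"
        unfolding r0_def using T(1) \<xi> sR \<rho>(1) by (subst Min_gr_iff) auto
      have r0_le: "r0 \<le> R - norm s" "r0 \<le> \<rho>/2" "t \<in> T \<Longrightarrow> r0 \<le> r t" for t
        unfolding r0_def using T(1) by (blast intro: Min_le)+
      define X where "X = (\<lambda>s' t. if t \<in> T then \<xi> t s' else x t)"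
      have XK: "(s', X s') \<in> K" if "s' \<in> ball s r0" for s'
      proof -
        have "norm s' \<le> norm s + dist s s'"
          by (metis dist_norm norm_minus_commute norm_triangle_sub)
        then have 1: "norm s' \<le> R" using that r0_le(1) by simp
        have "dist a s \<le> dist a s' + dist s s'"
          by (metis dist_commute dist_triangle)
        then have 2: "s' \<notin> ball a (\<rho>/2)" using that s_out r0_le(2) by auto
        have 3: "X s' t \<in> closure W" for t
        proof (cases "t \<in> T")
          case True
          then have "s' \<in> ball s (r t)" using that r0_le(3)[OF True] by auto
          then show ?thesis using \<xi>[OF True] closure_subset[of W] True by (auto simp: X_def)
        next
          case False
          then show ?thesis using kK by (simp add: X_def K_def)
        qed
        have 4: "?F s' (X s' t) = 0" if t: "t \<in> T" for t
          using \<xi>[OF t] \<open>s' \<in> ball s r0\<close> r0_le(3)[OF t] t by (auto simp: X_def)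
        show ?thesis using 1 2 3 4 by (simp add: K_def)
      qed
      have hol\<xi>: "(\<lambda>s. \<xi> t s $ i) holomorphic_on ball s r0" if "t \<in> T" for t i
        using \<xi>[OF that] r0_le(3)[OF that] holomorphic_on_subset by (metis subset_ball)
      define H where "H = (\<lambda>s. \<Psi> s (X s) / b s ^ m)"
      have holb: "b holomorphic_on ball s r0" and b_nz: "\<And>s'. s' \<in> ball s r0 \<Longrightarrow> b s' \<noteq> 0"
      proof -
        show "b holomorphic_on ball s r0"
          unfolding b_def
        proof (intro holomorphic_intros)
          show "of_real (R\<^sup>2) - cnj a * s' \<noteq> 0" if "s' \<in> ball s r0" for s'
            using XK[OF that] b(1) by (simp add: K_def)
        qed
        show "b s' \<noteq> 0" if "s' \<in> ball s r0" for s'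
          using bK[OF XK[OF that]] by simp
      qed
      have hol\<Psi>: "(\<lambda>s'. \<Psi> s' (X s')) holomorphic_on ball s r0"
      proof -
        have eq: "\<Psi> s' (X s') = (\<Prod>t\<in>T. det (cjacobian (?F s') (\<xi> t s'))) *
            (\<Prod>t\<in>T. \<Prod>t'\<in>T-{t}. \<xi> t s' $ c t t' - \<xi> t' s' $ c t t')" for s'
          unfolding \<Psi>_def X_def by (intro arg_cong2[where f = "(*)"] prod.cong) auto
        show ?thesis
          unfolding eq
          by (intro holomorphic_intros holomorphic_det_cjacobian_pencil p open_ball hol\<xi>) auto
      qed
      have holH: "H holomorphic_on ball s r0"
        unfolding H_def by (intro holomorphic_intros hol\<Psi> holb) (use b_nz in auto)
      have nH: "norm (H s') = \<Theta> (s', X s')" for s'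
        by (simp add: H_def \<Theta>_def norm_divide norm_power)
      have Xs: "\<Theta> (s, X s) = \<Theta> (s, x)"
      proof -
        have "X s t = x t" for t using \<xi> by (auto simp: X_def)
        then have "X s = x" by (rule ext)
        then show ?thesis by simp
      qed
      have "H constant_on ball s r0"
        by (rule maximum_modulus_principle[OF holH, of "ball s r0" s])
          (use r0 nH Xs max XK in auto)
      then have const: "H s' = H s" if "s' \<in> ball s r0" for s'
        using that r0 by (auto simp: constant_on_def)
      define s' where "s' = s + of_real (r0 / 2)"
      have s': "s' \<in> ball s r0" using r0 by (simp add: s'_def dist_norm)
      have "\<Theta> (s', X s') = \<Theta> k0"
        using const[OF s'] nH[of s'] nH[of s] Xs k(1) by (simp add: sx Mx_def)
      then have "(s', X s') \<in> Mx" using XK[OF s'] by (simp add: Mx_def)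
      then have "Re s' \<le> Re s" using k(2) sx by fastforce
      then show False using r0 by (simp add: s'_def)
    qed
    \<comment> \<open>On the circle \<open>\<Theta>\<close> reduces to the norm of
      \<open>\<Psi>\<close>, bounded on \<open>K\<close> independently of \<open>m\<close>. The
      value at \<open>s1\<close> is thus at most a constant times the power \<open>m\<close> of
      \<open>norm (b s1) < 1\<close>, and letting \<open>m\<close> grow forces it to vanish.\<close>
    then have "norm (b s) = 1" by (rule b(2))
    then have "\<Theta> (s1, x1) \<le> norm (\<Psi> s x)" using max[OF k1] by (simp add: \<Theta>_def)
    then have "norm (\<Psi> s1 x1) \<le> norm (\<Psi> s x) * norm (b s1) ^ m"
      using bK[OF k1] by (simp add: \<Theta>_def pos_divide_le_eq)
    then show ?thesis using kK by force
  qed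
  have "bounded ((\<lambda>k. \<Psi> (fst k) (snd k)) ` K)"
    by (intro compact_imp_bounded compact_continuous_image cont\<Psi> \<open>compact K\<close>)
  then obtain M where M: "\<And>k. k \<in> K \<Longrightarrow> norm (\<Psi> (fst k) (snd k)) \<le> M"
    by (auto simp: bounded_iff)
  have "norm (\<Psi> s1 x1) \<le> M * norm (b s1) ^ m" for m
    using bound[of m] M by (meson mult_right_mono norm_ge_zero order_trans zero_le_power)
  moreover have "(\<lambda>m. M * norm (b s1) ^ m) \<longlonglongrightarrow> M * 0"
    using b(3)[of s1] s1 by (intro tendsto_intros LIMSEQ_power_zero) auto
  ultimately have "norm (\<Psi> s1 x1) \<le> M * 0"
    by (metis LIMSEQ_le_const)
  then show False using \<Psi>1 by simp
qed

section \<open>Regular values\<close>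

text \<open>Sard's theorem in equal dimensions, transported to a real Euclidean space through
  real-linear isomorphisms. A complex kernel vector of the Jacobian is in particular a real one, so
  the real rank drops at critical points.\<close>

lemma negligible_critical_values:
  fixes p :: "complex^'n::finite \<Rightarrow> complex^'n"
  assumes p: "analytic_map p"
  shows "negligible (p ` {x. \<not> invertible (cjacobian p x)})"
proof -
  let ?C = "{x. \<not> invertible (cjacobian p x)}"
  \<comment> \<open>The index type \<open>'n bit0\<close> has twice as many elements as
    \<open>'n\<close>, the real dimension of the complex space.\<close>
  have "DIM(complex^'n) = DIM(real^('n bit0))" by simp
  then obtain e :: "complex^'n \<Rightarrow> real^('n bit0)" and d where
    e: "linear e" "linear d" "\<And>x. d (e x) = x" "\<And>y. e (d y) = y"
    using isomorphisms_UNIV_UNIV by metis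
  let ?D = "\<lambda>y v. e (cjacobian p (d y) *v d v)"
  have "negligible ((\<lambda>y. e (p (d y))) ` (e ` ?C))"
  proof (rule baby_Sard)
    fix y assume y: "y \<in> e ` ?C"
    have "((\<lambda>y. e (p (d y))) has_derivative ?D y) (at y)"
      by (intro bounded_linear.has_derivative[OF linear_conv_bounded_linear[THEN iffD1, OF e(1)]]
          has_derivative_compose[OF _ analytic_map_has_derivative[OF p]]
          bounded_linear_imp_has_derivative linear_conv_bounded_linear[THEN iffD1, OF e(2)])
    then show der: "((\<lambda>y. e (p (d y))) has_derivative ?D y) (at y within e ` ?C)"
      by (rule has_derivative_at_withinI)
    have lin: "linear (?D y)" by (rule has_derivative_linear[OF der])
    have "\<not> invertible (cjacobian p (d y))" using y e by auto
    then obtain v where v: "v \<noteq> 0" "cjacobian p (d y) *v v = 0"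
      by (metis invertible_left_inverse matrix_left_invertible_ker)
    have "\<not> inj ((*v) (matrix (?D y)))"
    proof
      assume "inj ((*v) (matrix (?D y)))"
      then have "inj (?D y)" using lin by simp
      moreover have "?D y (e v) = ?D y 0"
        by (simp add: e v linear_0[OF e(1)] linear_0[OF e(2)])
      ultimately have "e v = 0" by (rule injD)
      then show False using v e(3)[of v] linear_0[OF e(2)] by simp
    qed
    then show "rank (matrix (?D y)) < CARD('n bit0)"
      using full_rank_injective[of "matrix (?D y)"] rank_bound[of "matrix (?D y)"]
      by (metis le_neq_implies_less min.idem)
  qed simp
  then have "negligible (d ` ((\<lambda>y. e (p (d y))) ` (e ` ?C)))"
    by (rule negligible_differentiable_image_negligible[rotated])
      (simp_all add: e linear_imp_differentiable_on)
  moreover have "d ` ((\<lambda>y. e (p (d y))) ` (e ` ?C)) = p ` ?C"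
    by (simp add: image_image e)
  ultimately show ?thesis by simp
qed

lemma small_regular_value:
  fixes p :: "complex^'n::finite \<Rightarrow> complex^'n"
  assumes p: "analytic_map p" and "\<delta> > 0"
  obtains v where "norm v < \<delta>" "analytic_map (\<lambda>x. p x - v)" "nondegenerate_on (\<lambda>x. p x - v) UNIV"
proof -
  have "\<not> negligible (ball (0 :: complex^'n) \<delta>)"
    using \<open>\<delta> > 0\<close> by (simp add: open_not_negligible)
  then have "\<not> ball 0 \<delta> \<subseteq> p ` {x. \<not> invertible (cjacobian p x)}"
    using negligible_critical_values[OF p] negligible_subset by blast
  then obtain v where v: "norm v < \<delta>" "\<And>x. p x = v \<Longrightarrow> invertible (cjacobian p x)"
    by (auto simp: subset_iff image_iff)
  have "cjacobian (\<lambda>x. p x - v) x = cjacobian p x" for x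
    by (rule cjacobian_eqI)
      (rule has_derivative_eq_rhs[OF has_derivative_diff[OF analytic_map_has_derivative[OF p]
            has_derivative_const]], simp)
  then have "nondegenerate_on (\<lambda>x. p x - v) UNIV"
    using v by (auto simp: nondegenerate_on_def)
  moreover have "analytic_map (\<lambda>x. p x - v)"
    using p by (auto simp: analytic_map_iff intro!: analytic_fun_intros)
  ultimately show ?thesis using that v by blast
qed

section \<open>The number of zeros in a bounded open set\<close>

text \<open>The maximum principle needs the parameters 0 and 1 strictly inside the disc; compactness
  of the frontier turns the strict Rouche inequality into the necessary margin.\<close>

lemma rouche_exists_radius:
  fixes p0 p1 :: "complex^'n::finite \<Rightarrow> complex^'n"
  assumes p: "analytic_map p0" "analytic_map p1" and W: "bounded W"
    and lt: "\<And>x. x \<in> frontier W \<Longrightarrow> norm (p1 x - p0 x) < norm (p0 x)"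
  obtains R where "R > 1"
    "\<And>s x. norm s \<le> R \<Longrightarrow> x \<in> frontier W \<Longrightarrow> pencil p0 p1 s x \<noteq> 0"
proof -
  have *: "pencil p0 p1 s x \<noteq> 0" if "norm s * norm (p1 x - p0 x) < norm (p0 x)" for s x
  proof
    assume "pencil p0 p1 s x = 0"
    then have "p0 x = - (s *s (p1 x - p0 x))"
      unfolding pencil_def by (simp only: eq_neg_iff_add_eq_0)
    then have "norm (p0 x) = norm s * norm (p1 x - p0 x)"
      by (metis norm_minus_cancel norm_scale_vec)
    with that show False by simp
  qed
  show ?thesis
  proof (cases "frontier W = {}")
    case True
    then show ?thesis using that[of 2] by simp
  next
    case False
    have "compact (frontier W)" using W by (simp add: compact_frontier_bounded)
    moreover have "continuous_on (frontier W) (\<lambda>x. norm (p1 x - p0 x) / norm (p0 x))"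
      by (intro continuous_intros analytic_map_imp_continuous_on p)
        (use lt in \<open>metis norm_ge_zero not_less norm_zero\<close>)
    ultimately obtain x0 where x0: "x0 \<in> frontier W" "\<And>x. x \<in> frontier W \<Longrightarrow>
        norm (p1 x - p0 x) / norm (p0 x) \<le> norm (p1 x0 - p0 x0) / norm (p0 x0)"
      using continuous_attains_sup[OF _ False] by blast
    define q where "q = norm (p1 x0 - p0 x0) / norm (p0 x0)"
    have pos: "norm (p0 x) > 0" if "x \<in> frontier W" for x
      using lt[OF that] by (smt (verit) norm_ge_zero)
    have q: "0 \<le> q" "q < 1"
      using lt[OF x0(1)] pos[OF x0(1)] by (auto simp: q_def)
    \<comment> \<open>The pencil has no frontier zero while \<open>norm s * q < 1\<close>. This
      value exceeds 1, satisfies \<open>R * q < 1\<close>, and also makes sense for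
      \<open>q = 0\<close>.\<close>
    define R where "R = 2 / (1 + q)"
    have R: "R > 1" "R * q < 1"
      using q by (auto simp: R_def field_simps)
    show ?thesis
    proof (rule that[OF R(1)])
      fix s :: complex and x assume s: "norm s \<le> R" and x: "x \<in> frontier W"
      have "norm (p1 x - p0 x) \<le> q * norm (p0 x)"
        using x0(2)[OF x] pos[OF x] by (simp add: q_def[symmetric] pos_divide_le_eq)
      then have "norm s * norm (p1 x - p0 x) \<le> R * (q * norm (p0 x))"
        using s R q by (intro mult_mono) auto
      also have "\<dots> < norm (p0 x)" using R pos[OF x] by simp
      finally show "pencil p0 p1 s x \<noteq> 0" by (rule *)
    qed
  qed
qed

text \<open>\<open>p1\<close> may be degenerate elsewhere: only the chosen zeros \<open>T\<close>
  have to be nondegenerate. This asymmetry is what later proves finiteness of zeros.\<close>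

lemma rouche_card_le:
  assumes p: "analytic_map p0" "analytic_map p1" and W: "open W" "bounded W"
    and lt: "\<And>x. x \<in> frontier W \<Longrightarrow> norm (p1 x - p0 x) < norm (p0 x)"
    and nd: "nondegenerate_on p0 W" and T: "finite T" "T \<subseteq> zeros_in p1 W" "nondegenerate_on p1 T"
  shows "card T \<le> card (zeros_in p0 W)"
proof -
  obtain R where R: "R > 1"
    "\<And>s x. norm s \<le> R \<Longrightarrow> x \<in> frontier W \<Longrightarrow> pencil p0 p1 s x \<noteq> 0"
    by (rule rouche_exists_radius[OF p W(2)], rule lt, assumption, rule that)
  show ?thesis
    using card_nondegenerate_zeros_pencil_le[OF p W R(2), where a = 0 and ?s1.0 = 1 and T = T] R(1) nd T
    by (auto simp: nondegenerate_on_def zeros_in_def subset_iff)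
qed

text \<open>Both inequalities come from one pencil, by exchanging the parameters 0 and 1 as base
  point; no Rouche inequality relative to \<open>p1\<close> is required.\<close>

lemma rouche_card_eq:
  assumes p: "analytic_map p0" "analytic_map p1" and W: "open W" "bounded W"
    and lt: "\<And>x. x \<in> frontier W \<Longrightarrow> norm (p1 x - p0 x) < norm (p0 x)"
    and nd: "nondegenerate_on p0 W" "nondegenerate_on p1 W"
  shows "card (zeros_in p0 W) = card (zeros_in p1 W)"
proof -
  obtain R where R: "R > 1"
    "\<And>s x. norm s \<le> R \<Longrightarrow> x \<in> frontier W \<Longrightarrow> pencil p0 p1 s x \<noteq> 0"
    by (rule rouche_exists_radius[OF p W(2)], rule lt, assumption, rule that)
  have nz: "p0 x \<noteq> 0" "p1 x \<noteq> 0" if "x \<in> frontier W" for x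
    using R(2)[OF _ that, of 0] R(2)[OF _ that, of 1] R(1) by auto
  have "finite (zeros_in p0 W)" "finite (zeros_in p1 W)"
    using finite_zeros_in_nondegenerate[OF p(1) W(2) nz(1) nd(1)]
      finite_zeros_in_nondegenerate[OF p(2) W(2) nz(2) nd(2)] by auto
  moreover from this have "card (zeros_in p1 W) \<le> card (zeros_in p0 W)"
    using rouche_card_le[OF p W lt nd(1)] nd(2) by (auto simp: nondegenerate_on_def zeros_in_def)
  moreover have "card (zeros_in p0 W) \<le> card (zeros_in p1 W)"
    using card_nondegenerate_zeros_pencil_le[OF p W R(2), where a = 1 and ?s1.0 = 0 and T = "zeros_in p0 W"] R(1) nd calculation(1)
    by (auto simp: nondegenerate_on_def zeros_in_def subset_iff)
  ultimately show ?thesis by simp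
qed

section \<open>The generic number of zeros as a substitute for the degree\<close>

lemma frontier_norm_lower_bound:
  fixes W :: "'a::heine_borel set" and f :: "'a \<Rightarrow> 'b::real_normed_vector"
  assumes "bounded W" "continuous_on (frontier W) f" "\<And>x. x \<in> frontier W \<Longrightarrow> f x \<noteq> 0"
  obtains \<eta> where "\<eta> > 0" "\<And>x. x \<in> frontier W \<Longrightarrow> \<eta> \<le> norm (f x)"
  using compact_norm_lower_bound[OF compact_frontier_bounded[OF assms(1)] assms(2,3)] by metis

text \<open>Plays the part of the Brouwer degree of \<open>f\<close> on \<open>W\<close>. It is a
  relation because the existence of a common count is a theorem, and it quantifies over the full
  Rouche range rather than over small perturbations so that comparison maps can be inserted
  directly.\<close>

definition zero_degree :: "(complex^'n \<Rightarrow> complex^'n::finite) \<Rightarrow> (complex^'n) set \<Rightarrow> nat \<Rightarrow> bool" where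
  "zero_degree f W N \<longleftrightarrow> (\<forall>p. analytic_map p \<longrightarrow> nondegenerate_on p W \<longrightarrow>
     (\<forall>x\<in>frontier W. norm (p x - f x) < norm (f x)) \<longrightarrow>
     finite (zeros_in p W) \<and> card (zeros_in p W) = N)"

lemma small_regular_perturbation:
  assumes f: "analytic_map f" and "\<eta> > 0"
  obtains p where "analytic_map p" "nondegenerate_on p UNIV" "\<And>x. norm (p x - f x) < \<eta>"
proof -
  obtain v where "norm v < \<eta>" "analytic_map (\<lambda>x. f x - v)" "nondegenerate_on (\<lambda>x. f x - v) UNIV"
    using small_regular_value[OF assms] .
  then show ?thesis using that[of "\<lambda>x. f x - v"] by simp
qed

lemma nondegenerate_on_subset: "nondegenerate_on p S \<Longrightarrow> T \<subseteq> S \<Longrightarrow> nondegenerate_on p T"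
  by (auto simp: nondegenerate_on_def)

text \<open>Two maps in the Rouche range of \<open>f\<close> need not be in each other's range. Both
  are compared with a third one, \<open>p1\<close>, chosen so close to \<open>f\<close> that each
  comparison is again a Rouche inequality.\<close>

lemma zero_degree_exists:
  assumes f: "analytic_map f" and W: "open W" "bounded W"
    and nz: "\<And>x. x \<in> frontier W \<Longrightarrow> f x \<noteq> 0"
  shows "\<exists>N. zero_degree f W N"
proof -
  obtain \<eta> where \<eta>: "\<eta> > 0" "\<And>x. x \<in> frontier W \<Longrightarrow> \<eta> \<le> norm (f x)"
    using frontier_norm_lower_bound[OF W(2) analytic_map_imp_continuous_on[OF f] nz] by metis
  obtain p0 where p0: "analytic_map p0" "nondegenerate_on p0 UNIV" "\<And>x. norm (p0 x - f x) < \<eta> / 4"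
    using small_regular_perturbation[OF f, of "\<eta>/4"] \<eta> by (metis divide_pos_pos zero_less_numeral)
  have "zero_degree f W (card (zeros_in p0 W))"
    unfolding zero_degree_def
  proof (intro allI impI conjI)
    fix p assume p: "analytic_map p" "nondegenerate_on p W"
      and lt: "\<forall>x\<in>frontier W. norm (p x - f x) < norm (f x)"
    have pnz: "p x \<noteq> 0" if "x \<in> frontier W" for x
      using lt that by fastforce
    show "finite (zeros_in p W)"
      by (rule finite_zeros_in_nondegenerate[OF p(1) W(2) pnz p(2)])
    have "\<exists>\<mu>>0. \<forall>x\<in>frontier W. \<mu> \<le> norm (f x) - norm (p x - f x)"
    proof (cases "frontier W = {}")
      case False
      have "compact (frontier W)" using W by (simp add: compact_frontier_bounded)
      moreover have "continuous_on (frontier W) (\<lambda>x. norm (f x) - norm (p x - f x))"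
        by (intro continuous_intros analytic_map_imp_continuous_on f p)
      ultimately obtain x0 where "x0 \<in> frontier W" "\<forall>x\<in>frontier W.
          norm (f x0) - norm (p x0 - f x0) \<le> norm (f x) - norm (p x - f x)"
        using continuous_attains_inf[OF _ False] by blast
      then show ?thesis using lt by (intro exI[of _ "norm (f x0) - norm (p x0 - f x0)"]) auto
    qed (auto intro: exI[of _ 1])
    then obtain \<mu> where \<mu>: "\<mu> > 0" "\<And>x. x \<in> frontier W \<Longrightarrow> \<mu> \<le> norm (f x) - norm (p x - f x)"
      by blast
    \<comment> \<open>Passing from \<open>f\<close> to \<open>p1\<close> costs twice the distance
      between them: \<open>\<mu> / 2\<close> is covered by the slack \<open>\<mu>\<close> of
      \<open>p\<close>, and \<open>\<eta> / 4\<close> together with the same distance for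
      \<open>p0\<close> stays below the lower bound \<open>\<eta>\<close> of
      \<open>f\<close>.\<close>
    obtain p1 where p1: "analytic_map p1" "nondegenerate_on p1 UNIV"
      "\<And>x. norm (p1 x - f x) < min (\<mu> / 2) (\<eta> / 4)"
    proof (rule small_regular_perturbation[OF f, of "min (\<mu> / 2) (\<eta> / 4)"])
      show "0 < min (\<mu> / 2) (\<eta> / 4)" using \<eta> \<mu> by simp
    qed (rule that)
    have "card (zeros_in p1 W) = card (zeros_in p W)"
    proof (rule rouche_card_eq[OF p1(1) p(1) W])
      fix x assume x: "x \<in> frontier W"
      have "norm (p x - p1 x) \<le> norm (p x - f x) + norm (p1 x - f x)"
        using norm_triangle_ineq4[of "p x - f x" "p1 x - f x"] by simp
      moreover have "norm (f x) \<le> norm (p1 x) + norm (p1 x - f x)"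
        by (metis norm_minus_commute norm_triangle_sub)
      ultimately show "norm (p x - p1 x) < norm (p1 x)"
        using \<mu>(2)[OF x] p1(3)[of x] by simp
    qed (use p p1 in \<open>auto intro: nondegenerate_on_subset\<close>)
    moreover have "card (zeros_in p1 W) = card (zeros_in p0 W)"
    proof (rule rouche_card_eq[OF p1(1) p0(1) W])
      fix x assume x: "x \<in> frontier W"
      have "norm (p0 x - p1 x) \<le> norm (p0 x - f x) + norm (p1 x - f x)"
        using norm_triangle_ineq4[of "p0 x - f x" "p1 x - f x"] by simp
      moreover have "norm (f x) \<le> norm (p1 x) + norm (p1 x - f x)"
        by (metis norm_minus_commute norm_triangle_sub)
      ultimately show "norm (p0 x - p1 x) < norm (p1 x)"
        using \<eta>(2)[OF x] p1(3)[of x] p0(3)[of x] \<eta>(1) by simp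
    qed (use p0 p1 in \<open>auto intro: nondegenerate_on_subset\<close>)
    ultimately show "card (zeros_in p W) = card (zeros_in p0 W)" by simp
  qed
  then show ?thesis by blast
qed

text \<open>A nondegenerate map close enough to \<open>f'\<close> lies in the Rouche range of both
  maps, so its number of zeros is at once the old and the new degree.\<close>

lemma zero_degree_perturb:
  assumes N: "zero_degree f W N" and f: "analytic_map f" "analytic_map f'" and W: "open W" "bounded W"
    and lt: "\<And>x. x \<in> frontier W \<Longrightarrow> norm (f' x - f x) < norm (f x)"
  shows "zero_degree f' W N"
proof -
  have nz: "f' x \<noteq> 0" if "x \<in> frontier W" for x using lt[OF that] by fastforce
  obtain N' where N': "zero_degree f' W N'"
    using zero_degree_exists[OF f(2) W nz] by blast
  have "\<exists>\<mu>>0. \<forall>x\<in>frontier W. \<mu> \<le> norm (f x) - norm (f' x - f x) \<and> \<mu> \<le> norm (f' x)"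
  proof (cases "frontier W = {}")
    case False
    have "compact (frontier W)" using W by (simp add: compact_frontier_bounded)
    moreover have "continuous_on (frontier W) (\<lambda>x. min (norm (f x) - norm (f' x - f x)) (norm (f' x)))"
      by (intro continuous_intros analytic_map_imp_continuous_on f)
    ultimately obtain x0 where "x0 \<in> frontier W" "\<forall>x\<in>frontier W.
        min (norm (f x0) - norm (f' x0 - f x0)) (norm (f' x0)) \<le>
        min (norm (f x) - norm (f' x - f x)) (norm (f' x))"
      using continuous_attains_inf[OF _ False] by blast
    then show ?thesis using lt nz
      by (intro exI[of _ "min (norm (f x0) - norm (f' x0 - f x0)) (norm (f' x0))"]) auto
  qed (auto intro: exI[of _ 1])
  then obtain \<mu> where \<mu>: "\<mu> > 0" "\<And>x. x \<in> frontier W \<Longrightarrow> \<mu> \<le> norm (f x) - norm (f' x - f x)"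
      "\<And>x. x \<in> frontier W \<Longrightarrow> \<mu> \<le> norm (f' x)"
    by blast
  obtain p where p: "analytic_map p" "nondegenerate_on p UNIV" "\<And>x. norm (p x - f' x) < \<mu>"
    by (rule small_regular_perturbation[OF f(2) \<mu>(1)]) (rule that)
  have nd: "nondegenerate_on p W" using p(2) nondegenerate_on_subset by blast
  have "norm (p x - f x) < norm (f x)" if x: "x \<in> frontier W" for x
  proof -
    have "norm (p x - f x) \<le> norm (p x - f' x) + norm (f' x - f x)"
      using norm_triangle_ineq[of "p x - f' x" "f' x - f x"] by simp
    then show ?thesis using p(3)[of x] \<mu>(2)[OF x] by simp
  qed
  then have "card (zeros_in p W) = N"
    using N p(1) nd unfolding zero_degree_def by blast
  moreover have "card (zeros_in p W) = N'"
    using N' p(1,3) nd \<mu>(3) unfolding zero_degree_def by (meson order_less_le_trans)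
  ultimately show ?thesis using N' by simp
qed

text \<open>By compactness the homotopy stays at least \<open>\<eta>\<close> away from 0 on the
  frontier, so finitely many steps shorter than that bound are each a Rouche perturbation.\<close>

lemma zero_degree_homotopy:
  assumes N: "zero_degree f0 W N" and f: "analytic_map f0" "analytic_map f1"
    and W: "open W" "bounded W"
    and nz: "\<And>t x. t \<in> {0..1} \<Longrightarrow> x \<in> frontier W \<Longrightarrow> pencil f0 f1 (of_real t) x \<noteq> 0"
  shows "zero_degree f1 W N"
proof -
  let ?F = "\<lambda>t. pencil f0 f1 (of_real t)"
  obtain \<eta> where \<eta>: "\<eta> > 0" "\<And>t x. t \<in> {0..1} \<Longrightarrow> x \<in> frontier W \<Longrightarrow> \<eta> \<le> norm (?F t x)"
  proof (cases "frontier W = {}")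
    case False
    let ?K = "{0..1::real} \<times> frontier W"
    have "compact ?K" using W by (intro compact_Times) (auto simp: compact_frontier_bounded)
    moreover have "continuous_on ?K (\<lambda>k. norm (?F (fst k) (snd k)))"
      by (intro continuous_intros continuous_on_pencil f)
    moreover have "?K \<noteq> {}" using False by auto
    ultimately obtain k where "k \<in> ?K" "\<forall>k'\<in>?K. norm (?F (fst k) (snd k)) \<le> norm (?F (fst k') (snd k'))"
      using continuous_attains_inf by blast
    then show ?thesis using nz that[of "norm (?F (fst k) (snd k))"] by fastforce
  qed (use that[of 1] in auto)
  have "bounded ((\<lambda>x. f1 x - f0 x) ` frontier W)"
    using W by (intro compact_imp_bounded compact_continuous_image continuous_intros
        analytic_map_imp_continuous_on f) (simp add: compact_frontier_bounded)
  then obtain M where M: "M > 0" "\<And>x. x \<in> frontier W \<Longrightarrow> norm (f1 x - f0 x) \<le> M"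
    unfolding bounded_pos by blast
  obtain m where m: "M / \<eta> < real m" using reals_Archimedean2 by blast
  then have m0: "m > 0" using M \<eta> by (metis divide_pos_pos gr0I less_asym of_nat_0)
  have "k \<le> m \<Longrightarrow> zero_degree (?F (k / m)) W N" for k
  proof (induction k)
    case 0
    then show ?case using N by simp
  next
    case (Suc k)
    show ?case
    proof (rule zero_degree_perturb[OF Suc.IH])
      fix x assume x: "x \<in> frontier W"
      have "?F (Suc k / m) x - ?F (k / m) x = of_real (1 / m) *s (f1 x - f0 x)"
        by (simp add: pencil_def vec_eq_iff add_divide_distrib algebra_simps)
      then have "norm (?F (Suc k / m) x - ?F (k / m) x) = norm (of_real (1 / m) *s (f1 x - f0 x))"
        by simp
      also have "\<dots> = 1 / m * norm (f1 x - f0 x)" by (simp only: norm_scale_vec norm_of_real) simp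
      also have "\<dots> \<le> 1 / m * M" using M(2)[OF x] by (intro mult_left_mono) auto
      also have "\<dots> < \<eta>" using m m0 \<eta>(1) by (simp add: field_simps)
      also have "\<eta> \<le> norm (?F (k / m) x)" 
        by (rule \<eta>(2)[OF _ x]) (use Suc.prems m0 in \<open>simp add: field_simps\<close>)
      finally show "norm (?F (Suc k / m) x - ?F (k / m) x) < norm (?F (k / m) x)" .
    qed (use Suc.prems W in \<open>auto intro: analytic_map_pencil f\<close>)
  qed
  from this[of m] show ?thesis using m0 by simp
qed

section \<open>Finiteness of zeros and multiplicities\<close>

lemma cpartial_mult_square_eq_0:
  assumes "analytic_fun u" "analytic_fun l" "l z = 0"
  shows "cpartial j (\<lambda>x. u x * (l x)\<^sup>2) z = 0"
  using assms by (simp add: power2_eq_square cpartial_mult analytic_fun_mult)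

text \<open>Hermite interpolation. Near \<open>z\<close> the summand is \<open>x - z\<close> times a
  product equal to 1 at \<open>z\<close>; each squared factor kills both the value and the first
  derivatives at another point of \<open>T\<close>.\<close>

lemma analytic_map_vanishing_with_unit_jacobian:
  fixes T :: "(complex^'n::finite) set"
  assumes "finite T"
  obtains \<phi> where "analytic_map \<phi>" "\<And>z. z \<in> T \<Longrightarrow> \<phi> z = 0" "\<And>z. z \<in> T \<Longrightarrow> cjacobian \<phi> z = mat 1"
proof -
  have "\<exists>c. z $ c \<noteq> w $ c" if "z \<noteq> w" for z w :: "complex^'n"
    using that by (auto simp: vec_eq_iff)
  then obtain c where c: "\<And>z w :: complex^'n. z \<noteq> w \<Longrightarrow> z $ c z w \<noteq> w $ c z w"
    by metis
  define l where "l = (\<lambda>z w x :: complex^'n. inverse (z $ c z w - w $ c z w) * (x $ c z w - w $ c z w))"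
  have l: "analytic_fun (l z w)" for z w
    unfolding l_def by (intro analytic_fun_intros)
  have l0: "l z w w = 0" for z w by (simp add: l_def)
  have l1: "l z w z = 1" if "z \<noteq> w" for z w using c[OF that] by (simp add: l_def)
  define t where "t = (\<lambda>i z x. (x $ i - z $ i) * (\<Prod>w\<in>T-{z}. (l z w x)\<^sup>2))"
  have t: "analytic_fun (t i z)" for i z
    unfolding t_def by (intro analytic_fun_intros l)
  define \<phi> where "\<phi> = (\<lambda>x. \<chi> i. \<Sum>z\<in>T. t i z x)"
  have t_other: "t i z x = (x $ i - z $ i) * (\<Prod>w\<in>T-{z}-{z0}. (l z w x)\<^sup>2) * (l z z0 x)\<^sup>2"
    if "z0 \<in> T" "z \<noteq> z0" for i z z0 x
    unfolding t_def using assms that by (subst prod.remove[of "T - {z}" z0]) (auto simp: mult_ac)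
  show ?thesis
  proof
    show "analytic_map \<phi>"
      unfolding \<phi>_def analytic_map_iff by (auto intro!: analytic_fun_intros t)
    fix z0 assume z0: "z0 \<in> T"
    have "t i z z0 = 0" for i z
      by (cases "z = z0") (simp_all add: t_other[OF z0] l0, simp add: t_def)
    then show "\<phi> z0 = 0" by (simp add: \<phi>_def vec_eq_iff)
    have "cpartial j (t i z) z0 = (if z = z0 then if j = i then 1 else 0 else 0)" for i j z
    proof (cases "z = z0")
      case True
      have 1: "(\<Prod>w\<in>T-{z0}. (l z0 w z0)\<^sup>2) = 1"
      proof (intro prod.neutral ballI)
        fix w assume "w \<in> T - {z0}"
        then have "l z0 w z0 = 1" by (intro l1) auto
        then show "(l z0 w z0)\<^sup>2 = 1" by simp
      qed
      have "cpartial j (\<lambda>x. (x $ i - z0 $ i) * (\<Prod>w\<in>T-{z0}. (l z0 w x)\<^sup>2)) z0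
          = (if j = i then 1 else 0)"
        by (subst cpartial_mult)
          (auto intro!: analytic_fun_intros l simp: 1 cpartial_diff analytic_fun_nth analytic_fun_const)
      then show ?thesis using True by (simp add: t_def)
    next
      case False
      have "cpartial j (\<lambda>x. ((x $ i - z $ i) * (\<Prod>w\<in>T-{z}-{z0}. (l z w x)\<^sup>2)) * (l z z0 x)\<^sup>2) z0 = 0"
        by (intro cpartial_mult_square_eq_0 analytic_fun_intros l l0)
      moreover have "t i z = (\<lambda>x. ((x $ i - z $ i) * (\<Prod>w\<in>T-{z}-{z0}. (l z w x)\<^sup>2)) * (l z z0 x)\<^sup>2)"
        by (rule ext) (rule t_other[OF z0 False])
      ultimately show ?thesis using False by (simp only: if_False)
    qed
    then have "(\<Sum>z\<in>T. cpartial j (t i z) z0) = (if j = i then 1 else 0)" for i j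
      using assms z0 by simp
    then show "cjacobian \<phi> z0 = mat 1"
      unfolding vec_eq_iff cjacobian_nth \<phi>_def vec_lambda_beta cpartial_sum[OF t]
      by (auto simp: mat_def)
  qed
qed

text \<open>The product of the determinants is holomorphic in \<open>\<tau>\<close> and nonzero once
  \<open>\<tau>\<close> exceeds bounds for all the matrices as operators; by the identity theorem it
  cannot vanish on a whole disc around 0.\<close>

lemma small_invertible_shift:
  fixes M :: "'a \<Rightarrow> complex^'n::finite^'n"
  assumes "finite T" "\<delta> > 0"
  obtains \<tau> where "norm \<tau> < \<delta>" "\<And>z. z \<in> T \<Longrightarrow> invertible (\<chi> i j. M z $ i $ j + \<tau> * mat 1 $ i $ j)"
proof -
  let ?S = "\<lambda>\<tau> z. \<chi> i j. M z $ i $ j + \<tau> * (mat 1 :: complex^'n^'n) $ i $ j"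
  define D where "D = (\<lambda>\<tau>. \<Prod>z\<in>T. det (?S \<tau> z))"
  have holD: "D holomorphic_on UNIV"
    unfolding D_def det_def by (simp, intro holomorphic_intros)
  have S: "?S \<tau> z *v v = M z *v v + \<tau> *s v" for \<tau> z v
  proof -
    have "(\<Sum>j\<in>UNIV. (M z $ i $ j + \<tau> * mat 1 $ i $ j) * v $ j)
        = (\<Sum>j\<in>UNIV. M z $ i $ j * v $ j) + \<tau> * (mat 1 *v v) $ i" for i
      by (simp add: matrix_vector_mult_def algebra_simps sum.distrib sum_distrib_left
          del: matrix_vector_mul_lid)
    then have "(?S \<tau> z *v v) $ i = (M z *v v) $ i + \<tau> * (mat 1 *v v) $ i" for i
      by (simp add: matrix_vector_mult_def del: matrix_vector_mul_lid)
    then show ?thesis by (simp add: vec_eq_iff)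
  qed
  have "\<exists>B. \<forall>v. norm (M z *v v) \<le> norm v * B" for z
    using matrix_vector_mult_has_derivative[of "M z" 0 UNIV]
    by (meson has_derivative_bounded_linear bounded_linear.bounded)
  then obtain B where B: "\<And>z v. norm (M z *v v) \<le> norm v * B z" by metis
  obtain \<tau>0 :: real where \<tau>0: "\<tau>0 > 0" "\<And>z. z \<in> T \<Longrightarrow> B z < \<tau>0"
  proof
    let ?m = "Max (insert 0 (B ` T)) + 1"
    have "B z \<le> Max (insert 0 (B ` T))" if "z \<in> T" for z
      using that assms by (intro Max_ge) auto
    moreover have "0 \<le> Max (insert 0 (B ` T))" using assms by (intro Max_ge) auto
    ultimately show "?m > 0" "\<And>z. z \<in> T \<Longrightarrow> B z < ?m" by force+
  qed
  have "invertible (?S (of_real \<tau>0) z)" if z: "z \<in> T" for z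
    unfolding invertible_left_inverse matrix_left_invertible_ker
  proof (intro allI impI, rule ccontr)
    fix v assume 0: "?S (of_real \<tau>0) z *v v = 0" and "v \<noteq> 0"
    then have "M z *v v = - (of_real \<tau>0 *s v)" unfolding S by (simp only: eq_neg_iff_add_eq_0)
    then have "norm (M z *v v) = \<tau>0 * norm v" using \<tau>0 by (simp add: norm_scale_vec)
    with B[of z v] \<open>v \<noteq> 0\<close> \<tau>0(2)[OF z] show False by simp
  qed
  then have D\<tau>0: "D (of_real \<tau>0) \<noteq> 0"
    using assms by (simp add: D_def invertible_det_nz)
  have "\<exists>\<tau>\<in>ball 0 \<delta>. D \<tau> \<noteq> 0"
  proof (rule ccontr)
    assume "\<not> ?thesis"
    then have "D (of_real \<tau>0) = 0"
      by (intro analytic_continuation_open[of "ball 0 \<delta>" UNIV D "\<lambda>_. 0" "of_real \<tau>0"])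
        (use assms holD in auto)
    with D\<tau>0 show False by simp
  qed
  then show ?thesis
    using that assms by (auto simp: D_def invertible_det_nz)
qed

text \<open>Too many zeros of \<open>f\<close> could all be made nondegenerate by a small perturbation vanishing at them,
  which contradicts the bound for nondegenerate zeros.\<close>

lemma finite_zeros_in:
  fixes f :: "complex^'n::finite \<Rightarrow> complex^'n"
  assumes f: "analytic_map f" and W: "open W" "bounded W"
    and nz: "\<And>x. x \<in> frontier W \<Longrightarrow> f x \<noteq> 0"
  shows "finite (zeros_in f W)"
proof (rule ccontr)
  assume inf: "infinite (zeros_in f W)"
  obtain \<eta> where \<eta>: "\<eta> > 0" "\<And>x. x \<in> frontier W \<Longrightarrow> \<eta> \<le> norm (f x)"
    using frontier_norm_lower_bound[OF W(2) analytic_map_imp_continuous_on[OF f] nz] by metis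
  obtain p0 where p0: "analytic_map p0" "nondegenerate_on p0 UNIV" "\<And>x. norm (p0 x - f x) < \<eta> / 4"
    using small_regular_perturbation[OF f, of "\<eta>/4"] \<eta> by (metis divide_pos_pos zero_less_numeral)
  obtain T where T: "finite T" "card T = Suc (card (zeros_in p0 W))" "T \<subseteq> zeros_in f W"
    using infinite_arbitrarily_large[OF inf] by blast
  obtain \<phi> where \<phi>: "analytic_map \<phi>" "\<And>z. z \<in> T \<Longrightarrow> \<phi> z = 0" "\<And>z. z \<in> T \<Longrightarrow> cjacobian \<phi> z = mat 1"
    using analytic_map_vanishing_with_unit_jacobian[OF T(1)] by metis
  have "bounded (\<phi> ` frontier W)"
    using W by (intro compact_imp_bounded compact_continuous_image
        analytic_map_imp_continuous_on \<phi>) (simp add: compact_frontier_bounded)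
  then obtain B where B: "B > 0" "\<And>x. x \<in> frontier W \<Longrightarrow> norm (\<phi> x) \<le> B"
    unfolding bounded_pos by blast
  \<comment> \<open>With this bound \<open>p1\<close> moves by less than \<open>\<eta> / 4\<close>
    on the frontier. As \<open>p0\<close> does too, their distance is below
    \<open>\<eta> / 2\<close>, while \<open>p0\<close> has norm above \<open>3 * \<eta> / 4\<close>
    there.\<close>
  obtain \<tau> where \<tau>: "norm \<tau> < \<eta> / (4 * B)"
      "\<And>z. z \<in> T \<Longrightarrow> invertible (\<chi> i j. cjacobian f z $ i $ j + \<tau> * mat 1 $ i $ j)"
  proof (rule small_invertible_shift[OF T(1), of "\<eta> / (4 * B)" "cjacobian f"])
    show "\<eta> / (4 * B) > 0" using \<eta> B by simp
  qed (rule that)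
  define p1 where "p1 = (\<lambda>x. f x + \<tau> *s \<phi> x)"
  have af: "analytic_fun (\<lambda>x. f x $ i)" "analytic_fun (\<lambda>x. \<phi> x $ i)" for i
    using f \<phi> by (auto simp: analytic_map_iff)
  have p1: "analytic_map p1"
    unfolding p1_def analytic_map_iff by (auto intro!: analytic_fun_intros af)
  have "cjacobian p1 z = (\<chi> i j. cjacobian f z $ i $ j + \<tau> * mat 1 $ i $ j)" if "z \<in> T" for z
    unfolding vec_eq_iff \<phi>(3)[OF that, symmetric] cjacobian_nth p1_def
    by (simp add: cpartial_add cpartial_cmult af analytic_fun_cmult cjacobian_nth)
  then have "nondegenerate_on p1 T"
    using \<tau>(2) by (simp add: nondegenerate_on_def)
  moreover have "T \<subseteq> zeros_in p1 W"
    using T \<phi>(2) by (force simp: zeros_in_def p1_def)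
  moreover have "norm (p1 x - p0 x) < norm (p0 x)" if x: "x \<in> frontier W" for x
  proof -
    have "norm (p1 x - f x) = norm \<tau> * norm (\<phi> x)" by (simp add: p1_def norm_scale_vec)
    also have "\<dots> \<le> norm \<tau> * B" using B(2)[OF x] by (simp add: mult_left_mono)
    also have "\<dots> < \<eta> / 4" using \<tau>(1) B(1) by (simp add: field_simps)
    finally have "norm (p1 x - f x) < \<eta> / 4" .
    moreover have "norm (p1 x - p0 x) \<le> norm (p1 x - f x) + norm (p0 x - f x)"
      using norm_triangle_ineq4[of "p1 x - f x" "p0 x - f x"] by simp
    moreover have "norm (f x) \<le> norm (p0 x) + norm (p0 x - f x)"
      by (metis norm_minus_commute norm_triangle_sub)
    ultimately show ?thesis using \<eta> \<eta>(2)[OF x] p0(3)[of x] by linarith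
  qed
  ultimately have "card T \<le> card (zeros_in p0 W)"
    by (intro rouche_card_le[OF p0(1) p1 W]) (use p0 T in \<open>auto intro: nondegenerate_on_subset\<close>)
  then show False using T by simp
qed

text \<open>A perturbation smaller than the minimum of \<open>f\<close> on the shell between the two
  spheres has no zero in the shell, so the count does not depend on the radius.\<close>

lemma zero_degree_ball_isolated_zero:
  fixes f :: "complex^'n::finite \<Rightarrow> complex^'n"
  assumes f: "analytic_map f" and R: "R > 0" and nz: "\<And>x. x \<in> cball z R \<Longrightarrow> x \<noteq> z \<Longrightarrow> f x \<noteq> 0"
  obtains m where "\<And>r. 0 < r \<Longrightarrow> r \<le> R \<Longrightarrow> zero_degree f (ball z r) m"
proof -
  obtain m where m: "zero_degree f (ball z R) m"
    using zero_degree_exists[OF f open_ball bounded_ball] R nz by (metis dist_self frontier_ball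
        less_irrefl mem_cball mem_sphere order_refl)
  show ?thesis
  proof
    fix r assume r: "0 < r" "r \<le> R"
    obtain m' where m': "zero_degree f (ball z r) m'"
      using zero_degree_exists[OF f open_ball bounded_ball, of z r] r nz
      by (metis dist_self frontier_ball less_irrefl mem_cball mem_sphere)
    let ?C = "cball z R - ball z r"
    have "compact ?C" by (intro compact_diff) auto
    have nzC: "f x \<noteq> 0" if "x \<in> ?C" for x
      using that r by (intro nz) auto
    obtain \<eta> where \<eta>: "\<eta> > 0" "\<And>x. x \<in> ?C \<Longrightarrow> \<eta> \<le> norm (f x)"
      using compact_norm_lower_bound[OF \<open>compact ?C\<close> analytic_map_imp_continuous_on[OF f] nzC] by metis
    obtain p where p: "analytic_map p" "nondegenerate_on p UNIV" "\<And>x. norm (p x - f x) < \<eta>"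
      by (rule small_regular_perturbation[OF f \<eta>(1)]) (rule that)
    have lt: "norm (p x - f x) < norm (f x)" if "x \<in> ?C" for x
      using p(3)[of x] \<eta>(2)[OF that] by linarith
    have "card (zeros_in p (ball z R)) = m" "card (zeros_in p (ball z r)) = m'"
      using m m' p(1,2) r R lt unfolding zero_degree_def
      by (auto simp: nondegenerate_on_def)
    moreover have "zeros_in p (ball z R) = zeros_in p (ball z r)"
      using lt r by (force simp: zeros_in_def)
    ultimately show "zero_degree f (ball z r) m" using m' by simp
  qed
qed

lemma zero_degree_imp_generic_zero_number:
  fixes f :: "complex^'n::finite \<Rightarrow> complex^'n"
  assumes f: "analytic_map f" and R: "R > 0" and nz: "\<And>x. x \<in> cball z R \<Longrightarrow> x \<noteq> z \<Longrightarrow> f x \<noteq> 0"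
    and deg: "\<And>r. 0 < r \<Longrightarrow> r \<le> R \<Longrightarrow> zero_degree f (ball z r) m"
  shows "generic_zero_number f z m"
  unfolding generic_zero_number_def
proof (rule exI[of _ R], intro conjI allI impI R)
  fix r assume r: "0 < r \<and> r \<le> R"
  obtain \<eta> where \<eta>: "\<eta> > 0" "\<And>x. x \<in> frontier (ball z r) \<Longrightarrow> \<eta> \<le> norm (f x)"
  proof (rule frontier_norm_lower_bound[OF bounded_ball analytic_map_imp_continuous_on[OF f]])
    show "f x \<noteq> 0" if "x \<in> frontier (ball z r)" for x
      using that r by (intro nz) auto
  qed (rule that)
  show "\<exists>\<delta>>0. \<forall>p. analytic_map p \<and> (\<forall>x\<in>ball z r. norm (p x - f x) < \<delta>) \<and>
      (\<forall>x\<in>ball z r. p x = 0 \<longrightarrow> invertible (cjacobian p x)) \<longrightarrow>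
      finite {x \<in> ball z r. p x = 0} \<and> card {x \<in> ball z r. p x = 0} = m"
  \<comment> \<open>Closeness is given on the open ball only and reaches the sphere as a weak
    inequality; asking for half of \<open>\<eta>\<close> keeps the Rouche inequality strict.\<close>
  proof (intro exI[of _ "\<eta>/2"] conjI allI impI)
    show "\<eta> / 2 > 0" using \<eta> by simp
    fix p assume p: "analytic_map p \<and> (\<forall>x\<in>ball z r. norm (p x - f x) < \<eta> / 2) \<and>
      (\<forall>x\<in>ball z r. p x = 0 \<longrightarrow> invertible (cjacobian p x))"
    have "norm (p x - f x) < norm (f x)" if x: "x \<in> frontier (ball z r)" for x
    proof -
      have "closure (ball z r) = cball z r" using r by simp
      then have "norm (p x - f x) \<le> \<eta> / 2"
        by (intro continuous_le_on_closure[of "ball z r" "\<lambda>x. norm (p x - f x)" x "\<eta>/2"]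
            continuous_intros analytic_map_imp_continuous_on f)
          (use p x r in \<open>auto intro: less_imp_le\<close>)
      then show ?thesis using \<eta> \<eta>(2)[OF x] by linarith
    qed
    then have *: "finite (zeros_in p (ball z r)) \<and> card (zeros_in p (ball z r)) = m"
      using deg[of r] p r unfolding zero_degree_def by (simp add: nondegenerate_on_def)
    then show "finite {x \<in> ball z r. p x = 0}" "card {x \<in> ball z r. p x = 0} = m"
      by (simp_all add: zeros_in_def)
  qed
qed

text \<open>Sard's theorem provides a perturbation admissible for both numbers on the smaller of the
  two radii. This makes the description operator in \<open>zero_mult\<close> meaningful.\<close>

lemma generic_zero_number_unique:
  fixes f :: "complex^'n::finite \<Rightarrow> complex^'n"
  assumes f: "analytic_map f" and m: "generic_zero_number f z m" "generic_zero_number f z m'"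
  shows "m = m'"
proof -
  let ?A = "\<lambda>r \<delta> m. \<forall>p. analytic_map p \<and> (\<forall>x\<in>ball z r. norm (p x - f x) < \<delta>) \<and>
      (\<forall>x\<in>ball z r. p x = 0 \<longrightarrow> invertible (cjacobian p x)) \<longrightarrow>
      finite {x \<in> ball z r. p x = 0} \<and> card {x \<in> ball z r. p x = 0} = m"
  obtain R where R: "R > 0 \<and> (\<forall>r. 0 < r \<and> r \<le> R \<longrightarrow> (\<exists>\<delta>>0. ?A r \<delta> m))"
    using m(1) unfolding generic_zero_number_def by (rule exE)
  obtain R' where R': "R' > 0 \<and> (\<forall>r. 0 < r \<and> r \<le> R' \<longrightarrow> (\<exists>\<delta>>0. ?A r \<delta> m'))"
    using m(2) unfolding generic_zero_number_def by (rule exE)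
  define r where "r = min R R'"
  have r: "0 < r" "r \<le> R" "r \<le> R'" using R R' by (auto simp: r_def)
  from R r obtain \<delta> where \<delta>: "\<delta> > 0 \<and> ?A r \<delta> m" by (elim conjE allE[of _ r] impE) auto
  from R' r obtain \<delta>' where \<delta>': "\<delta>' > 0 \<and> ?A r \<delta>' m'" by (elim conjE allE[of _ r] impE) auto
  have "min \<delta> \<delta>' > 0" using \<delta> \<delta>' by simp
  then obtain p where p: "analytic_map p" "nondegenerate_on p UNIV" "\<And>x. norm (p x - f x) < min \<delta> \<delta>'"
    by (rule small_regular_perturbation[OF f]) (rule that)
  then show ?thesis
    using conjunct2[OF \<delta>, rule_format, of p] conjunct2[OF \<delta>', rule_format, of p]
    by (simp add: nondegenerate_on_def)
qed

lemma isolated_zero_mult: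
  fixes f :: "complex^'n::finite \<Rightarrow> complex^'n"
  assumes f: "analytic_map f" and iso: "isolated_zero f z"
  obtains m R where "R > 0" "zero_mult f z = enat m" "\<And>x. x \<in> cball z R \<Longrightarrow> x \<noteq> z \<Longrightarrow> f x \<noteq> 0"
    "\<And>r. 0 < r \<Longrightarrow> r \<le> R \<Longrightarrow> zero_degree f (ball z r) m"
proof -
  from iso have "\<forall>\<^sub>F x in at z. f x \<noteq> 0" by (simp add: isolated_zero_def)
  then obtain d where d: "d > 0" "\<And>x. x \<noteq> z \<Longrightarrow> dist x z < d \<Longrightarrow> f x \<noteq> 0"
    by (auto simp: eventually_at)
  define R where "R = d / 2"
  have R: "R > 0" "\<And>x. x \<in> cball z R \<Longrightarrow> x \<noteq> z \<Longrightarrow> f x \<noteq> 0"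
    using d by (auto simp: R_def dist_commute)
  obtain m where m: "\<And>r. 0 < r \<Longrightarrow> r \<le> R \<Longrightarrow> zero_degree f (ball z r) m"
    by (rule zero_degree_ball_isolated_zero[OF f R(1)], rule R(2), assumption+, rule that)
  have gen: "generic_zero_number f z m"
    by (rule zero_degree_imp_generic_zero_number[OF f R(1)], rule R(2), assumption+, rule m)
  then have "(THE m. generic_zero_number f z m) = m"
    using generic_zero_number_unique[OF f] by blast
  then have "zero_mult f z = enat m" using iso by (simp add: zero_mult_def)
  then show ?thesis using that R m by blast
qed

section \<open>Counting zeros with multiplicity\<close>

text \<open>One generic map \<open>p\<close> is counted twice. It is in the Rouche range of
  \<open>h\<close> on \<open>W\<close>, giving \<open>N\<close> zeros, and in that of
  \<open>f\<close> on small balls around the zeros of \<open>f\<close>, giving their multiplicities;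
  all its zeros in \<open>W\<close> lie in these balls. Balls around frontier zeros stick out of
  \<open>W\<close>, which accounts for the inequality.\<close>

lemma sum_zero_mult_closure:
  fixes f h :: "complex^'n::finite \<Rightarrow> complex^'n"
  assumes f: "analytic_map f" and h: "analytic_map h" and W: "open W" "bounded W"
    and N: "zero_degree h W N" and hnz: "\<And>x. x \<in> frontier W \<Longrightarrow> h x \<noteq> 0"
    and le: "\<And>x. x \<in> frontier W \<Longrightarrow> norm (f x - h x) \<le> norm (h x)"
    and fin: "finite (zeros_in f (closure W))"
    and iso: "\<And>z. z \<in> zeros_in f (closure W) \<Longrightarrow> isolated_zero f z"
  obtains m where "\<And>z. z \<in> zeros_in f (closure W) \<Longrightarrow> zero_mult f z = enat (m z)"
    "N \<le> (\<Sum>z\<in>zeros_in f (closure W). m z)"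
    "zeros_in f (closure W) \<subseteq> W \<Longrightarrow> N = (\<Sum>z\<in>zeros_in f (closure W). m z)"
proof -
  let ?Z = "zeros_in f (closure W)"
  have "\<exists>m R. R > 0 \<and> zero_mult f z = enat m \<and> (\<forall>x. x \<in> cball z R \<longrightarrow> x \<noteq> z \<longrightarrow> f x \<noteq> 0) \<and>
      (\<forall>r. 0 < r \<longrightarrow> r \<le> R \<longrightarrow> zero_degree f (ball z r) m)" if z: "z \<in> ?Z" for z
  proof -
    obtain m R where mR: "R > 0" "zero_mult f z = enat m" "\<And>x. x \<in> cball z R \<Longrightarrow> x \<noteq> z \<Longrightarrow> f x \<noteq> 0"
      "\<And>r. 0 < r \<Longrightarrow> r \<le> R \<Longrightarrow> zero_degree f (ball z r) m"
      by (rule isolated_zero_mult[OF f iso[OF z]]) (rule that)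
    show ?thesis
      by (rule exI[of _ m], rule exI[of _ R]) (intro conjI allI impI mR)
  qed
  then obtain m R where mR: "\<And>z. z \<in> ?Z \<Longrightarrow> R z > 0 \<and> zero_mult f z = enat (m z) \<and>
      (\<forall>x. x \<in> cball z (R z) \<longrightarrow> x \<noteq> z \<longrightarrow> f x \<noteq> 0) \<and>
      (\<forall>r. 0 < r \<longrightarrow> r \<le> R z \<longrightarrow> zero_degree f (ball z r) (m z))"
    by metis
  have "\<exists>d>0. z \<in> W \<longrightarrow> ball z d \<subseteq> W" for z
    using W(1) by (metis open_contains_ball zero_less_one)
  then obtain d where d: "\<And>z. d z > 0" "\<And>z. z \<in> W \<Longrightarrow> ball z (d z) \<subseteq> W" by metis
  \<comment> \<open>The three families keep each ball within the radius where its multiplicity is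
    valid, inside \<open>W\<close> if its centre is, and disjoint from the others. The element 1
    covers an empty set of zeros.\<close>
  define r where "r = Min (insert 1 (R ` ?Z \<union> d ` ?Z \<union> (\<lambda>(z, w). dist z w / 2) ` {(z, w) \<in> ?Z \<times> ?Z. z \<noteq> w}))"
  let ?M = "insert 1 (R ` ?Z \<union> d ` ?Z \<union> (\<lambda>(z, w). dist z w / 2) ` {(z, w) \<in> ?Z \<times> ?Z. z \<noteq> w})"
  have "finite {(z, w) \<in> ?Z \<times> ?Z. z \<noteq> w}"
    by (rule finite_subset[of _ "?Z \<times> ?Z"]) (use fin in auto)
  then have finM: "finite ?M" using fin by blast
  have r0: "r > 0"
    unfolding r_def using finM mR d(1) by (subst Min_gr_iff) auto
  have rle: "r \<le> y" if "y \<in> ?M" for y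
    unfolding r_def using finM that by (rule Min_le)
  have rR: "r \<le> R z" "r \<le> d z" if "z \<in> ?Z" for z using that by (auto intro: rle)
  have disj: "ball z r \<inter> ball w r = {}" if "z \<in> ?Z" "w \<in> ?Z" "z \<noteq> w" for z w
  proof -
    have "dist z w / 2 \<in> ?M" using that by force
    from rle[OF this] have "2 * r \<le> dist z w" by simp
    then show ?thesis by (intro disjoint_ballI) simp
  qed
  let ?B = "\<Union>z\<in>?Z. ball z r"
  let ?C = "(closure W - ?B) \<union> (\<Union>z\<in>?Z. sphere z r)"
  have "compact ?C"
    using W fin by (intro compact_Un compact_diff compact_UN) auto
  have "f x \<noteq> 0" if "x \<in> ?C" for x
  proof
    assume fx: "f x = 0"
    show False
    proof (cases "\<exists>z\<in>?Z. x \<in> sphere z r")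
      case True
      then obtain z where z: "z \<in> ?Z" "x \<in> sphere z r" by blast
      then have "x \<in> cball z (R z)" "x \<noteq> z" using rR(1)[OF z(1)] r0 by auto
      then show False using mR[OF z(1)] fx by blast
    next
      case False
      then have "x \<in> closure W" "x \<notin> ?B" using that by auto
      then have "x \<in> ?Z" using fx by (simp add: zeros_in_def)
      then show False using \<open>x \<notin> ?B\<close> r0 by auto
    qed
  qed
  then obtain \<eta> where \<eta>: "\<eta> > 0" "\<And>x. x \<in> ?C \<Longrightarrow> \<eta> \<le> norm (f x)"
    using compact_norm_lower_bound[OF \<open>compact ?C\<close> analytic_map_imp_continuous_on[OF f]] by blast
  obtain \<mu> where \<mu>: "\<mu> > 0" "\<And>x. x \<in> frontier W \<Longrightarrow> \<mu> \<le> norm (h x)"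
    by (rule frontier_norm_lower_bound[OF W(2) analytic_map_imp_continuous_on[OF h]], rule hnz, assumption, rule that)
  have "bounded ((\<lambda>x. f x - h x) ` ?C)"
    by (intro compact_imp_bounded compact_continuous_image continuous_intros
        analytic_map_imp_continuous_on f h \<open>compact ?C\<close>)
  then obtain B where B: "B > 0" "\<And>x. x \<in> ?C \<Longrightarrow> norm (f x - h x) \<le> B"
    unfolding bounded_pos by blast
  \<comment> \<open>Moving \<open>f\<close> by the fraction \<open>\<tau>\<close> towards
    \<open>h\<close> creates the slack \<open>\<tau> * norm (h x)\<close> in the weak Rouche
    inequality, yet changes \<open>f\<close> by less than \<open>\<eta> / 2\<close> on
    \<open>?C\<close>.\<close>
  define \<tau> where "\<tau> = min (1/2) (\<eta> / (4 * B))"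
  have \<tau>: "0 < \<tau>" "\<tau> < 1" "\<tau> * B < \<eta> / 2"
  proof -
    show "0 < \<tau>" "\<tau> < 1" using \<eta> B by (auto simp: \<tau>_def)
    have "\<tau> * B \<le> \<eta> / (4 * B) * B" using B by (intro mult_right_mono) (auto simp: \<tau>_def)
    also have "\<dots> < \<eta> / 2" using \<eta> B by simp
    finally show "\<tau> * B < \<eta> / 2" .
  qed
  let ?q = "pencil f h (of_real \<tau>)"
  have qf: "norm (?q x - f x) = \<tau> * norm (f x - h x)" for x
  proof -
    have "?q x - f x = of_real \<tau> *s (h x - f x)" by (simp add: pencil_def)
    then show ?thesis using \<tau> by (simp only: norm_scale_vec norm_of_real norm_minus_commute)
  qed
  have qh: "norm (?q x - h x) = (1 - \<tau>) * norm (f x - h x)" for x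
  proof -
    have "?q x - h x = of_real (1 - \<tau>) *s (f x - h x)" by (simp add: pencil_def vec_eq_iff algebra_simps)
    then show ?thesis using \<tau> by (simp only: norm_scale_vec norm_of_real)
  qed
  \<comment> \<open>The remaining half of \<open>\<eta>\<close> keeps \<open>p\<close> in the range
    of \<open>f\<close> on \<open>?C\<close>; \<open>\<tau> * \<mu>\<close> is the slack towards
    \<open>h\<close> on the frontier.\<close>
  have "min (\<eta> / 2) (\<tau> * \<mu>) > 0" using \<eta> \<tau> \<mu> by simp
  then obtain p where p: "analytic_map p" "nondegenerate_on p UNIV"
    "\<And>x. norm (p x - ?q x) < min (\<eta> / 2) (\<tau> * \<mu>)"
    by (rule small_regular_perturbation[OF analytic_map_pencil[OF f h]]) (rule that)
  have pnd: "nondegenerate_on p S" for S using p(2) by (auto intro: nondegenerate_on_subset)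
  have pf: "norm (p x - f x) < norm (f x)" if x: "x \<in> ?C" for x
  proof -
    have "norm (p x - f x) \<le> norm (p x - ?q x) + norm (?q x - f x)"
      using norm_triangle_ineq[of "p x - ?q x" "?q x - f x"] by simp
    moreover have "norm (?q x - f x) \<le> \<tau> * B"
      unfolding qf using B(2)[OF x] \<tau> by (intro mult_left_mono) auto
    ultimately show ?thesis using p(3)[of x] \<tau>(3) \<eta>(2)[OF x] by linarith
  qed
  have ph: "norm (p x - h x) < norm (h x)" if x: "x \<in> frontier W" for x
  proof -
    have "norm (p x - h x) \<le> norm (p x - ?q x) + norm (?q x - h x)"
      using norm_triangle_ineq[of "p x - ?q x" "?q x - h x"] by simp
    moreover have "norm (?q x - h x) \<le> (1 - \<tau>) * norm (h x)"
      unfolding qh using le[OF x] \<tau> by (intro mult_left_mono) auto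
    moreover have "\<tau> * \<mu> \<le> \<tau> * norm (h x)" using \<mu>(2)[OF x] \<tau> by simp
    ultimately show ?thesis using p(3)[of x] by (simp add: algebra_simps)
  qed
  have cardW: "card (zeros_in p W) = N" "finite (zeros_in p W)"
    using N p(1) pnd ph unfolding zero_degree_def by blast+
  have cardz: "finite (zeros_in p (ball z r))" "card (zeros_in p (ball z r)) = m z" if z: "z \<in> ?Z" for z
  proof -
    have "zero_degree f (ball z r) (m z)" using mR[OF z] r0 rR(1)[OF z] by blast
    moreover have "norm (p x - f x) < norm (f x)" if "x \<in> frontier (ball z r)" for x
      by (rule pf) (use that z r0 in auto)
    ultimately show "finite (zeros_in p (ball z r))" "card (zeros_in p (ball z r)) = m z"
      using p(1) pnd unfolding zero_degree_def by blast+
  qed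
  have sub: "zeros_in p W \<subseteq> (\<Union>z\<in>?Z. zeros_in p (ball z r))"
  proof
    fix x assume x: "x \<in> zeros_in p W"
    then have "x \<in> closure W" "p x = 0" using closure_subset[of W] by (auto simp: zeros_in_def)
    moreover have "x \<notin> ?C" using pf[of x] \<open>p x = 0\<close> by auto
    ultimately show "x \<in> (\<Union>z\<in>?Z. zeros_in p (ball z r))" by (auto simp: zeros_in_def)
  qed
  have cardU: "card (\<Union>z\<in>?Z. zeros_in p (ball z r)) = (\<Sum>z\<in>?Z. m z)"
  proof -
    have "card (\<Union>z\<in>?Z. zeros_in p (ball z r)) = (\<Sum>z\<in>?Z. card (zeros_in p (ball z r)))"
    proof (rule card_UN_disjoint[OF fin])
      show "\<forall>z\<in>?Z. finite (zeros_in p (ball z r))" using cardz by blast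
      show "\<forall>z\<in>?Z. \<forall>w\<in>?Z. z \<noteq> w \<longrightarrow> zeros_in p (ball z r) \<inter> zeros_in p (ball w r) = {}"
        using disj unfolding zeros_in_def by blast
    qed
    then show ?thesis using cardz(2) by simp
  qed
  have finU: "finite (\<Union>z\<in>?Z. zeros_in p (ball z r))" using fin cardz(1) by blast
  show ?thesis
  proof
    show "zero_mult f z = enat (m z)" if "z \<in> ?Z" for z using mR[OF that] by blast
    show "N \<le> (\<Sum>z\<in>?Z. m z)"
      using card_mono[OF finU sub] cardW(1) cardU by simp
    assume ZW: "?Z \<subseteq> W"
    have "(\<Union>z\<in>?Z. zeros_in p (ball z r)) \<subseteq> zeros_in p W"
    proof
      fix x assume "x \<in> (\<Union>z\<in>?Z. zeros_in p (ball z r))"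
      then obtain z where z: "z \<in> ?Z" "x \<in> ball z r" "p x = 0" by (auto simp: zeros_in_def)
      moreover have "ball z r \<subseteq> W" using d(2)[of z] z(1) ZW rR(2)[OF z(1)] by (meson subset_ball subset_trans subsetD)
      ultimately show "x \<in> zeros_in p W" by (auto simp: zeros_in_def)
    qed
    with sub have "zeros_in p W = (\<Union>z\<in>?Z. zeros_in p (ball z r))" by blast
    then show "N = (\<Sum>z\<in>?Z. m z)" using cardW(1) cardU by simp
  qed
qed

lemma sum_enat: "(\<Sum>z\<in>Z. enat (m z)) = enat (\<Sum>z\<in>Z. m z)"
  by (induction Z rule: infinite_finite_induct) (auto simp: zero_enat_def)

text \<open>If the zeros in the closure are infinite in number, or one is not isolated (zeros
  outside may accumulate at a frontier zero), the count is infinite and the lower bound is trivial.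
  With no frontier zeros, finiteness in the open set forces isolation.\<close>

lemma zero_count_closure:
  fixes f h :: "complex^'n::finite \<Rightarrow> complex^'n"
  assumes f: "analytic_map f" and h: "analytic_map h" and W: "open W" "bounded W"
    and N: "zero_degree h W N" and hnz: "\<And>x. x \<in> frontier W \<Longrightarrow> h x \<noteq> 0"
    and le: "\<And>x. x \<in> frontier W \<Longrightarrow> norm (f x - h x) \<le> norm (h x)"
  shows "enat N \<le> zero_count f (closure W)"
    and "(\<And>x. x \<in> frontier W \<Longrightarrow> f x \<noteq> 0) \<Longrightarrow> zero_count f (closure W) = enat N"
proof -
  let ?Z = "zeros_in f (closure W)"
  have count: "zero_count f (closure W) = (if finite ?Z then \<Sum>z\<in>?Z. zero_mult f z else \<infinity>)"
    by (simp add: zero_count_def zeros_in_def)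
  show "enat N \<le> zero_count f (closure W)"
  proof (cases "finite ?Z \<and> (\<forall>z\<in>?Z. isolated_zero f z)")
    case True
    then obtain m where m: "\<And>z. z \<in> ?Z \<Longrightarrow> zero_mult f z = enat (m z)" "N \<le> (\<Sum>z\<in>?Z. m z)"
      using sum_zero_mult_closure[OF f h W N hnz le] by metis
    then show ?thesis using True by (simp add: count sum_enat)
  next
    case False
    then show ?thesis
    proof (cases "finite ?Z")
      case True
      with False obtain z where z: "z \<in> ?Z" "\<not> isolated_zero f z" by blast
      then have "zero_mult f z = \<infinity>" by (simp add: zero_mult_def)
      then have "(\<Sum>z\<in>?Z. zero_mult f z) = \<infinity>"
        using True z(1) by (simp add: sum.remove)
      then show ?thesis using True by (simp add: count)
    qed (simp add: count)
  qed
  assume fnz: "\<And>x. x \<in> frontier W \<Longrightarrow> f x \<noteq> 0"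
  have ZW: "?Z = zeros_in f W"
    using zeros_in_closure[where p = f, OF fnz] closure_subset[of W] by (auto simp: zeros_in_def)
  have fin: "finite ?Z" unfolding ZW by (rule finite_zeros_in[OF f W fnz])
  have "isolated_zero f z" if z: "z \<in> ?Z" for z
  proof -
    have "open (W - (?Z - {z}))" using W(1) fin by (intro open_Diff finite_imp_closed) auto
    moreover have "z \<in> W - (?Z - {z})" using z ZW by (auto simp: zeros_in_def)
    ultimately have "\<forall>\<^sub>F x in at z. x \<in> W - (?Z - {z}) \<and> x \<noteq> z"
      by (intro eventually_conj eventually_at_in_open' eventually_neq_at_within) auto
    then have "\<forall>\<^sub>F x in at z. f x \<noteq> 0"
      by eventually_elim (use ZW in \<open>auto simp: zeros_in_def\<close>)
    then show ?thesis using z by (simp add: isolated_zero_def zeros_in_def)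
  qed
  moreover have "?Z \<subseteq> W" using ZW by (auto simp: zeros_in_def)
  ultimately obtain m where "\<And>z. z \<in> ?Z \<Longrightarrow> zero_mult f z = enat (m z)" "N = (\<Sum>z\<in>?Z. m z)"
    using sum_zero_mult_closure[OF f h W N hnz le fin] by metis
  then show "zero_count f (closure W) = enat N" using fin by (simp add: count sum_enat)
qed

section \<open>The zero count of a nondegenerate quasi-homogeneous quadratic map\<close>

definition quad_map :: "'n set \<Rightarrow> ('n \<Rightarrow> 'n \<Rightarrow> 'n \<Rightarrow> complex) \<Rightarrow> complex^'n \<Rightarrow> complex^'n::finite" where
  "quad_map F a x = (\<chi> i. \<Sum>j\<in>F. \<Sum>k\<in>F. a i j k * x $ j * x $ k)"

definition lin_map :: "'n set \<Rightarrow> ('n \<Rightarrow> 'n \<Rightarrow> complex) \<Rightarrow> complex^'n \<Rightarrow> complex^'n::finite" where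
  "lin_map F b x = (\<chi> i. \<Sum>k\<in>-F. b i k * x $ k)"

definition square_map :: "'n set \<Rightarrow> ('n \<Rightarrow> complex^'n) \<Rightarrow> complex^'n \<Rightarrow> complex^'n::finite" where
  "square_map T h x = (\<Sum>j\<in>T. (x $ j)\<^sup>2 *s h j)"

text \<open>Weighted dilation with weight 1 on \<open>F\<close> and 2 elsewhere. Quadratic maps in
  the \<open>F\<close> coordinates and linear maps in the others all have degree 2 under it.\<close>

definition quasi_scale :: "'n set \<Rightarrow> complex \<Rightarrow> complex^'n \<Rightarrow> complex^'n::finite" where
  "quasi_scale F r x = (\<chi> j. if j \<in> F then r * x $ j else r\<^sup>2 * x $ j)"

lemma quad_map_scale: "quad_map F a (quasi_scale F r x) = r\<^sup>2 *s quad_map F a x"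
  by (simp add: quad_map_def quasi_scale_def vec_eq_iff sum_distrib_left power2_eq_square mult_ac)

lemma lin_map_scale: "lin_map F b (quasi_scale F r x) = r\<^sup>2 *s lin_map F b x"
  by (simp add: lin_map_def quasi_scale_def vec_eq_iff sum_distrib_left mult_ac)

lemma square_map_scale: "T \<subseteq> F \<Longrightarrow> square_map T h (quasi_scale F r x) = r\<^sup>2 *s square_map T h x"
  by (auto simp: square_map_def quasi_scale_def vec_eq_iff sum_distrib_left power_mult_distrib
      mult_ac subset_iff intro!: sum.cong)

lemma analytic_map_quad_map: "analytic_map (quad_map F a)"
  unfolding analytic_map_iff quad_map_def by (auto intro!: analytic_fun_intros)

lemma analytic_map_lin_map: "analytic_map (lin_map F b)"
  unfolding analytic_map_iff lin_map_def by (auto intro!: analytic_fun_intros)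

lemma analytic_map_square_map: "analytic_map (square_map T h)"
proof -
  have "analytic_fun (\<lambda>x. \<Sum>j\<in>T. h j $ i * (x $ j)\<^sup>2)" for i
    by (intro analytic_fun_intros)
  then show ?thesis unfolding analytic_map_iff square_map_def by (simp add: mult.commute)
qed

lemma analytic_map_add:
  "analytic_map f \<Longrightarrow> analytic_map g \<Longrightarrow> analytic_map (\<lambda>x. f x + g x)"
  by (auto simp: analytic_map_iff intro!: analytic_fun_intros)

section \<open>Joining the quadratic part to a sum of squares\<close>

lemma negligible_real_coordinate: "negligible {x :: complex^'n::finite. Im (x $ i) = 0}"
proof -
  have "{x :: complex^'n. Im (x $ i) = 0} = {x. axis i \<i> \<bullet> x = 0}"
    by (simp add: inner_axis' inner_complex_def)
  then show ?thesis using negligible_hyperplane[of "axis i \<i> :: complex^'n" 0] by (simp add: axis_eq_0_iff)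
qed

text \<open>The forbidden \<open>c\<close> are the values of \<open>- g x / x $ i\<close>, a
  differentiable map on part of a real hyperplane. The domain is a null set, hence so is the
  image.\<close>

lemma exists_avoiding_value:
  fixes g :: "complex^'n::finite \<Rightarrow> complex^'n"
  assumes g: "analytic_map g"
  obtains c where "\<And>x. Im (x $ i) = 0 \<Longrightarrow> x $ i \<noteq> 0 \<Longrightarrow> g x + x $ i *s c \<noteq> 0"
proof -
  let ?S = "{x :: complex^'n. Im (x $ i) = 0 \<and> x $ i \<noteq> 0}"
  let ?f = "\<lambda>x. inverse (x $ i) *s (- g x)"
  have "?f differentiable_on ?S"
    unfolding differentiable_on_def
  proof
    fix x assume x: "x \<in> ?S"
    have "\<exists>D. ((\<lambda>x. ?f x $ k) has_derivative D) (at x within ?S)" for k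
    proof -
      have 1: "((\<lambda>x. - g x $ k) has_derivative (\<lambda>v. - (\<Sum>j\<in>UNIV. cpartial j (\<lambda>x. g x $ k) x * v $ j)))
          (at x within ?S)"
        using g by (intro has_derivative_minus has_derivative_at_withinI[OF analytic_fun_has_derivative])
          (simp add: analytic_map_iff)
      have 2: "((\<lambda>x. inverse (x $ i)) has_derivative
          (\<lambda>v. - (inverse (x $ i) * v $ i * inverse (x $ i)))) (at x within ?S)"
        by (rule Deriv.has_derivative_inverse[OF _ bounded_linear_imp_has_derivative[OF bounded_linear_vec_nth]])
          (use x in simp)
      show ?thesis
        unfolding vector_smult_component vector_uminus_component by (rule exI, rule has_derivative_mult[OF 2 1])
    qed
    then have "\<forall>k. \<exists>D. ((\<lambda>x. ?f x $ k) has_derivative D) (at x within ?S)" ..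
    from choice[OF this] obtain D where "\<forall>k. ((\<lambda>x. ?f x $ k) has_derivative D k) (at x within ?S)" ..
    then have "(?f has_derivative (\<lambda>v. \<chi> k. D k v)) (at x within ?S)"
      by (simp add: has_derivative_vec_iff)
    then show "?f differentiable at x within ?S" unfolding differentiable_def by blast
  qed
  moreover have "negligible ?S"
    by (rule negligible_subset[OF negligible_real_coordinate[of i]]) auto
  ultimately have "negligible (?f ` ?S)"
    by (intro negligible_differentiable_image_negligible) auto
  then have "?f ` ?S \<noteq> UNIV"
    using open_not_negligible[of "UNIV :: (complex^'n) set"] by auto
  then obtain c where c: "c \<notin> ?f ` ?S" by blast
  show ?thesis
  proof
    fix x :: "complex^'n" assume x: "Im (x $ i) = 0" "x $ i \<noteq> 0"
    show "g x + x $ i *s c \<noteq> 0"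
    proof
      assume "g x + x $ i *s c = 0"
      then have "- g x = x $ i *s c" by (simp add: neg_eq_iff_add_eq_0)
      then have "?f x = c" using x by (simp add: vector_smult_assoc)
      then show False using c x by (metis (mono_tags, lifting) image_eqI mem_Collect_eq)
    qed
  qed
qed

text \<open>The coefficients are chosen one at a time. By quasi-homogeneity, the new one has to be avoided
  only at points with \<open>x $ i = 1\<close>, so coordinate \<open>i\<close> is free to carry the real homotopy parameter \<open>t\<close>
  and the forbidden values are the smooth image of a real hyperplane.\<close>

lemma exists_homotopy_to_squares:
  fixes a :: "'n::finite \<Rightarrow> 'n \<Rightarrow> 'n \<Rightarrow> complex" and b :: "'n \<Rightarrow> 'n \<Rightarrow> complex"
  assumes nz: "\<And>x. x \<noteq> 0 \<Longrightarrow> quad_map F a x + lin_map F b x \<noteq> 0" and "T \<subseteq> F"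
  shows "\<exists>h. \<forall>t x. 0 < t \<longrightarrow> t \<le> 1 \<longrightarrow> (\<forall>j\<in>F-T. x $ j = 0) \<longrightarrow> x \<noteq> 0 \<longrightarrow>
    of_real (1 - t) *s quad_map F a x + of_real t *s square_map T h x + lin_map F b x \<noteq> 0"
  using finite[of T] \<open>T \<subseteq> F\<close>
proof (induction T rule: finite_induct)
  case empty
  have "quad_map F a x = 0" if "\<forall>j\<in>F. x $ j = 0" for x
    using that by (simp add: quad_map_def vec_eq_iff)
  then show ?case using nz by (force simp: square_map_def)
next
  case (insert i T)
  then have i: "i \<in> F" "T \<subseteq> F" "i \<notin> T" by auto
  from insert.IH[OF i(2)] obtain h where h: "\<And>t x. 0 < t \<Longrightarrow> t \<le> 1 \<Longrightarrow> \<forall>j\<in>F-T. x $ j = 0 \<Longrightarrow> x \<noteq> 0 \<Longrightarrow>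
    of_real (1 - t) *s quad_map F a x + of_real t *s square_map T h x + lin_map F b x \<noteq> 0"
    by blast
  \<comment> \<open>The map \<open>g\<close> encodes the homotopy at normalised points: coordinate
    \<open>i\<close> of its argument is read as \<open>t\<close>, and \<open>set1\<close> restores
    the true value 1 where the quadratic map needs it. The other two maps do not read coordinate
    \<open>i\<close>, which lies in \<open>F\<close> but not in \<open>T\<close>.\<close>
  define set1 where "set1 = (\<lambda>x :: complex^'n. \<chi> j. if j = i then 1 else x $ j)"
  define g where "g = (\<lambda>x. (1 - x $ i) *s quad_map F a (set1 x) + x $ i *s square_map T h x + lin_map F b x)"
  have set1: "analytic_map set1"
    unfolding analytic_map_iff
  proof
    fix j show "analytic_fun (\<lambda>x. set1 x $ j)"
      by (cases "j = i") (simp_all add: set1_def analytic_fun_intros)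
  qed
  have "analytic_fun (\<lambda>x. quad_map F a (set1 x) $ k)" "analytic_fun (\<lambda>x. square_map T h x $ k)"
      "analytic_fun (\<lambda>x. lin_map F b x $ k)" for k
    using analytic_map_compose[OF set1 analytic_map_quad_map, of F a] analytic_map_square_map[of T h]
      analytic_map_lin_map[of F b] unfolding analytic_map_iff by blast+
  then have "analytic_map g"
    unfolding g_def analytic_map_iff by (auto intro!: analytic_fun_intros)
  then obtain c where c: "\<And>x. Im (x $ i) = 0 \<Longrightarrow> x $ i \<noteq> 0 \<Longrightarrow> g x + x $ i *s c \<noteq> 0"
    by (rule exists_avoiding_value) (rule that)
  define h' where "h' = h(i := c)"
  have sq: "square_map (insert i T) h' x = (x $ i)\<^sup>2 *s c + square_map T h x" for x
  proof -
    have "(\<Sum>j\<in>T. (x $ j)\<^sup>2 *s h' j) = (\<Sum>j\<in>T. (x $ j)\<^sup>2 *s h j)"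
      using i by (intro sum.cong) (auto simp: h'_def)
    then show ?thesis using insert.hyps by (simp add: square_map_def h'_def)
  qed
  show ?case
  proof (intro exI[of _ h'] allI impI)
    fix t :: real and x :: "complex^'n"
    assume t: "0 < t" "t \<le> 1" and x0: "\<forall>j\<in>F - insert i T. x $ j = 0" "x \<noteq> 0"
    let ?G = "\<lambda>x. of_real (1 - t) *s quad_map F a x + of_real t *s square_map (insert i T) h' x + lin_map F b x"
    show "?G x \<noteq> 0"
    proof (cases "x $ i = 0")
      case True
      then have "\<forall>j\<in>F-T. x $ j = 0" using x0 by auto
      from h[OF t this x0(2)] show ?thesis using True by (simp add: sq)
    next
      case False
      define y where "y = quasi_scale F (inverse (x $ i)) x"
      have yi: "y $ i = 1" using False i by (simp add: y_def quasi_scale_def)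
      have Gy: "?G y = (inverse (x $ i))\<^sup>2 *s ?G x"
        unfolding y_def quad_map_scale lin_map_scale square_map_scale[OF insert.prems]
        by (simp add: vec_eq_iff algebra_simps)
      define w where "w = (\<chi> j. if j = i then of_real t else y $ j)"
      have wi: "w $ i = of_real t" by (simp add: w_def)
      have "set1 w = y" using yi by (auto simp: set1_def w_def vec_eq_iff)
      moreover have "square_map T h w = square_map T h y"
        unfolding square_map_def by (intro sum.cong) (use i in \<open>auto simp: w_def\<close>)
      moreover have "lin_map F b w = lin_map F b y"
        unfolding lin_map_def vec_eq_iff vec_lambda_beta by (intro allI sum.cong) (use i in \<open>auto simp: w_def\<close>)
      ultimately have "g w + w $ i *s c = ?G y"
        unfolding g_def sq wi yi by (simp add: vector_add_ldistrib)
      \<comment> \<open>Here \<open>t > 0\<close> is essential, since \<open>c\<close> is avoided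
        only where coordinate \<open>i\<close> of \<open>w\<close> is nonzero.\<close>
      then have "?G y \<noteq> 0" using c[of w] t by (simp add: wi)
      moreover have "?G y = 0" if "?G x = 0"
        unfolding Gy that by (rule vector_smult_rzero)
      ultimately show ?thesis by blast
    qed
  qed
qed

section \<open>The explicit count for the model and its transfer along the homotopy\<close>

lemma card_vec_sign_set:
  fixes S :: "'n::finite \<Rightarrow> complex set"
  shows "card {x :: complex^'n. \<forall>j. x $ j \<in> S j} = (\<Prod>j\<in>UNIV. card (S j))"
proof -
  have "bij_betw vec_lambda (PiE UNIV S) {x :: complex^'n. \<forall>j. x $ j \<in> S j}"
    by (rule bij_betw_byWitness[where f' = vec_nth]) (auto simp: PiE_def)
  from bij_betw_same_card[OF this] show ?thesis by (simp add: card_PiE)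
qed

text \<open>The map is an invertible matrix applied to the coordinatewise squaring
  \<open>s 0\<close>. Replacing each square by the square minus \<open>\<rho>\<^sup>2\<close> splits
  the zero at the origin into the nondegenerate points with \<open>F\<close> coordinates plus or
  minus \<open>\<rho>\<close> and other coordinates 0.\<close>

lemma zero_degree_squares:
  fixes b :: "'n::finite \<Rightarrow> 'n \<Rightarrow> complex"
  assumes nz: "\<And>x. x \<noteq> 0 \<Longrightarrow> square_map F h x + lin_map F b x \<noteq> 0"
    and W: "open W" "bounded W" "0 \<in> W"
  shows "zero_degree (\<lambda>x. square_map F h x + lin_map F b x) W (2 ^ card F)"
proof -
  let ?P = "\<lambda>x. square_map F h x + lin_map F b x"
  define M where "M = (\<chi> i j. if j \<in> F then h j $ i else b i j)"
  define s where "s = (\<lambda>(c::complex) (x::complex^'n). \<chi> j. if j \<in> F then (x $ j)\<^sup>2 - c else x $ j)"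
  have Mv: "(M *v v) $ i = (\<Sum>j\<in>F. h j $ i * v $ j) + (\<Sum>j\<in>-F. b i j * v $ j)" for v i
    by (simp add: matrix_vector_mult_def M_def if_distrib if_distribR sum.If_cases cong: if_cong)
  have P: "?P x = M *v s 0 x" for x
  proof -
    have "(\<Sum>j\<in>F. h j $ i * s 0 x $ j) = (\<Sum>j\<in>F. (x $ j)\<^sup>2 * h j $ i)"
         "(\<Sum>j\<in>-F. b i j * s 0 x $ j) = (\<Sum>j\<in>-F. b i j * x $ j)" for i
      by (intro sum.cong; simp add: s_def)+
    then show ?thesis by (simp add: vec_eq_iff Mv square_map_def lin_map_def)
  qed
  have invM: "invertible M"
    unfolding invertible_left_inverse matrix_left_invertible_ker
  proof (intro allI impI, rule ccontr)
    fix v assume v: "M *v v = 0" "v \<noteq> 0"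
    \<comment> \<open>Square roots pull a kernel vector of \<open>M\<close> back to a nontrivial
      zero of the map, contradicting \<open>nz\<close>.\<close>
    define x where "x = (\<chi> j. if j \<in> F then csqrt (v $ j) else v $ j)"
    have "s 0 x = v" by (simp add: s_def x_def vec_eq_iff)
    then have "?P x = 0" using P v by simp
    then have "x = 0" using nz by blast
    then have "v = 0" by (auto simp: x_def vec_eq_iff split: if_splits)
    then show False using v by simp
  qed
  have as: "analytic_map (s c)" for c
    unfolding analytic_map_iff
  proof
    fix j show "analytic_fun (\<lambda>x. s c x $ j)"
      by (cases "j \<in> F") (simp_all add: s_def analytic_fun_intros)
  qed
  note aM = analytic_map_matrix[of M]
  have aP: "analytic_map ?P" using analytic_map_add[OF analytic_map_square_map analytic_map_lin_map] .
  have "?P x \<noteq> 0" if "x \<in> frontier W" for x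
  proof (rule nz)
    show "x \<noteq> 0" using that W by (auto simp: frontier_def interior_open)
  qed
  note Pnz = this
  obtain N where N: "zero_degree ?P W N" using zero_degree_exists[OF aP W(1,2) Pnz] by blast
  obtain \<eta> where \<eta>: "\<eta> > 0" "\<And>x. x \<in> frontier W \<Longrightarrow> \<eta> \<le> norm (?P x)"
    by (rule frontier_norm_lower_bound[OF W(2) analytic_map_imp_continuous_on[OF aP]], rule Pnz, assumption, rule that)
  obtain e where e: "e > 0" "ball 0 e \<subseteq> W" using W by (meson open_contains_ball)
  define v where "v = M *v (\<chi> j. if j \<in> F then 1 else 0)"
  \<comment> \<open>The bound 1 gives \<open>\<rho>\<^sup>2 \<le> \<rho>\<close>, so the second
    bound keeps the perturbation \<open>\<rho>\<^sup>2 * norm v\<close> below \<open>\<eta>\<close>;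
    the third places all split zeros in \<open>ball 0 e\<close>.\<close>
  define \<rho> where "\<rho> = min (min 1 (\<eta> / (2 * (norm v + 1)))) (e / (2 * (real CARD('n) + 1)))"
  have \<rho>: "\<rho> > 0" "\<rho>\<^sup>2 * norm v < \<eta>" "real CARD('n) * \<rho> < e"
  proof -
    have pos: "norm v + 1 > 0" by (smt (verit) norm_ge_zero)
    then show "\<rho> > 0" using \<eta> e by (simp add: \<rho>_def)
    moreover have "\<rho> \<le> 1" by (simp add: \<rho>_def)
    ultimately have "\<rho>\<^sup>2 \<le> \<rho>" by (simp add: power2_eq_square mult_left_le)
    also have "\<dots> \<le> \<eta> / (2 * (norm v + 1))" by (simp add: \<rho>_def)
    finally have "\<rho>\<^sup>2 * norm v \<le> \<eta> / (2 * (norm v + 1)) * norm v"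
      by (intro mult_right_mono) auto
    also have "\<dots> < \<eta>" using pos \<eta> by (simp add: field_simps add_strict_increasing2)
    finally show "\<rho>\<^sup>2 * norm v < \<eta>" .
    have "real CARD('n) * \<rho> \<le> real CARD('n) * (e / (2 * (real CARD('n) + 1)))"
      by (intro mult_left_mono) (auto simp: \<rho>_def)
    also have "\<dots> < e" using e by (simp add: field_simps add_strict_increasing2)
    finally show "real CARD('n) * \<rho> < e" .
  qed
  let ?c = "of_real (\<rho>\<^sup>2) :: complex"
  let ?p = "\<lambda>x. M *v s ?c x"
  let ?S = "\<lambda>j. if j \<in> F then {of_real \<rho>, - of_real \<rho>} else {0 :: complex}"
  have zeros: "?p x = 0 \<longleftrightarrow> (\<forall>j. x $ j \<in> ?S j)" for x
  proof -
    have "?p x = 0 \<longleftrightarrow> s ?c x = 0"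
      using invM by (metis invertible_left_inverse matrix_left_invertible_ker matrix_vector_mult_0_right)
    also have "\<dots> \<longleftrightarrow> (\<forall>j. x $ j \<in> ?S j)"
      by (auto simp: s_def vec_eq_iff power2_eq_iff)
    finally show ?thesis .
  qed
  have cj: "cjacobian (s ?c) x = (\<chi> i j. if i = j then (if j \<in> F then 2 * x $ j else 1) else 0)" for x
  proof -
    have "cpartial j (\<lambda>x. s ?c x $ i) x = (if i = j then (if j \<in> F then 2 * x $ j else 1) else 0)" for i j
    proof (cases "i \<in> F")
      case True
      then have "cpartial j (\<lambda>x. s ?c x $ i) x = cpartial j (\<lambda>x. (x $ i)\<^sup>2 - ?c) x"
        by (simp add: s_def)
      also have "\<dots> = (if i = j then 2 * x $ j else 0)"
        by (auto simp: cpartial_diff cpartial_mult analytic_fun_nth analytic_fun_const power2_eq_square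
            analytic_fun_intros)
      finally show ?thesis using True by auto
    qed (auto simp: s_def analytic_fun_nth)
    then show ?thesis by (simp add: vec_eq_iff cjacobian_nth)
  qed
  have cjM: "cjacobian ((*v) M) y = M" for y
    by (rule cjacobian_eqI[OF matrix_vector_mult_has_derivative])
  have "nondegenerate_on ?p W"
    unfolding nondegenerate_on_def
  proof (intro ballI impI)
    fix x assume "?p x = 0"
    then have "x $ j \<noteq> 0" if "j \<in> F" for j
      using zeros[of x] that \<rho>(1) by (metis (full_types) insertE neg_equal_0_iff_equal of_real_eq_0_iff
          order_less_irrefl singletonD)
    then have "det (cjacobian (s ?c) x) \<noteq> 0"
      unfolding cj by (subst det_diagonal) (auto simp: prod_zero_iff)
    then show "invertible (cjacobian ?p x)"
      using invM by (simp add: cjacobian_compose[OF as aM] cjM invertible_det_nz det_mul)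
  qed
  moreover have "norm (?p x - ?P x) < norm (?P x)" if "x \<in> frontier W" for x
  proof -
    have "s ?c x = s 0 x - ?c *s (\<chi> j. if j \<in> F then 1 else 0)"
      by (simp add: s_def vec_eq_iff)
    then have "?p x - ?P x = - (?c *s v)"
      by (simp only: P v_def matrix_vector_mult_diff_distrib matrix_vector_mult_scale) simp
    then have "norm (?p x - ?P x) = \<rho>\<^sup>2 * norm v" by (simp add: norm_scale_vec norm_power)
    then show ?thesis using \<rho>(2) \<eta>(2)[OF that] by simp
  qed
  ultimately have "card (zeros_in ?p W) = N"
    using N analytic_map_compose[OF as aM] unfolding zero_degree_def by blast
  moreover have "zeros_in ?p W = {x. \<forall>j. x $ j \<in> ?S j}"
  proof -
    have "x \<in> W" if x: "\<forall>j. x $ j \<in> ?S j" for x :: "complex^'n"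
    proof -
      have "norm (x $ j) \<le> \<rho>" for j
        using spec[OF x, of j] \<rho>(1) by (auto split: if_splits)
      moreover have "norm x \<le> (\<Sum>j\<in>UNIV. norm (x $ j))"
        unfolding norm_vec_def by (rule L2_set_le_sum) simp
      ultimately have "norm x \<le> (\<Sum>j\<in>(UNIV :: 'n set). \<rho>)"
        by (meson order_trans sum_mono)
      then have "norm x < e" using \<rho>(3) by simp
      then show ?thesis using e by auto
    qed
    then show ?thesis using zeros by (auto simp: zeros_in_def)
  qed
  moreover have "card {x :: complex^'n. \<forall>j. x $ j \<in> ?S j} = 2 ^ card F"
  proof -
    have "card (?S j) = (if j \<in> F then 2 else 1)" for j
      using \<rho>(1) by (simp add: card_insert_if)
    then have "card {x :: complex^'n. \<forall>j. x $ j \<in> ?S j} = (\<Prod>j\<in>(UNIV :: 'n set). if j \<in> F then 2 else 1)"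
      by (simp only: card_vec_sign_set)
    then show ?thesis by (simp add: prod.If_cases)
  qed
  ultimately show ?thesis using N by simp
qed

lemma zero_degree_quad_lin:
  fixes a :: "'n::finite \<Rightarrow> 'n \<Rightarrow> 'n \<Rightarrow> complex" and b :: "'n \<Rightarrow> 'n \<Rightarrow> complex"
  assumes nz: "\<And>x. x \<noteq> 0 \<Longrightarrow> quad_map F a x + lin_map F b x \<noteq> 0"
    and W: "open W" "bounded W" "0 \<in> W"
  shows "zero_degree (\<lambda>x. quad_map F a x + lin_map F b x) W (2 ^ card F)"
proof -
  let ?P = "\<lambda>x. quad_map F a x + lin_map F b x"
  obtain h where h: "\<And>t x. 0 < t \<Longrightarrow> t \<le> 1 \<Longrightarrow> x \<noteq> 0 \<Longrightarrow>
    of_real (1 - t) *s quad_map F a x + of_real t *s square_map F h x + lin_map F b x \<noteq> 0"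
    using exists_homotopy_to_squares[OF nz order_refl] by auto
  let ?P1 = "\<lambda>x. square_map F h x + lin_map F b x"
  have "zero_degree ?P1 W (2 ^ card F)"
    by (rule zero_degree_squares[OF _ W]) (use h[of 1] in auto)
  then show ?thesis
  proof (rule zero_degree_homotopy)
    show "analytic_map ?P1" "analytic_map ?P"
      by (intro analytic_map_add analytic_map_square_map analytic_map_lin_map analytic_map_quad_map)+
    fix t :: real and x assume t: "t \<in> {0..1}" and x: "x \<in> frontier W"
    have x0: "x \<noteq> 0" using x W by (auto simp: frontier_def interior_open)
    have eq: "pencil ?P1 ?P (of_real t) x
        = of_real (1 - (1 - t)) *s quad_map F a x + of_real (1 - t) *s square_map F h x + lin_map F b x"
      by (simp add: pencil_def vec_eq_iff algebra_simps)
    show "pencil ?P1 ?P (of_real t) x \<noteq> 0"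
    \<comment> \<open>The homotopy runs from the squares back to the given map. Its endpoint is the
      one parameter not covered by \<open>h\<close>; there the hypothesis \<open>nz\<close>
      applies.\<close>
    proof (cases "t = 1")
      case True
      then show ?thesis using nz[OF x0] by simp
    next
      case False
      then show ?thesis unfolding eq using t x0 by (intro h) auto
    qed
  qed (use W in auto)
qed

section \<open>The quadratic part after inflation\<close>

lemma analytic_map_inflation: "analytic_map (inflation \<kappa>)"
  unfolding analytic_map_iff
proof
  fix i :: 'a
  show "analytic_fun (\<lambda>z. inflation \<kappa> z $ i)"
    by (cases "i \<in> first_coords \<kappa>") (simp_all add: inflation_def analytic_fun_intros)
qed

lemma cpartial_inflation:
  "cpartial k (\<lambda>z. inflation \<kappa> z $ m) z =
    (if m = k then if k \<in> first_coords \<kappa> then 1 else 2 * z $ k else 0)"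
proof (cases "m \<in> first_coords \<kappa>")
  case False
  have "cpartial k (\<lambda>z. (z $ m)\<^sup>2) z = (if m = k then 2 * z $ k else 0)"
    by (auto simp: power2_eq_square cpartial_mult analytic_fun_nth)
  with False show ?thesis by (auto simp: inflation_def)
qed (auto simp: inflation_def analytic_fun_nth)

text \<open>By the chain rule, differentiating in direction \<open>k\<close> multiplies by
  \<open>\<sigma> k\<close>, which is 1 on \<open>F\<close> and \<open>2 * z $ k\<close> elsewhere.
  At the origin the second derivatives of \<open>G\<close> survive only for two indices in
  \<open>F\<close>, while the first derivatives of \<open>G\<close> off \<open>F\<close> reappear,
  doubled, on the diagonal.\<close>

lemma quadratic_part_inflation:
  fixes G :: "complex^'n::{finite,linorder} \<Rightarrow> complex^'n::{finite,linorder}" and \<kappa> :: nat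
  assumes G: "analytic_map G"
  defines "F \<equiv> first_coords \<kappa> :: 'n set"
  shows "quadratic_part (G \<circ> inflation \<kappa>) x =
    quad_map F (\<lambda>i j k. cpartial j (cpartial k (\<lambda>z. G z $ i)) 0 / 2) (inflation \<kappa> x) +
    lin_map F (\<lambda>i k. cpartial k (\<lambda>z. G z $ i) 0) (inflation \<kappa> x)"
proof -
  have aG: "analytic_fun (\<lambda>z. G z $ i)" for i using G by (simp add: analytic_map_iff)
  define \<sigma> where "\<sigma> = (\<lambda>k (z :: (complex, 'n) vec). if k \<in> F then 1 else 2 * z $ k)"
  have a\<sigma>: "analytic_fun (\<sigma> k)" for k
    by (cases "k \<in> F") (simp_all add: \<sigma>_def analytic_fun_intros)
  have c\<sigma>: "cpartial j (\<sigma> k) 0 = (if k \<notin> F \<and> j = k then 2 else 0)" for j k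
    by (cases "k \<in> F") (auto simp: \<sigma>_def analytic_fun_const cpartial_cmult analytic_fun_nth)
  have inf: "cpartial k (\<lambda>z. inflation \<kappa> z $ m) z = (if m = k then \<sigma> k z else 0)" for k m z
    by (simp add: cpartial_inflation \<sigma>_def F_def)
  have comp: "cpartial k (\<lambda>z. u (inflation \<kappa> z)) z = cpartial k u (inflation \<kappa> z) * \<sigma> k z"
    if "analytic_fun u" for u k z
    unfolding cpartial_compose[OF analytic_map_inflation that] inf
    by (simp add: if_distrib cong: if_cong)
  have "cpartial j (cpartial k (\<lambda>z. (G \<circ> inflation \<kappa>) z $ i)) 0 =
      (if j \<in> F \<and> k \<in> F then cpartial j (cpartial k (\<lambda>z. G z $ i)) 0 else 0) +
      (if k \<notin> F \<and> j = k then 2 * cpartial k (\<lambda>z. G z $ i) 0 else 0)" for i j k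
  proof -
    let ?u = "cpartial k (\<lambda>z. G z $ i)"
    have u: "analytic_fun ?u" by (rule analytic_fun_cpartial[OF aG])
    have "cpartial k (\<lambda>z. (G \<circ> inflation \<kappa>) z $ i) = (\<lambda>z. ?u (inflation \<kappa> z) * \<sigma> k z)"
      using comp[OF aG] by (simp add: fun_eq_iff)
    then have "cpartial j (cpartial k (\<lambda>z. (G \<circ> inflation \<kappa>) z $ i)) 0 =
        ?u (inflation \<kappa> 0) * cpartial j (\<sigma> k) 0 + cpartial j ?u (inflation \<kappa> 0) * \<sigma> j 0 * \<sigma> k 0"
      by (simp add: cpartial_mult[OF analytic_fun_compose[OF analytic_map_inflation u] a\<sigma>] comp[OF u])
    moreover have "inflation \<kappa> 0 = (0 :: (complex, 'n) vec)" by (simp add: inflation_def vec_eq_iff)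
    moreover have "\<sigma> k 0 = (if k \<in> F then 1 else 0)" for k by (simp add: \<sigma>_def)
    ultimately show ?thesis by (auto simp: c\<sigma>)
  qed
  note D = this
  have "(\<Sum>j\<in>UNIV. \<Sum>k\<in>UNIV. ((if j \<in> F \<and> k \<in> F then a j k else 0) + (if k \<notin> F \<and> j = k then 2 * b k else 0))
        * x $ j * x $ k) / 2
      = (\<Sum>j\<in>F. \<Sum>k\<in>F. a j k / 2 * inflation \<kappa> x $ j * inflation \<kappa> x $ k) +
        (\<Sum>k\<in>-F. b k * inflation \<kappa> x $ k)" for a :: "'n \<Rightarrow> 'n \<Rightarrow> complex" and b
  proof -
    have 1: "(\<Sum>j\<in>UNIV. \<Sum>k\<in>UNIV. (if j \<in> F \<and> k \<in> F then a j k else 0) * x $ j * x $ k)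
        = (\<Sum>j\<in>F. \<Sum>k\<in>F. a j k * x $ j * x $ k)"
    proof -
      have "(\<Sum>k\<in>UNIV. (if j \<in> F \<and> k \<in> F then a j k else 0) * x $ j * x $ k)
          = (if j \<in> F then \<Sum>k\<in>F. a j k * x $ j * x $ k else 0)" for j
        by (cases "j \<in> F") (simp_all add: if_distribR if_distrib sum.If_cases cong: if_cong)
      then show ?thesis by (simp add: sum.If_cases)
    qed
    have 2: "(\<Sum>j\<in>UNIV. \<Sum>k\<in>UNIV. (if k \<notin> F \<and> j = k then 2 * b k else 0) * x $ j * x $ k)
        = (\<Sum>k\<in>-F. 2 * b k * x $ k * x $ k)"
    proof -
      have "(\<Sum>k\<in>UNIV. (if k \<notin> F \<and> j = k then 2 * b k else 0) * x $ j * x $ k)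
          = (\<Sum>k\<in>UNIV. if k = j then (if j \<notin> F then 2 * b j * x $ j * x $ j else 0) else 0)" for j
        by (intro sum.cong) auto
      then show ?thesis by (simp add: sum.If_cases Compl_eq)
    qed
    have 3: "(\<Sum>j\<in>F. \<Sum>k\<in>F. a j k / 2 * inflation \<kappa> x $ j * inflation \<kappa> x $ k)
        = (\<Sum>j\<in>F. \<Sum>k\<in>F. a j k * x $ j * x $ k) / 2"
      by (simp add: inflation_def F_def sum_divide_distrib)
    have 4: "(\<Sum>k\<in>-F. b k * inflation \<kappa> x $ k) = (\<Sum>k\<in>-F. 2 * b k * x $ k * x $ k) / 2"
      by (simp add: inflation_def F_def sum_divide_distrib power2_eq_square mult.assoc)
    show ?thesis
      unfolding distrib_right sum.distrib 1 2 3 4 by (rule add_divide_distrib)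
  qed
  then show ?thesis
    unfolding quadratic_part_def D by (simp add: vec_eq_iff quad_map_def lin_map_def)
qed

lemma quadratic_part_scale: "quadratic_part h (r *s x) = r\<^sup>2 *s quadratic_part h x"
proof -
  have "(\<Sum>j\<in>UNIV. \<Sum>k\<in>UNIV. a j k * (r *s x) $ j * (r *s x) $ k)
      = r\<^sup>2 * (\<Sum>j\<in>UNIV. \<Sum>k\<in>UNIV. a j k * x $ j * x $ k)" for a
    by (simp add: sum_distrib_left power2_eq_square mult_ac)
  then show ?thesis by (simp add: quadratic_part_def vec_eq_iff)
qed

section \<open>Orthogonal projections\<close>

lemma inner_eq_Re_hermitian_inner: "z \<bullet> w = Re (hermitian_inner z w)"
  by (simp add: inner_vec_def hermitian_inner_def inner_complex_def)

lemma hermitian_inner_self_eq_0: "hermitian_inner d d = 0 \<Longrightarrow> d = 0"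
  by (metis inner_eq_Re_hermitian_inner inner_eq_zero_iff zero_complex.sel(1))

lemma hermitian_inner_add: "hermitian_inner (x + y) v = hermitian_inner x v + hermitian_inner y v"
  and hermitian_inner_diff: "hermitian_inner (x - y) v = hermitian_inner x v - hermitian_inner y v"
  and hermitian_inner_scale: "hermitian_inner (c *s x) v = c * hermitian_inner x v"
  and hermitian_inner_scale_right: "hermitian_inner x (c *s v) = cnj c * hermitian_inner x v"
  by (simp_all add: hermitian_inner_def sum.distrib sum_subtractf algebra_simps sum_distrib_left)

lemma orth_proj_eqI:
  assumes V: "vec.subspace V" and p: "p \<in> V" "\<And>v. v \<in> V \<Longrightarrow> hermitian_inner (x - p) v = 0"
  shows "orth_proj V x = p"
  unfolding orth_proj_def
proof (rule the_equality)
  fix q assume q: "q \<in> V \<and> (\<forall>v\<in>V. hermitian_inner (x - q) v = 0)"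
  then have d: "p - q \<in> V" using p V by (simp add: vec.subspace_diff)
  then have "hermitian_inner (x - q) (p - q) - hermitian_inner (x - p) (p - q) = 0"
    using p q by simp
  then have "hermitian_inner (p - q) (p - q) = 0"
    by (simp flip: hermitian_inner_diff)
  then show "q = p" using hermitian_inner_self_eq_0 by (metis eq_iff_diff_eq_0)
qed (use p in auto)

text \<open>Existence comes from the real orthogonal decomposition. Real orthogonality to both
  \<open>v\<close> and its multiple by the imaginary unit kills the real and imaginary parts of the
  Hermitian product.\<close>

lemma orth_proj_props:
  assumes V: "vec.subspace V"
  shows "orth_proj V x \<in> V" "v \<in> V \<Longrightarrow> hermitian_inner (x - orth_proj V x) v = 0"
proof -
  have r: "c *\<^sub>R v = complex_of_real c *s v" for c and v :: "(complex, 'a) vec"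
    unfolding vec_eq_iff vector_scaleR_component vector_smult_component
    by (simp add: scaleR_conv_of_real)
  have "subspace V"
    using V unfolding subspace_def r by (simp add: vec.subspace_def)
  then have "span V = V" by simp
  obtain p z where pz: "p \<in> V" "\<And>w. w \<in> V \<Longrightarrow> orthogonal z w" "x = p + z"
    using orthogonal_subspace_decomp_exists[of V x] unfolding \<open>span V = V\<close> by metis
  have "hermitian_inner (x - p) v = 0" if v: "v \<in> V" for v
  proof -
    have "\<i> *s v \<in> V" using V v by (simp add: vec.subspace_scale)
    then have "Re (hermitian_inner z v) = 0" "Re (hermitian_inner z (\<i> *s v)) = 0"
      using pz(2) v by (simp_all add: orthogonal_def inner_eq_Re_hermitian_inner)
    then show ?thesis using pz(3) by (simp add: hermitian_inner_scale_right complex_eq_iff)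
  qed
  with orth_proj_eqI[OF V pz(1)] pz(1)
  show "orth_proj V x \<in> V" "v \<in> V \<Longrightarrow> hermitian_inner (x - orth_proj V x) v = 0"
    by auto
qed

lemma analytic_map_orth_proj:
  assumes V: "vec.subspace V"
  shows "analytic_map (orth_proj V)"
proof -
  have "Vector_Spaces.linear (*s) (*s) (orth_proj V)"
    unfolding Vector_Spaces.linear_def module_hom_def module_hom_axioms_def
  proof (intro conjI allI vec.vector_space_axioms vec.module_axioms)
    show "orth_proj V (x + y) = orth_proj V x + orth_proj V y" for x y
    proof (rule orth_proj_eqI[OF V])
      have "x + y - (orth_proj V x + orth_proj V y) = (x - orth_proj V x) + (y - orth_proj V y)"
        by simp
      then show "hermitian_inner (x + y - (orth_proj V x + orth_proj V y)) v = 0" if "v \<in> V" for v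
        by (simp only: hermitian_inner_add orth_proj_props(2)[OF V that]) simp
    qed (simp add: V orth_proj_props vec.subspace_add)
    show "orth_proj V (c *s x) = c *s orth_proj V x" for c x
    proof (rule orth_proj_eqI[OF V])
      have "c *s x - c *s orth_proj V x = c *s (x - orth_proj V x)"
        by (simp add: vector_ssub_ldistrib)
      then show "hermitian_inner (c *s x - c *s orth_proj V x) v = 0" if "v \<in> V" for v
        using orth_proj_props(2)[OF V that, of x] by (simp only: hermitian_inner_scale) simp
    qed (simp add: V orth_proj_props vec.subspace_scale)
  qed
  then have "orth_proj V = (*v) (matrix (orth_proj V))"
    by (simp add: matrix_works fun_eq_iff)
  then show ?thesis using analytic_map_matrix by metis
qed

section \<open>Invertible affine changes of coordinates\<close>

lemma
  assumes A: "analytic_map A" and C: "analytic_map C" and inv: "\<And>x. C (A x) = x" "\<And>x. A (C x) = x"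
    and W: "open W"
  shows open_analytic_iso: "open (A ` W)"
    and closure_analytic_iso: "closure (A ` W) = A ` closure W"
    and frontier_analytic_iso: "frontier (A ` W) = A ` frontier W"
proof -
  have "A ` W = C -` W" by (auto simp: inv) (metis image_eqI inv(2))
  then show o: "open (A ` W)"
    using W analytic_map_imp_continuous_on[OF C, of UNIV] by (simp add: open_vimage)
  have "A ` closure W \<subseteq> closure (A ` W)"
    by (intro image_closure_subset analytic_map_imp_continuous_on A) (auto intro: subsetD[OF closure_subset])
  moreover have "C ` closure (A ` W) \<subseteq> closure W"
    by (intro image_closure_subset analytic_map_imp_continuous_on C)
      (auto simp: inv intro: subsetD[OF closure_subset])
  then have "closure (A ` W) \<subseteq> A ` closure W"
    using inv(2) by (metis image_eqI image_subset_iff subsetI)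
  ultimately show c: "closure (A ` W) = A ` closure W" by simp
  have "inj A" using inv(1) by (metis injI)
  then show "frontier (A ` W) = A ` frontier W"
    using o W by (simp add: frontier_def interior_open c image_set_diff)
qed

text \<open>Transporting the model to the original coordinates allows \<open>f\<close> itself to be
  compared with it, so multiplicities of zeros never have to be transported through
  \<open>A\<close>.\<close>

lemma zero_degree_compose:
  fixes A C P :: "complex^'n::finite \<Rightarrow> (complex, 'n) vec"
  assumes A: "analytic_map A" and C: "analytic_map C" and inv: "\<And>x. C (A x) = x" "\<And>x. A (C x) = x"
    and W: "open W" and invA: "\<And>x. invertible (cjacobian A x)" and N: "zero_degree P W N"
  shows "zero_degree (\<lambda>x. P (C x)) (A ` W) N"
  unfolding zero_degree_def
proof (intro allI impI)
  fix p assume p: "analytic_map p" "nondegenerate_on p (A ` W)"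
    and lt: "\<forall>x\<in>frontier (A ` W). norm (p x - P (C x)) < norm (P (C x))"
  let ?q = "\<lambda>x. p (A x)"
  have "analytic_map ?q" by (rule analytic_map_compose[OF A p(1)])
  moreover have "nondegenerate_on ?q W"
    using p(2) invA unfolding nondegenerate_on_def
    by (auto simp: cjacobian_compose[OF A p(1)] intro: invertible_mult)
  moreover have "\<forall>x\<in>frontier W. norm (?q x - P x) < norm (P x)"
    using lt by (simp add: frontier_analytic_iso[OF A C inv W] inv)
  ultimately have *: "finite (zeros_in ?q W) \<and> card (zeros_in ?q W) = N"
    using N unfolding zero_degree_def by blast
  have "zeros_in p (A ` W) = A ` zeros_in ?q W" by (auto simp: zeros_in_def)
  moreover have "inj A" using inv(1) by (metis injI)
  ultimately show "finite (zeros_in p (A ` W)) \<and> card (zeros_in p (A ` W)) = N"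
    using * by (simp add: card_image inj_on_subset)
qed

section \<open>Mixed norm balls\<close>

text \<open>Squaring a coordinate turns its first power in the mixed norm into the square in the
  Euclidean one. Hence Euclidean spheres upstairs correspond to mixed spheres downstairs.\<close>

lemma mixed_norm_inflation: "mixed_norm \<kappa> (inflation \<kappa> v) = norm v"
proof -
  have "(\<Sum>i\<in>first_coords \<kappa>. (norm (inflation \<kappa> v $ i))\<^sup>2) = (\<Sum>i\<in>first_coords \<kappa>. (norm (v $ i))\<^sup>2)"
    "(\<Sum>i\<in>- first_coords \<kappa>. norm (inflation \<kappa> v $ i)) = (\<Sum>i\<in>- first_coords \<kappa>. (norm (v $ i))\<^sup>2)"
    by (simp_all add: inflation_def norm_power)
  moreover have "(\<Sum>i\<in>first_coords \<kappa>. (norm (v $ i))\<^sup>2) + (\<Sum>i\<in>- first_coords \<kappa>. (norm (v $ i))\<^sup>2)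
      = (\<Sum>i\<in>UNIV. (norm (v $ i))\<^sup>2)"
    by (subst sum.union_disjoint[symmetric]) (auto simp: Un_commute Compl_partition2)
  ultimately show ?thesis by (simp add: mixed_norm_def norm_vec_def L2_set_def)
qed

lemma inflation_surj: obtains v where "inflation \<kappa> v = x"
proof
  show "inflation \<kappa> (\<chi> i. if i \<in> first_coords \<kappa> then x $ i else csqrt (x $ i)) = x"
    by (simp add: inflation_def vec_eq_iff)
qed

lemma continuous_on_mixed_norm: "continuous_on S (mixed_norm \<kappa>)"
  unfolding mixed_norm_def by (intro continuous_intros)

lemma open_mixed_ball_interior: "open {x. mixed_norm \<kappa> x < \<epsilon>}"
  by (intro open_Collect_less continuous_on_mixed_norm continuous_on_const)

lemma mixed_norm_0: "mixed_norm \<kappa> 0 = 0"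
  by (simp add: mixed_norm_def)

lemma bounded_mixed_ball: "bounded (mixed_ball \<kappa> \<epsilon> :: (complex^'n::{finite,linorder}) set)"
proof -
  have "mixed_ball \<kappa> \<epsilon> \<subseteq> inflation \<kappa> ` cball (0 :: (complex, 'n) vec) \<epsilon>"
  proof
    fix x :: "(complex, 'n) vec" assume "x \<in> mixed_ball \<kappa> \<epsilon>"
    moreover obtain v where "inflation \<kappa> v = x" by (rule inflation_surj)
    ultimately show "x \<in> inflation \<kappa> ` cball 0 \<epsilon>"
      using mixed_norm_inflation[of \<kappa> v] by (auto simp: mixed_ball_def)
  qed
  moreover have "compact (inflation \<kappa> ` cball (0 :: (complex, 'n) vec) \<epsilon>)"
    by (intro compact_continuous_image analytic_map_imp_continuous_on analytic_map_inflation compact_cball)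
  ultimately show ?thesis using bounded_subset compact_imp_bounded by blast
qed

text \<open>The mixed norm is not homogeneous, so boundary points are not approximated by scaling;
  density is carried over from the Euclidean ball by the continuous surjection
  \<open>inflation \<kappa>\<close>.\<close>

lemma closure_mixed_ball:
  assumes "\<epsilon> > 0"
  shows "closure {x :: complex^'n::{finite,linorder}. mixed_norm \<kappa> x < \<epsilon>} = mixed_ball \<kappa> \<epsilon>"
proof
  show "closure {x :: (complex, 'n) vec. mixed_norm \<kappa> x < \<epsilon>} \<subseteq> mixed_ball \<kappa> \<epsilon>"
    unfolding mixed_ball_def
    by (intro closure_minimal closed_Collect_le continuous_on_mixed_norm continuous_on_const) auto
  show "mixed_ball \<kappa> \<epsilon> \<subseteq> closure {x :: (complex, 'n) vec. mixed_norm \<kappa> x < \<epsilon>}"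
  proof
    fix x :: "(complex, 'n) vec" assume x: "x \<in> mixed_ball \<kappa> \<epsilon>"
    obtain v where v: "inflation \<kappa> v = x" by (rule inflation_surj)
    have nv: "norm v \<le> \<epsilon>" using x v mixed_norm_inflation[of \<kappa> v] by (simp add: mixed_ball_def)
    then have "v \<in> closure (ball 0 \<epsilon>)" using assms by simp
    moreover have "inflation \<kappa> ` closure (ball 0 \<epsilon>) \<subseteq> closure {x :: (complex, 'n) vec. mixed_norm \<kappa> x < \<epsilon>}"
      by (intro image_closure_subset analytic_map_imp_continuous_on analytic_map_inflation)
        (auto simp: mixed_norm_inflation intro: subsetD[OF closure_subset])
    ultimately show "x \<in> closure {x. mixed_norm \<kappa> x < \<epsilon>}" using v by auto
  qed
qed

lemma frontier_mixed_ball: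
  assumes "\<epsilon> > 0"
  shows "frontier {x :: complex^'n::{finite,linorder}. mixed_norm \<kappa> x < \<epsilon>} = {x. mixed_norm \<kappa> x = \<epsilon>}"
  unfolding frontier_def closure_mixed_ball[OF assms] interior_open[OF open_mixed_ball_interior]
  by (auto simp: mixed_ball_def)

text \<open>The rank function counting smaller indices is strictly increasing, hence a bijection
  onto the numbers below \<open>CARD('n)\<close>.\<close>

lemma card_first_coords:
  assumes "\<kappa> \<le> CARD('n::{finite,linorder})"
  shows "card (first_coords \<kappa> :: 'n set) = \<kappa>"
proof -
  let ?r = "\<lambda>i :: 'n. card {j. j < i}"
  have less: "?r i < ?r k" if "i < k" for i k
    by (rule psubset_card_mono) (use that in auto)
  have inj: "inj ?r"
  proof (rule injI)
    fix i k assume "?r i = ?r k"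
    then show "i = k" using less[of i k] less[of k i] by (cases i k rule: linorder_cases) auto
  qed
  moreover have "range ?r \<subseteq> {..<CARD('n)}"
  proof
    fix m assume "m \<in> range ?r"
    then obtain i where "m = ?r i" by blast
    moreover have "?r i < CARD('n)" by (rule psubset_card_mono) auto
    ultimately show "m \<in> {..<CARD('n)}" by simp
  qed
  ultimately have "range ?r = {..<CARD('n)}"
    by (intro card_subset_eq) (auto simp: card_image)
  then have range: "range ?r = {..<CARD('n)}" .
  have "?r ` first_coords \<kappa> = {..<\<kappa>}"
  proof
    show "?r ` first_coords \<kappa> \<subseteq> {..<\<kappa>}" by (simp add: image_subset_iff first_coords_def)
    show "{..<\<kappa>} \<subseteq> ?r ` first_coords \<kappa>"
    proof
      fix m assume m: "m \<in> {..<\<kappa>}"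
      then have "m \<in> range ?r" unfolding range using assms by simp
      then obtain i where i: "m = ?r i" by (rule rangeE)
      then have "i \<in> first_coords \<kappa>" using m by (simp add: first_coords_def)
      with i show "m \<in> ?r ` first_coords \<kappa>" by (simp add: image_iff) blast
    qed
  qed
  then show ?thesis
    using card_image[OF inj_on_subset[OF inj subset_UNIV], of "first_coords \<kappa>"] by simp
qed

theorem corollary2p1:
  fixes f g A Q :: "complex^'n::{finite,linorder} \<Rightarrow> complex^'n::{finite,linorder}"
    and y :: "complex^'n::{finite,linorder}"
    and V :: "(complex^'n::{finite,linorder}) set"
    and \<kappa> :: nat
    and c \<epsilon> :: real
  assumes "analytic_map f"
    and "vec.subspace V" and "vec.dim V = \<kappa>"
    and "g = (\<lambda>x. f x - f y - cjacobian f y *v orth_proj V (x - y))"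
    and "invertible_affine A"
    and "(g \<circ> A) 0 = 0"
    and "{v. cjacobian (g \<circ> A) 0 *v v = 0} = vec.span ((\<lambda>i. axis i 1) ` first_coords \<kappa>)"
    and "Q = quadratic_part (g \<circ> A \<circ> inflation \<kappa>)"
    and "c > 0" and "\<epsilon> > 0"
    and "\<And>x. norm x = \<epsilon> \<Longrightarrow> norm ((f \<circ> A \<circ> inflation \<kappa>) x - Q x) \<le> c * \<epsilon>\<^sup>2"
    and "\<And>x. norm x = 1 \<Longrightarrow> norm (Q x) \<ge> c"
  shows "zero_count f (A ` mixed_ball \<kappa> \<epsilon>) \<ge> 2 ^ \<kappa> \<and>
         ((\<forall>x. mixed_norm \<kappa> x = \<epsilon> \<longrightarrow> f (A x) \<noteq> 0) \<longrightarrow>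
            zero_count f (A ` mixed_ball \<kappa> \<epsilon>) = 2 ^ \<kappa>)"
proof -
  note f = assms(1) and close = assms(11)
  define F :: "'n set" where "F = first_coords \<kappa>"
  \<comment> \<open>A subspace dimension is at most \<open>CARD('n)\<close>, so enough coordinates
    exist.\<close>
  have cardF: "card F = \<kappa>"
    unfolding F_def using assms(3) dim_subset_UNIV_cart_gen[of V] by (intro card_first_coords) simp
  obtain M b where M: "invertible M" and A: "A = (\<lambda>x. M *v x + b)"
    using assms(5) unfolding invertible_affine_def by blast
  obtain M' where M': "M ** M' = mat 1" "M' ** M = mat 1" using M unfolding invertible_def by blast
  define C where "C = (\<lambda>x. M' *v (x - b))"
  have translate: "analytic_map (\<lambda>x :: (complex, 'n) vec. x + v)" "analytic_map (\<lambda>x :: (complex, 'n) vec. x - v)" for v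
    by (auto simp: analytic_map_iff intro!: analytic_fun_intros)
  have aA: "analytic_map A"
    unfolding A by (rule analytic_map_compose[OF analytic_map_matrix translate(1)])
  have aC: "analytic_map C"
    unfolding C_def by (rule analytic_map_compose[OF translate(2) analytic_map_matrix])
  have inv: "C (A x) = x" "A (C x) = x" for x
    by (simp_all add: A C_def matrix_vector_mul_assoc M')
  have "cjacobian A x = M" for x
    unfolding A by (rule cjacobian_eqI)
      (rule has_derivative_eq_rhs[OF has_derivative_add[OF matrix_vector_mult_has_derivative has_derivative_const]], simp)
  then have invA: "invertible (cjacobian A x)" for x using M by simp
  have ag: "analytic_map g"
  proof -
    have "analytic_map (\<lambda>x. cjacobian f y *v orth_proj V (x - y))"
      by (rule analytic_map_compose[OF analytic_map_compose[OF translate(2) analytic_map_orth_proj[OF assms(2)]]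
            analytic_map_matrix])
    then show ?thesis using f unfolding assms(4) analytic_map_iff
      by (auto intro!: analytic_fun_intros)
  qed
  then have aG: "analytic_map (g \<circ> A)" using analytic_map_compose[OF aA] by (simp add: o_def)
  define P where "P = (\<lambda>z. quad_map F (\<lambda>i j k. cpartial j (cpartial k (\<lambda>z. (g \<circ> A) z $ i)) 0 / 2) z +
      lin_map F (\<lambda>i k. cpartial k (\<lambda>z. (g \<circ> A) z $ i) 0) z)"
  have Q: "Q x = P (inflation \<kappa> x)" for x
    unfolding assms(8) P_def F_def by (rule quadratic_part_inflation[OF aG])
  \<comment> \<open>Hypothesis (2) on the unit sphere extends to all radii because \<open>Q\<close>
    is homogeneous of degree 2; at radius \<open>\<epsilon>\<close> it matches the right-hand side
    of (1).\<close>
  have Qlow: "c * (norm x)\<^sup>2 \<le> norm (Q x)" for x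
  proof (cases "x = 0")
    case False
    define u where "u = complex_of_real (inverse (norm x)) *s x"
    have "norm u = 1" using False by (simp add: u_def norm_scale_vec norm_inverse)
    moreover have "Q x = (complex_of_real (norm x))\<^sup>2 *s Q u"
    proof -
      have "x = complex_of_real (norm x) *s u" using False by (simp add: u_def vector_smult_assoc)
      then show ?thesis unfolding assms(8) by (metis quadratic_part_scale)
    qed
    ultimately show ?thesis using assms(12)[of u]
      by (simp add: norm_scale_vec norm_power mult.commute mult_right_mono)
  qed simp
  have Pnz: "P z \<noteq> 0" if "z \<noteq> 0" for z
  proof -
    obtain x where x: "inflation \<kappa> x = z" by (rule inflation_surj)
    have "x \<noteq> 0"
    proof
      assume "x = 0"
      then have "z = 0" unfolding x[symmetric] by (simp add: inflation_def vec_eq_iff)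
      then show False using that by simp
    qed
    then have "c * (norm x)\<^sup>2 > 0" using assms(9) by simp
    then show ?thesis using Qlow[of x] Q[of x] x by auto
  qed
  define W where "W = {x :: (complex, 'n) vec. mixed_norm \<kappa> x < \<epsilon>}"
  have "W \<subseteq> mixed_ball \<kappa> \<epsilon>" by (auto simp: W_def mixed_ball_def)
  then have W: "open W" "bounded W" "0 \<in> W"
    using assms(10) bounded_subset[OF bounded_mixed_ball]
    by (auto simp: W_def open_mixed_ball_interior mixed_norm_0)
  note iso = aA aC inv W(1)
  have "zero_degree P W (2 ^ \<kappa>)"
    using zero_degree_quad_lin[OF _ W] Pnz unfolding P_def cardF[symmetric] by blast
  then have deg: "zero_degree (\<lambda>x. P (C x)) (A ` W) (2 ^ \<kappa>)"
    by (rule zero_degree_compose[OF iso invA])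
  have aP: "analytic_map P"
    unfolding P_def by (intro analytic_map_add analytic_map_quad_map analytic_map_lin_map)
  have front: "frontier (A ` W) = A ` {x. mixed_norm \<kappa> x = \<epsilon>}"
    unfolding frontier_analytic_iso[OF iso] unfolding W_def frontier_mixed_ball[OF assms(10)] ..
  have clos: "closure (A ` W) = A ` mixed_ball \<kappa> \<epsilon>"
    unfolding closure_analytic_iso[OF iso] unfolding W_def closure_mixed_ball[OF assms(10)] ..
  have bdd: "bounded (A ` W)"
  proof -
    have "compact (A ` closure W)"
      using W(2) by (intro compact_continuous_image analytic_map_imp_continuous_on aA) simp
    then show ?thesis
      by (metis bounded_subset closure_subset compact_imp_bounded image_mono)
  qed
  \<comment> \<open>A frontier point is \<open>A (inflation \<kappa> x)\<close> with
    \<open>norm x = \<epsilon>\<close>, where (1) and the lower bound for \<open>Q\<close>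
    meet.\<close>
  have bound: "norm (f z - P (C z)) \<le> norm (P (C z))" and hnz: "P (C z) \<noteq> 0"
    if z: "z \<in> frontier (A ` W)" for z
  proof -
    obtain w where w: "mixed_norm \<kappa> w = \<epsilon>" "z = A w" using z front by blast
    obtain x where x: "inflation \<kappa> x = w" by (rule inflation_surj)
    have nx: "norm x = \<epsilon>" using w x mixed_norm_inflation[of \<kappa> x] by simp
    have "norm (f z - P (C z)) = norm ((f \<circ> A \<circ> inflation \<kappa>) x - Q x)"
      by (simp add: w inv x Q)
    also have "\<dots> \<le> c * \<epsilon>\<^sup>2" by (rule close[OF nx])
    also have "\<dots> \<le> norm (P (C z))" using Qlow[of x] by (simp add: nx Q x w inv)
    finally show "norm (f z - P (C z)) \<le> norm (P (C z))" .
    have "w \<noteq> 0" using w(1) assms(10) mixed_norm_0[of \<kappa>, where 'a = 'n] by auto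
    then show "P (C z) \<noteq> 0" using Pnz by (simp add: w inv)
  qed
  have enat: "enat (2 ^ \<kappa>) = 2 ^ \<kappa>"
    by (metis of_nat_eq_enat of_nat_numeral of_nat_power)
  note count = zero_count_closure[OF f analytic_map_compose[OF aC aP] open_analytic_iso[OF iso] bdd deg hnz bound]
  show ?thesis
  proof (intro conjI impI)
    show "2 ^ \<kappa> \<le> zero_count f (A ` mixed_ball \<kappa> \<epsilon>)"
      using count(1) by (simp add: enat clos)
    assume "\<forall>x. mixed_norm \<kappa> x = \<epsilon> \<longrightarrow> f (A x) \<noteq> 0"
    then have "f z \<noteq> 0" if "z \<in> frontier (A ` W)" for z using that front by auto
    then show "zero_count f (A ` mixed_ball \<kappa> \<epsilon>) = 2 ^ \<kappa>"
      using count(2) by (simp add: enat clos)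
  qed
qed

end
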